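(* Let $e\ge2$ and $\alpha_e=1-2e^{-1}$. Under the Plancherel measure $\mathrm{Pl}_n$, as $n\to+\infty$, \[\inf\{s\in\mathbb R:\tilde\omega_{\mathrm{reg}_e(\lambda)}(s)\ne|s|\}\to-2\quad\text{and}\quad \sup\{s\in\mathbb R:\tilde\omega_{\mathrm{reg}_e(\lambda)}(s)\ne|s|\}\to s_{\alpha_e}(\Omega)\] in probability.
   Context: Partitions: a partition of $n$ is a non-increasing sequence $\lambda=(\lambda_1\ge\dots\ge\lambda_h>0)$ of positive integers with sum $n$; its Young diagram is $Y(\lambda)=\{(a,b)\in\mathbb Z_{\ge1}^2:1\le a\le h,\ 1\le b\le\lambda_a\}$. The Plancherel measure is $\mathrm{Pl}_n(\lambda)=(\#\mathrm{Std}(\lambda))^2/n!$, with $\mathrm{Std}(\lambda)$ the set of standard Young tableaux of shape $\lambda$. Russian convention: node $(a,b)$ corresponds to the closed square with vertices $(a-b,a+b),(a-b\pm1,a+b-1),(a-b,a+b-2)$; $\omega_\lambda(x)=\max(|x|,\sup\{y:(x,y)\text{ lies in one of these squares}\})$, and $\tilde\omega_\lambda(s)=n^{-1/2}\omega_\lambda(s\sqrt n)$ for $\lambda$ a partition of $n$. $e$-regularisation: the $e$-ladder number of a node $(a,b)$ is $a+(e-1)(b-1)$; $\mathrm{reg}_e(\lambda)$ is the partition obtained by moving each node of $Y(\lambda)$ to the highest possible position (smallest row index) among nodes of the same ladder number. $\Omega(s)=\frac2\pi(s\arcsin\frac s2+\sqrt{4-s^2})$ for $|s|\le2$, $\Omega(s)=|s|$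 otherwise. For $\alpha\in[0,1)$: $F_\alpha(s)=\Omega(s)-\alpha s$, $x_\alpha^+=(\Omega')^{-1}(\alpha)\in[0,2)$ (inverse of $\Omega':[-2,2]\to[-1,1]$), and $s_\alpha(\Omega)=(1-\alpha)^{-1}F_\alpha(x_\alpha^+)$. *)

theory Defs
  imports "HOL-Analysis.Analysis"
begin

definition is_partition :: "nat \<Rightarrow> nat list \<Rightarrow> bool" where
  "is_partition n lam \<longleftrightarrow> sorted_wrt (\<ge>) lam \<and> (\<forall>x\<in>set lam. 0 < x) \<and> sum_list lam = n"

definition partitions :: "nat \<Rightarrow> nat list set" where
  "partitions n = {lam. is_partition n lam}"

definition young :: "nat list \<Rightarrow> (nat \<times> nat) set" where
  "young lam = {(a, b). 1 \<le> a \<and> a \<le> length lam \<and> 1 \<le> b \<and> b \<le> lam ! (a - 1)}"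

definition std :: "nat list \<Rightarrow> ((nat \<times> nat) \<Rightarrow> nat) set" where
  "std lam = {T. bij_betw T (young lam) {1..sum_list lam}
     \<and> (\<forall>a b. (a, b) \<in> young lam \<and> (a, Suc b) \<in> young lam \<longrightarrow> T (a, b) < T (a, Suc b))
     \<and> (\<forall>a b. (a, b) \<in> young lam \<and> (Suc a, b) \<in> young lam \<longrightarrow> T (a, b) < T (Suc a, b))
     \<and> (\<forall>p. p \<notin> young lam \<longrightarrow> T p = 0)}"

definition plancherel :: "nat \<Rightarrow> nat list \<Rightarrow> real" where
  "plancherel n lam = (real (card (std lam)))^2 / fact n"

definition ladder :: "nat \<Rightarrow> nat \<times> nat \<Rightarrow> nat" where
  "ladder e p = fst p + (e - 1) * (snd p - 1)"

definition ladder_positions :: "nat \<Rightarrow> nat \<Rightarrow> (nat \<times> nat) set" where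
  "ladder_positions e l = {(a, b). 1 \<le> a \<and> 1 \<le> b \<and> ladder e (a, b) = l}"

text \<open>Moving the nodes of each ladder to the highest possible positions: a position on
  ladder l is occupied iff the number of positions of that ladder strictly higher
  (smaller row index) is less than the number of nodes of lam on ladder l.\<close>
definition reg_nodes :: "nat \<Rightarrow> nat list \<Rightarrow> (nat \<times> nat) set" where
  "reg_nodes e lam = {(a, b). 1 \<le> a \<and> 1 \<le> b \<and>
      card {q \<in> ladder_positions e (ladder e (a, b)). fst q < a}
        < card {q \<in> young lam. ladder e q = ladder e (a, b)}}"

definition reg :: "nat \<Rightarrow> nat list \<Rightarrow> nat list" where
  "reg e lam = takeWhile (\<lambda>k. 0 < k)
     (map (\<lambda>a. card {b. (a, b) \<in> reg_nodes e lam}) [1..<Suc (sum_list lam)])"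

text \<open>The closed square of node (a,b), with vertices (a-b, a+b), (a-b+-1, a+b-1), (a-b, a+b-2).\<close>
definition node_square :: "nat \<times> nat \<Rightarrow> (real \<times> real) set" where
  "node_square p = {(x, y). \<bar>x - (real (fst p) - real (snd p))\<bar>
                            + \<bar>y - (real (fst p) + real (snd p) - 1)\<bar> \<le> 1}"

definition omega :: "nat list \<Rightarrow> real \<Rightarrow> real" where
  "omega lam x = (let S = {y. \<exists>p\<in>young lam. (x, y) \<in> node_square p}
                  in if S = {} then \<bar>x\<bar> else max \<bar>x\<bar> (Sup S))"

definition omega_tilde :: "nat list \<Rightarrow> real \<Rightarrow> real" where
  "omega_tilde lam s = omega lam (s * sqrt (real (sum_list lam))) / sqrt (real (sum_list lam))"

definition Omega :: "real \<Rightarrow> real" where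
  "Omega s = (if \<bar>s\<bar> \<le> 2 then 2 / pi * (s * arcsin (s / 2) + sqrt (4 - s^2)) else \<bar>s\<bar>)"

definition F_alpha :: "real \<Rightarrow> real \<Rightarrow> real" where
  "F_alpha \<alpha> s = Omega s - \<alpha> * s"

definition x_plus :: "real \<Rightarrow> real" where
  "x_plus \<alpha> = (THE x. x \<in> {-2..2} \<and> deriv Omega x = \<alpha>)"

definition s_alpha :: "real \<Rightarrow> real" where
  "s_alpha \<alpha> = F_alpha \<alpha> (x_plus \<alpha>) / (1 - \<alpha>)"

end

theory Submission
  imports Defs "HOL-Real_Asymp.Real_Asymp"
begin

text \<open>
  The regularisation is read off from the diagram \<open>S\<close> of the partition: its number of rows is
  one less than the minimum of \<open>a + (e - 1)(b - 1)\<close> over the positions outside \<open>S\<close>, and its first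
  row is squeezed between the first row of \<open>S\<close> and the maximum of \<open>a + b\<close> over \<open>S\<close>.  Both reduce to
  the limit shape of Plancherel-random diagrams together with the edge estimate \<open>2 sqrt n\<close>.

  The limit shape comes from Kerov's description of the Plancherel growth process, which adds a
  node with probability \<open>dim \<Lambda> / ((n + 1) dim \<lambda>)\<close>.  The Cauchy transform of the content of the added
  node is \<open>(1/z) \<Prod> (z - c)^2 / ((z - c)^2 - 1)\<close>, the product ranging over the contents \<open>c\<close> of the
  diagram, so its moments change in a controlled way when a node is added.  In the algebra
  generated by these moments and the content power sums the expected increment of a monomial has
  weight two less than the monomial, with an explicit leading term; hence the expectation of every
  monomial is determined asymptotically by induction on the weight, and all the generators
  concentrate.  The moments identify the limiting density \<open>(Omega u - |u|) / 2\<close> of the contents, and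
  since the lengths of consecutive diagonals differ by at most one, weak convergence gives uniform
  convergence.  At the edge, Cauchy--Schwarz shows that the first row has mean at most \<open>2 sqrt n\<close>.
\<close>
section \<open>Young diagrams and standard tableaux\<close>

text \<open>The generators are chosen so that one growth step closes up: a content power sum grows
  by a power of the new content, whose conditional mean is a transition moment, and a transition
  moment grows by a polynomial in the new content and lower moments. One unit of weight is worth
  \<open>sqrt n\<close>, a step costs two, and the Catalan convolution solves the leading equation.
  The limits are multiplicative in the monomial, so variances vanish without a separate computation.
  Weak convergence cannot see o(n) nodes, so a few very long rows stay possible; the upper edge is a
  separate matter and enters only through the infimum. The number of rows of the regularisation is a
  minimum, and beyond \<open>2 * sqrt n\<close> the trivial bound of the profile by |x| is already
  large enough. For the first row the squeeze closes for every e because \<open>Omega\<close> is at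
  most 2 on [-2, 2] and equals 2 at the end points: the maximum of a + b and the first row of the
  diagram are both near \<open>2 * sqrt n\<close>. Contents are a - b, so the number of rows governs
  the right end of the profile and the first row the left end.\<close>

definition diagram :: "(nat \<times> nat) set \<Rightarrow> bool" where
  "diagram S \<longleftrightarrow> finite S \<and> (\<forall>a b. (a, b) \<in> S \<longrightarrow> 1 \<le> a \<and> 1 \<le> b) \<and>
    (\<forall>a b a' b'. (a, b) \<in> S \<longrightarrow> 1 \<le> a' \<longrightarrow> a' \<le> a \<longrightarrow> 1 \<le> b' \<longrightarrow> b' \<le> b \<longrightarrow> (a', b') \<in> S)"

definition addable :: "(nat \<times> nat) set \<Rightarrow> (nat \<times> nat) set" where
  "addable S = {p. p \<notin> S \<and> diagram (insert p S)}"

definition removable :: "(nat \<times> nat) set \<Rightarrow> (nat \<times> nat) set" where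
  "removable S = {p \<in> S. diagram (S - {p})}"

text \<open>Row minus column, the opposite of the usual sign: this is the abscissa of the node in
  the Russian convention of \<open>node_square\<close>.\<close>

definition node_content :: "nat \<times> nat \<Rightarrow> int" where
  "node_content p = int (fst p) - int (snd p)"

definition syt :: "(nat \<times> nat) set \<Rightarrow> ((nat \<times> nat) \<Rightarrow> nat) set" where
  "syt S = {T. bij_betw T S {1..card S}
     \<and> (\<forall>a b. (a, b) \<in> S \<and> (a, Suc b) \<in> S \<longrightarrow> T (a, b) < T (a, Suc b))
     \<and> (\<forall>a b. (a, b) \<in> S \<and> (Suc a, b) \<in> S \<longrightarrow> T (a, b) < T (Suc a, b))
     \<and> (\<forall>p. p \<notin> S \<longrightarrow> T p = 0)}"

definition sdim :: "(nat \<times> nat) set \<Rightarrow> real" where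
  "sdim S = real (card (syt S))"

lemma diagram_finite: "diagram S \<Longrightarrow> finite S"
  by (simp add: diagram_def)

lemma diagram_pos: "diagram S \<Longrightarrow> (a, b) \<in> S \<Longrightarrow> 1 \<le> a \<and> 1 \<le> b"
  unfolding diagram_def by blast

lemma diagram_down:
  "diagram S \<Longrightarrow> (a, b) \<in> S \<Longrightarrow> 1 \<le> a' \<Longrightarrow> a' \<le> a \<Longrightarrow> 1 \<le> b' \<Longrightarrow> b' \<le> b \<Longrightarrow> (a', b') \<in> S"
  unfolding diagram_def by blast

lemma diagram_empty [simp]: "diagram {}"
  by (simp add: diagram_def)

lemma diagram_Int: "diagram S \<Longrightarrow> diagram S' \<Longrightarrow> diagram (S \<inter> S')"
  unfolding diagram_def by blast

lemma diagram_Un: "diagram S \<Longrightarrow> diagram S' \<Longrightarrow> diagram (S \<union> S')"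
  unfolding diagram_def by blast

lemma removable_iff:
  assumes S: "diagram S"
  shows "(a, b) \<in> removable S \<longleftrightarrow> (a, b) \<in> S \<and> (Suc a, b) \<notin> S \<and> (a, Suc b) \<notin> S"
proof
  assume r: "(a, b) \<in> removable S"
  then have ab: "(a, b) \<in> S" and d: "diagram (S - {(a, b)})" by (auto simp: removable_def)
  have "1 \<le> a" "1 \<le> b" using diagram_pos[OF S ab] by auto
  then show "(a, b) \<in> S \<and> (Suc a, b) \<notin> S \<and> (a, Suc b) \<notin> S"
    using ab diagram_down[OF d, of "Suc a" b a b] diagram_down[OF d, of a "Suc b" a b] by auto
next
  assume r: "(a, b) \<in> S \<and> (Suc a, b) \<notin> S \<and> (a, Suc b) \<notin> S"
  have "1 \<le> a" "1 \<le> b" using diagram_pos[OF S] r by auto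
  have "(c, d) = (a, b)" if "(c, d) \<in> S" "a \<le> c" "b \<le> d" for c d
  proof (rule ccontr)
    assume "(c, d) \<noteq> (a, b)"
    then have "Suc a \<le> c \<or> Suc b \<le> d" using that by auto
    then show False
      using diagram_down[OF S that(1), of "Suc a" b] diagram_down[OF S that(1), of a "Suc b"]
        r that \<open>1 \<le> a\<close> \<open>1 \<le> b\<close> by auto
  qed
  then have eq: "c = a \<and> d = b" if "(c, d) \<in> S" "a \<le> c" "b \<le> d" for c d
    using that by blast
  have "diagram (S - {(a, b)})"
    unfolding diagram_def
  proof (intro conjI allI impI)
    fix c d c' d' assume h: "(c, d) \<in> S - {(a, b)}" "1 \<le> c'" "c' \<le> c" "1 \<le> d'" "d' \<le> d"
    then have "(c', d') \<in> S" using diagram_down[OF S] by auto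
    moreover have "(c', d') \<noteq> (a, b)" using eq[of c d] h by auto
    ultimately show "(c', d') \<in> S - {(a, b)}" by auto
  qed (use diagram_finite[OF S] diagram_pos[OF S] in auto)
  then show "(a, b) \<in> removable S" using r by (simp add: removable_def)
qed

lemma addable_iff:
  assumes S: "diagram S"
  shows "(a, b) \<in> addable S \<longleftrightarrow> (a, b) \<notin> S \<and> 1 \<le> a \<and> 1 \<le> b \<and>
    (a = 1 \<or> (a - 1, b) \<in> S) \<and> (b = 1 \<or> (a, b - 1) \<in> S)"
proof
  assume r: "(a, b) \<in> addable S"
  then have ab: "(a, b) \<notin> S" and d: "diagram (insert (a, b) S)" by (auto simp: addable_def)
  have pos: "1 \<le> a" "1 \<le> b" using diagram_pos[OF d] by auto
  have "(a - 1, b) \<in> S" if "a \<noteq> 1"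
  proof -
    have "1 \<le> a - 1" "a - 1 \<noteq> a" using that pos by linarith+
    then show ?thesis using diagram_down[OF d, of a b "a - 1" b] pos by simp
  qed
  moreover have "(a, b - 1) \<in> S" if "b \<noteq> 1"
  proof -
    have "1 \<le> b - 1" "b - 1 \<noteq> b" using that pos by linarith+
    then show ?thesis using diagram_down[OF d, of a b a "b - 1"] pos by simp
  qed
  ultimately show "(a, b) \<notin> S \<and> 1 \<le> a \<and> 1 \<le> b \<and>
    (a = 1 \<or> (a - 1, b) \<in> S) \<and> (b = 1 \<or> (a, b - 1) \<in> S)"
    using ab pos by auto
next
  assume r: "(a, b) \<notin> S \<and> 1 \<le> a \<and> 1 \<le> b \<and>
    (a = 1 \<or> (a - 1, b) \<in> S) \<and> (b = 1 \<or> (a, b - 1) \<in> S)"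
  have "(c, d) \<in> insert (a, b) S" if "1 \<le> c" "1 \<le> d" "c \<le> a" "d \<le> b" for c d
  proof -
    have "(c = a \<and> d = b) \<or> (c \<le> a - 1 \<and> a \<noteq> 1) \<or> (d \<le> b - 1 \<and> b \<noteq> 1)"
      using that by arith
    then show ?thesis
      by (elim disjE conjE) (use r that diagram_down[OF S, of "a - 1" b c d]
        diagram_down[OF S, of a "b - 1" c d] in auto)
  qed
  then have eq: "(c, d) \<in> insert (a, b) S" if "1 \<le> c" "1 \<le> d" "c \<le> a" "d \<le> b" for c d
    using that by blast
  have "diagram (insert (a, b) S)"
    unfolding diagram_def
  proof (intro conjI allI impI)
    fix c d c' d' assume h: "(c, d) \<in> insert (a, b) S" "1 \<le> c'" "c' \<le> c" "1 \<le> d'" "d' \<le> d"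
    then show "(c', d') \<in> insert (a, b) S"
      using diagram_down[OF S, of c d c' d'] eq[of c' d'] by auto
  qed (use S diagram_finite[OF S] diagram_pos[OF S] r in auto)
  then show "(a, b) \<in> addable S" using r by (simp add: addable_def)
qed

lemma removable_addable:
  assumes "diagram S" "p \<in> removable S"
  shows "diagram (S - {p})" "p \<in> addable (S - {p})" "insert p (S - {p}) = S"
    "card (S - {p}) = card S - 1" "card S \<ge> 1" "p \<in> S"
  using assms diagram_finite[OF assms(1)]
  by (auto simp: removable_def addable_def insert_absorb card_gt_0_iff Suc_le_eq)

lemma addable_removable:
  assumes "diagram S" "p \<in> addable S"
  shows "diagram (insert p S)" "p \<in> removable (insert p S)" "insert p S - {p} = S"
    "card (insert p S) = Suc (card S)" "p \<notin> S"
  using assms diagram_finite[OF assms(1)]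
  by (auto simp: removable_def addable_def)

lemma diagram_card_bound:
  assumes S: "diagram S" and "(a, b) \<in> S"
  shows "a \<le> card S" "b \<le> card S"
proof -
  note pos = diagram_pos[OF S assms(2)]
  have "(\<lambda>i. (i, b)) ` {1..a} \<subseteq> S" "(\<lambda>i. (a, i)) ` {1..b} \<subseteq> S"
    using diagram_down[OF S assms(2)] pos by auto
  then have "card ((\<lambda>i. (i, b)) ` {1..a}) \<le> card S" "card ((\<lambda>i. (a, i)) ` {1..b}) \<le> card S"
    using card_mono diagram_finite[OF S] by blast+
  then show "a \<le> card S" "b \<le> card S"
    by (auto simp: card_image inj_on_def)
qed

lemma finite_addable: "diagram S \<Longrightarrow> finite (addable S)"
proof -
  assume S: "diagram S"
  have "(a, b) \<in> {..Suc (card S)} \<times> {..Suc (card S)}" if "(a, b) \<in> addable S" for a b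
    using diagram_card_bound[OF addable_removable(1)[OF S that], of a b] addable_removable(4)[OF S that]
    by simp
  then have "addable S \<subseteq> {..Suc (card S)} \<times> {..Suc (card S)}" by auto
  then show ?thesis by (rule finite_subset) auto
qed

lemma finite_removable: "diagram S \<Longrightarrow> finite (removable S)"
  by (simp add: removable_def diagram_finite)

lemma node_content_eq_cases:
  assumes "node_content (a, b) = node_content (c, d)"
  obtains "a = c" "b = d" | k where "c = a + Suc k" "d = b + Suc k"
    | k where "a = c + Suc k" "b = d + Suc k"
proof -
  have e: "a + d = c + b" using assms by (simp add: node_content_def)
  show ?thesis
  proof (cases a c rule: linorder_cases)
    case less
    then show ?thesis using e that(2)[of "c - a - 1"] by simp
  next
    case equal
    then show ?thesis using e that(1) by simp
  next
    case greater
    then show ?thesis using e that(3)[of "a - c - 1"] by simp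
  qed
qed

text \<open>Of two addable nodes on one diagonal, the farther one needs its upper neighbour in the
  diagram, and that neighbour lies south-east of the nearer one. Injectivity makes the poles of the
  transition sums simple.\<close>

lemma node_content_inj_addable:
  assumes S: "diagram S"
  shows "inj_on node_content (addable S)"
proof -
  have *: False if "(a, b) \<in> addable S" "(a + Suc k, b + Suc k) \<in> addable S" for a b k
  proof -
    have "(a + k, b + Suc k) \<in> S" "1 \<le> a" "1 \<le> b" "(a, b) \<notin> S"
      using that by (auto simp: addable_iff[OF S])
    then show False using diagram_down[OF S, of "a + k" "b + Suc k" a b] by auto
  qed
  show ?thesis
  proof (rule inj_onI)
    fix p q assume pq: "p \<in> addable S" "q \<in> addable S" "node_content p = node_content q"
    obtain a b c d where [simp]: "p = (a, b)" "q = (c, d)" by fastforce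
    have "node_content (a, b) = node_content (c, d)" using pq(3) by simp
    then show "p = q" by (cases rule: node_content_eq_cases) (use pq * in auto)
  qed
qed

lemma node_content_inj_removable:
  assumes S: "diagram S"
  shows "inj_on node_content (removable S)"
proof -
  have *: False if "(a, b) \<in> removable S" "(a + Suc k, b + Suc k) \<in> removable S" for a b k
    using that diagram_down[OF S, of "a + Suc k" "b + Suc k" "Suc a" b] diagram_pos[OF S, of a b]
    by (auto simp: removable_iff[OF S])
  show ?thesis
  proof (rule inj_onI)
    fix p q assume pq: "p \<in> removable S" "q \<in> removable S" "node_content p = node_content q"
    obtain a b c d where [simp]: "p = (a, b)" "q = (c, d)" by fastforce
    have "node_content (a, b) = node_content (c, d)" using pq(3) by simp
    then show "p = q" by (cases rule: node_content_eq_cases) (use pq * in auto)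
  qed
qed

section \<open>Standard tableaux and the branching rule\<close>

lemma finite_syt: "finite S \<Longrightarrow> finite (syt S)"
proof (rule finite_subset)
  show "syt S \<subseteq> {T. \<forall>p. (p \<in> S \<longrightarrow> T p \<in> {1..card S}) \<and> (p \<notin> S \<longrightarrow> T p = 0)}"
    by (auto simp: syt_def bij_betw_def)
  show "finite S \<Longrightarrow> finite {T. \<forall>p. (p \<in> S \<longrightarrow> T p \<in> {1..card S}) \<and> (p \<notin> S \<longrightarrow> T p = 0)}"
    by (rule finite_set_of_finite_funs) auto
qed

lemma sdim_empty [simp]: "sdim {} = 1"
proof -
  have "syt {} = {\<lambda>_. 0}" by (auto simp: syt_def bij_betw_def)
  then show ?thesis by (simp add: sdim_def)
qed

text \<open>Erasing the largest entry is undone by writing \<open>card S\<close> back; the value 0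
  outside the diagram makes the two maps exact inverses.\<close>

lemma syt_restrict_bij:
  assumes S: "diagram S" and q: "q \<in> removable S"
  shows "bij_betw (\<lambda>T. T(q := 0)) {T \<in> syt S. T q = card S} (syt (S - {q}))"
proof (rule bij_betw_byWitness[where f' = "\<lambda>T. T(q := card S)"])
  note rq = removable_addable[OF S q]
  have qr: "(fst q, Suc (snd q)) \<notin> S" "(Suc (fst q), snd q) \<notin> S"
    using q removable_iff[OF S, of "fst q" "snd q"] by auto
  have iv: "{1..card S} = insert (card S) {1..card S - 1}" "card S \<notin> {1..card S - 1}"
    using rq by auto
  show "\<forall>T\<in>{T \<in> syt S. T q = card S}. (T(q := 0))(q := card S) = T" by auto
  show "\<forall>T\<in>syt (S - {q}). (T(q := card S))(q := 0) = T"
  proof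
    fix T assume "T \<in> syt (S - {q})"
    then have "T q = 0" unfolding syt_def by blast
    then show "(T(q := card S))(q := 0) = T" by auto
  qed
  show "(\<lambda>T. T(q := 0)) ` {T \<in> syt S. T q = card S} \<subseteq> syt (S - {q})"
  proof (rule image_subsetI)
    fix T assume "T \<in> {T \<in> syt S. T q = card S}"
    then have T: "T \<in> syt S" "T q = card S" by auto
    have "bij_betw T (S - {q}) ({1..card S} - {card S})"
      using T bij_betw_DiffI[of T S "{1..card S}" "{q}" "{card S}"] rq
      by (auto simp: syt_def)
    moreover have "{1..card S} - {card S} = {1..card S - 1}" by auto
    moreover have "bij_betw (T(q := 0)) (S - {q}) X = bij_betw T (S - {q}) X" for X
      by (rule bij_betw_cong) auto
    ultimately show "T(q := 0) \<in> syt (S - {q})"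
      using T rq by (auto simp: syt_def)
  qed
  show "(\<lambda>T. T(q := card S)) ` syt (S - {q}) \<subseteq> {T \<in> syt S. T q = card S}"
  proof (rule image_subsetI)
    fix T assume T: "T \<in> syt (S - {q})"
    have bT: "bij_betw T (S - {q}) {1..card S - 1}" using T rq by (auto simp: syt_def)
    have "bij_betw (T(q := card S)) (S - {q}) {1..card S - 1}"
      using bT by (subst bij_betw_cong[of _ _ T]) auto
    then have "bij_betw (T(q := card S)) (insert q (S - {q})) (insert (card S) {1..card S - 1})"
      using iv(2) by (intro bij_betw_combine[of _ "{q}" "{card S}", simplified]) (auto simp: bij_betw_def)
    then have b: "bij_betw (T(q := card S)) S {1..card S}" using rq iv by simp
    have lt: "T p < card S" if "p \<in> S" "p \<noteq> q" for p
    proof -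
      have "T p \<in> {1..card S - 1}" using bij_betwE[OF bT] that by blast
      then show ?thesis using rq(5) by auto
    qed
    show "T(q := card S) \<in> {T \<in> syt S. T q = card S}"
      using T b qr lt rq(6) by (auto simp: syt_def)
  qed
qed

text \<open>The branching rule: tableaux are sorted by the place of their largest entry, which has
  nothing to its right or below and so occupies a removable corner.\<close>

lemma sdim_recursion:
  assumes S: "diagram S" "S \<noteq> {}"
  shows "sdim S = (\<Sum>q\<in>removable S. sdim (S - {q}))"
proof -
  have fS: "finite S" using S diagram_finite by auto
  have "syt S = (\<Union>q\<in>removable S. {T \<in> syt S. T q = card S})"
  proof -
    have "\<exists>q\<in>removable S. T q = card S" if T: "T \<in> syt S" for T
    proof -
      have b: "bij_betw T S {1..card S}" using T by (auto simp: syt_def)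
      have "card S \<in> {1..card S}" using fS S by (auto simp: Suc_le_eq card_gt_0_iff)
      then obtain q where q: "q \<in> S" "T q = card S" using b by (metis bij_betw_iff_bijections)
      have le: "T p \<le> card S" if "p \<in> S" for p using b that by (auto simp: bij_betw_def)
      have "q \<in> removable S"
      proof (cases q)
        case (Pair a c)
        have "(Suc a, c) \<notin> S" "(a, Suc c) \<notin> S"
          using T q Pair le[of "(Suc a, c)"] le[of "(a, Suc c)"] by (fastforce simp: syt_def)+
        then show ?thesis using Pair q removable_iff[OF S(1)] by auto
      qed
      then show ?thesis using q by auto
    qed
    then show ?thesis by auto
  qed
  then have "card (syt S) = (\<Sum>q\<in>removable S. card {T \<in> syt S. T q = card S})"
  proof (subst card_UN_disjoint[symmetric])
    show "finite (removable S)" using finite_removable S by auto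
    show "\<forall>q\<in>removable S. finite {T \<in> syt S. T q = card S}" using finite_syt[OF fS] by auto
    show "\<forall>i\<in>removable S. \<forall>j\<in>removable S. i \<noteq> j \<longrightarrow>
        {T \<in> syt S. T i = card S} \<inter> {T \<in> syt S. T j = card S} = {}"
    proof (intro ballI impI equals0I)
      fix i j T assume h: "i \<in> removable S" "j \<in> removable S" "i \<noteq> j"
        "T \<in> {T \<in> syt S. T i = card S} \<inter> {T \<in> syt S. T j = card S}"
      then have "inj_on T S" "T i = T j" "i \<in> S" "j \<in> S"
        by (auto simp: syt_def bij_betw_def removable_def)
      then show False using h(3) by (meson inj_onD)
    qed
  qed auto
  also have "\<dots> = (\<Sum>q\<in>removable S. card (syt (S - {q})))"
    using syt_restrict_bij[OF S(1)] bij_betw_same_card by (intro sum.cong) blast+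
  finally show ?thesis by (simp add: sdim_def)
qed

text \<open>A node that maximises a + b has no neighbour to the right or below.\<close>

lemma removable_nonempty:
  assumes S: "diagram S" "S \<noteq> {}"
  shows "removable S \<noteq> {}"
proof -
  have f: "finite ((\<lambda>(a, b). a + b) ` S)" "(\<lambda>(a, b). a + b) ` S \<noteq> {}"
    using S diagram_finite by auto
  obtain a b where "(a, b) \<in> S" "a + b = Max ((\<lambda>(a, b). a + b) ` S)"
    using Max_in[OF f] by auto
  moreover have "c + d \<le> a + b" if "(c, d) \<in> S" for c d
    using Max_ge[OF f(1)] that calculation by auto
  ultimately have "(a, b) \<in> removable S"
    using removable_iff[OF S(1)] by fastforce
  then show ?thesis by auto
qed

lemma diagram_induct [consumes 1, case_names empty add]:
  assumes "diagram S" "P {}"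
    "\<And>S p. diagram S \<Longrightarrow> p \<in> addable S \<Longrightarrow> P S \<Longrightarrow> P (insert p S)"
  shows "P S"
  using assms(1)
proof (induction "card S" arbitrary: S)
  case 0
  then show ?case using assms(2) diagram_finite by auto
next
  case (Suc n)
  then have "S \<noteq> {}" by auto
  then obtain q where q: "q \<in> removable S" using removable_nonempty[OF Suc.prems] by blast
  note r = removable_addable[OF Suc.prems q]
  have "P (S - {q})" using Suc r by simp
  then show ?case using assms(3)[OF r(1,2)] r(3) by simp
qed

lemma sdim_pos: "diagram S \<Longrightarrow> 0 < sdim S"
proof (induction "card S" arbitrary: S)
  case 0
  then show ?case using diagram_finite by auto
next
  case (Suc n)
  then have "S \<noteq> {}" by auto
  then show ?case
    using Suc removable_nonempty[OF Suc.prems] removable_addable[OF Suc.prems] finite_removable[OF Suc.prems]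
    by (subst sdim_recursion) (auto intro!: sum_pos)
qed

text \<open>Adding one node and then removing a different one commutes with doing it in the other
  order; only the pairs that return to \<open>S\<close> differ.\<close>
lemma add_remove_swap:
  fixes f :: "nat \<times> nat \<Rightarrow> real"
  assumes S: "diagram S"
  shows "(\<Sum>p\<in>addable S. f p * sdim (insert p S)) =
    (\<Sum>q\<in>removable S. \<Sum>p\<in>addable (S - {q}). f p * sdim (insert p (S - {q})))
    + sdim S * ((\<Sum>p\<in>addable S. f p) - (\<Sum>q\<in>removable S. f q))"
proof -
  have fin: "finite (addable S)" "finite (removable S)" using S finite_addable finite_removable by auto
  let ?X = "SIGMA p:addable S. removable (insert p S) - {p}"
  let ?Y = "SIGMA q:removable S. addable (S - {q}) - {q}"
  have finr: "finite (removable (insert p S))" if "p \<in> addable S" for p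
    using addable_removable[OF S that] finite_removable by auto
  have fina: "finite (addable (S - {p}))" if "p \<in> removable S" for p
    using removable_addable[OF S that] finite_addable by auto
  \<comment> \<open>Diagrams are closed under intersection and union: \<open>S - {q}\<close> is the
    intersection of \<open>S\<close> with \<open>insert p S - {q}\<close>, and
    \<open>insert p S\<close> is the union of \<open>S\<close> with
    \<open>insert p (S - {q})\<close>.\<close>
  have XY: "(p, q) \<in> ?X \<longleftrightarrow> (q, p) \<in> ?Y" for p q
  proof
    assume "(p, q) \<in> ?X"
    then have pq: "p \<in> addable S" "q \<in> removable (insert p S)" "q \<noteq> p" by auto
    have q: "q \<in> S" and d: "diagram (insert p S - {q})" using pq by (auto simp: removable_def)
    have p: "p \<notin> S" using pq by (auto simp: addable_def)
    have "S - {q} = S \<inter> (insert p S - {q})" using pq p by auto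
    then have "diagram (S - {q})" using diagram_Int[OF S d] by simp
    moreover have "insert p S - {q} = insert p (S - {q})" using pq by auto
    ultimately show "(q, p) \<in> ?Y" using p q pq d by (auto simp: removable_def addable_def)
  next
    assume "(q, p) \<in> ?Y"
    then have pq: "q \<in> removable S" "p \<in> addable (S - {q})" "q \<noteq> p" by auto
    have q: "q \<in> S" using pq by (auto simp: removable_def)
    have p: "p \<notin> S" and d: "diagram (insert p (S - {q}))" using pq by (auto simp: addable_def)
    have "insert p S = S \<union> insert p (S - {q})" using q by auto
    then have "diagram (insert p S)" using diagram_Un[OF S d] by simp
    moreover have "insert p S - {q} = insert p (S - {q})" using pq by auto
    ultimately show "(p, q) \<in> ?X" using p q pq d by (auto simp: removable_def addable_def)
  qed
  have "(\<Sum>p\<in>addable S. f p * sdim (insert p S)) =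
      (\<Sum>p\<in>addable S. \<Sum>q\<in>removable (insert p S). f p * sdim (insert p S - {q}))"
    using addable_removable(1)[OF S] by (intro sum.cong refl, subst sdim_recursion) (auto simp: sum_distrib_left)
  also have "\<dots> = (\<Sum>p\<in>addable S. f p * sdim S + (\<Sum>q\<in>removable (insert p S) - {p}. f p * sdim (insert p S - {q})))"
  proof (intro sum.cong refl)
    fix p assume p: "p \<in> addable S"
    show "(\<Sum>q\<in>removable (insert p S). f p * sdim (insert p S - {q})) =
        f p * sdim S + (\<Sum>q\<in>removable (insert p S) - {p}. f p * sdim (insert p S - {q}))"
      unfolding sum.remove[OF finr[OF p] addable_removable(2)[OF S p]] addable_removable(3)[OF S p] ..
  qed
  also have "\<dots> = (\<Sum>p\<in>addable S. f p * sdim S) + (\<Sum>(p,q)\<in>?X. f p * sdim (insert p S - {q}))"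
    using fin finr by (subst sum.Sigma[symmetric]) (auto simp: sum.distrib)
  also have "(\<Sum>(p,q)\<in>?X. f p * sdim (insert p S - {q})) = (\<Sum>(q,p)\<in>?Y. f p * sdim (insert p (S - {q})))"
  proof (rule sum.reindex_bij_witness[where i = prod.swap and j = prod.swap])
    fix x assume x: "x \<in> ?X"
    obtain p q where [simp]: "x = (p, q)" by (cases x)
    have "insert p S - {q} = insert p (S - {q})" using x by auto
    then show "(case prod.swap x of (q, p) \<Rightarrow> f p * sdim (insert p (S - {q}))) =
         (case x of (p, q) \<Rightarrow> f p * sdim (insert p S - {q}))" by simp
    show "prod.swap x \<in> ?Y" using x XY[of p q] by simp
  next
    fix x assume x: "x \<in> ?Y"
    then show "prod.swap x \<in> ?X" using XY[of "snd x" "fst x"] by (cases x) simp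
  qed auto
  also have "\<dots> = (\<Sum>q\<in>removable S. \<Sum>p\<in>addable (S - {q}) - {q}. f p * sdim (insert p (S - {q})))"
    using fin fina by (subst sum.Sigma[symmetric]) auto
  \<comment> \<open>Completing the inner sum by the missing term p = q costs
    \<open>f q * sdim S\<close>, because re-adding q gives back \<open>S\<close>.\<close>
  also have "\<dots> = (\<Sum>q\<in>removable S. (\<Sum>p\<in>addable (S - {q}). f p * sdim (insert p (S - {q}))) - f q * sdim S)"
    using removable_addable[OF S] fina
    by (intro sum.cong refl, subst sum.remove[where x = q and A = "addable (S - {q})" for q]) (auto simp: insert_absorb)
  finally show ?thesis
    by (simp add: sum_subtractf sum_distrib_left right_diff_distrib mult.commute)
qed

section \<open>Transition probabilities of the Plancherel growth process\<close>

abbreviation ct :: "nat \<times> nat \<Rightarrow> real" where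
  "ct p \<equiv> real_of_int (node_content p)"

text \<open>A product over all nodes instead of over corners, so that adding a node multiplies it by
  a single factor; \<open>transition_gf_corners\<close> recovers the rational function with zeros
  and poles at the corners.\<close>

definition transition_gf :: "(nat \<times> nat) set \<Rightarrow> real \<Rightarrow> real" where
  "transition_gf S z = (\<Prod>p\<in>S. (z - ct p)^2 / ((z - ct p)^2 - 1)) / z"

text \<open>Contents are integers, so a non-integral argument avoids every zero and pole of every
  diagram at once.\<close>

lemma not_Ints_diff_nonzero:
  assumes "(z::real) \<notin> \<int>"
  shows "z - real_of_int i \<noteq> 0" "(z - real_of_int i)^2 - 1 \<noteq> 0" "z - real_of_int i + 1 \<noteq> 0" 
    "z - real_of_int i - 1 \<noteq> 0"
proof -
  have *: "z - real_of_int j \<noteq> 0" for j using assms by (metis Ints_of_int right_minus_eq)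
  show "z - real_of_int i \<noteq> 0" by (rule *)
  show a: "z - real_of_int i + 1 \<noteq> 0" using *[of "i - 1"] by (simp add: algebra_simps)
  show b: "z - real_of_int i - 1 \<noteq> 0" using *[of "i + 1"] by (simp add: algebra_simps)
  have "(z - real_of_int i)^2 - 1 = (z - real_of_int i + 1) * (z - real_of_int i - 1)"
    by (simp add: power2_eq_square algebra_simps)
  then show "(z - real_of_int i)^2 - 1 \<noteq> 0" using a b by simp
qed

lemma transition_gf_insert:
  assumes "finite S" "p \<notin> S"
  shows "transition_gf (insert p S) z = transition_gf S z * ((z - ct p)^2 / ((z - ct p)^2 - 1))"
  using assms by (simp add: transition_gf_def mult_ac)

text \<open>Only the right and lower neighbours of the new node can become addable: the right one
  still needs support from above, the lower one support from the left.\<close>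

lemma addable_insert:
  assumes S: "diagram S" and p: "(a, b) \<in> addable S"
  shows "addable (insert (a, b) S) = (addable S - {(a, b)})
    \<union> (if a = 1 \<or> (a - 1, Suc b) \<in> S then {(a, Suc b)} else {})
    \<union> (if b = 1 \<or> (Suc a, b - 1) \<in> S then {(Suc a, b)} else {})"
proof -
  note ap = addable_removable[OF S p]
  have f: "1 \<le> a" "1 \<le> b" "(a, b) \<notin> S" "a = 1 \<or> (a - 1, b) \<in> S" "b = 1 \<or> (a, b - 1) \<in> S"
    using p unfolding addable_iff[OF S] by auto
  have g: "(a, Suc b) \<notin> S" "(Suc a, b) \<notin> S"
    using diagram_down[OF S, of a "Suc b" a b] diagram_down[OF S, of "Suc a" b a b] f by auto
  have "(c, d) \<in> addable (insert (a, b) S) \<longleftrightarrow> (c, d) \<in> (addable S - {(a, b)})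
    \<union> (if a = 1 \<or> (a - 1, Suc b) \<in> S then {(a, Suc b)} else {})
    \<union> (if b = 1 \<or> (Suc a, b - 1) \<in> S then {(Suc a, b)} else {})" for c d
  proof -
    consider "c = a" "d = Suc b" | "c = Suc a" "d = b"
      | "\<not> (c = a \<and> d = Suc b)" "\<not> (c = Suc a \<and> d = b)" by blast
    then show ?thesis
    proof cases
      case 1
      then show ?thesis using f g by (simp add: addable_iff[OF S] addable_iff[OF ap(1)])
    next
      case 2
      then show ?thesis using f g by (simp add: addable_iff[OF S] addable_iff[OF ap(1)])
    next
      case 3
      have "1 \<le> c \<Longrightarrow> 1 \<le> d \<Longrightarrow> (c - 1, d) \<noteq> (a, b) \<and> (c, d - 1) \<noteq> (a, b)" using 3 by auto
      then have e: "1 \<le> c \<Longrightarrow> 1 \<le> d \<Longrightarrow> ((c - 1, d) \<in> insert (a, b) S \<longleftrightarrow> (c - 1, d) \<in> S)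
          \<and> ((c, d - 1) \<in> insert (a, b) S \<longleftrightarrow> (c, d - 1) \<in> S)" by blast
      have r: "(c, d) \<in> (addable S - {(a, b)})
          \<union> (if a = 1 \<or> (a - 1, Suc b) \<in> S then {(a, Suc b)} else {})
          \<union> (if b = 1 \<or> (Suc a, b - 1) \<in> S then {(Suc a, b)} else {})
          \<longleftrightarrow> (c, d) \<in> addable S \<and> (c, d) \<noteq> (a, b)"
        using 3 by auto
      show ?thesis unfolding r addable_iff[OF S] addable_iff[OF ap(1)] using e by blast
    qed
  qed
  then show ?thesis by (intro set_eqI) (metis surj_pair)
qed

text \<open>The conditions are those of \<open>addable_insert\<close> with the branches exchanged:
  on each side the new node either opens an addable neighbour or covers an old corner. This
  alternative drives the telescoping of the corner products.\<close>

lemma removable_insert: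
  assumes S: "diagram S" and p: "(a, b) \<in> addable S"
  shows "removable S = (removable (insert (a, b) S) - {(a, b)})
    \<union> (if a = 1 \<or> (a - 1, Suc b) \<in> S then {} else {(a - 1, b)})
    \<union> (if b = 1 \<or> (Suc a, b - 1) \<in> S then {} else {(a, b - 1)})"
proof -
  note ap = addable_removable[OF S p]
  have f: "1 \<le> a" "1 \<le> b" "(a, b) \<notin> S" "a = 1 \<or> (a - 1, b) \<in> S" "b = 1 \<or> (a, b - 1) \<in> S"
    using p unfolding addable_iff[OF S] by auto
  have "(c, d) \<in> removable S \<longleftrightarrow> (c, d) \<in> (removable (insert (a, b) S) - {(a, b)})
    \<union> (if a = 1 \<or> (a - 1, Suc b) \<in> S then {} else {(a - 1, b)})
    \<union> (if b = 1 \<or> (Suc a, b - 1) \<in> S then {} else {(a, b - 1)})" for c d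
  proof -
    consider "Suc c = a" "d = b" | "c = a" "Suc d = b"
      | "Suc c \<noteq> a \<or> d \<noteq> b" "c \<noteq> a \<or> Suc d \<noteq> b" by blast
    then show ?thesis
    proof cases
      case 1
      then show ?thesis using f diagram_pos[OF S, of c d] by (auto simp: removable_iff[OF S] removable_iff[OF ap(1)])
    next
      case 2
      then show ?thesis using f diagram_pos[OF S, of c d] by (auto simp: removable_iff[OF S] removable_iff[OF ap(1)])
    next
      case 3
      then have "(c, d) \<in> (removable (insert (a, b) S) - {(a, b)})
          \<union> (if a = 1 \<or> (a - 1, Suc b) \<in> S then {} else {(a - 1, b)})
          \<union> (if b = 1 \<or> (Suc a, b - 1) \<in> S then {} else {(a, b - 1)})
          \<longleftrightarrow> (c, d) \<in> removable (insert (a, b) S) \<and> (c, d) \<noteq> (a, b)"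
        using f(1,2) by auto
      then show ?thesis unfolding removable_iff[OF S] removable_iff[OF ap(1)] using 3 f(3) by auto
    qed
  qed
  then show ?thesis by (intro set_eqI) (metis surj_pair)
qed

text \<open>The only zeros and poles of \<open>transition_gf S\<close> that survive the telescoping are the corners.\<close>
lemma transition_gf_corners:
  assumes "diagram S" and z: "z \<notin> \<int>"
  shows "transition_gf S z * (\<Prod>p\<in>addable S. z - ct p) = (\<Prod>p\<in>removable S. z - ct p)"
  using assms(1)
proof (induction rule: diagram_induct)
  case empty
  have "addable {} = {(1, 1)}"
    using addable_iff[OF diagram_empty] by auto
  moreover have "removable {} = {}" by (auto simp: removable_def)
  ultimately show ?case using not_Ints_diff_nonzero[OF z, of 0] by (simp add: transition_gf_def node_content_def)
next
  case (add S p)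
  obtain a b where p: "p = (a, b)" by (cases p)
  have pA: "(a, b) \<in> addable S" using add p by simp
  note ap = addable_removable[OF add(1) pA]
  note fin = finite_addable[OF add(1)] finite_removable[OF ap(1)]
  define E where "E \<longleftrightarrow> a = 1 \<or> (a - 1, Suc b) \<in> S"
  define N where "N \<longleftrightarrow> b = 1 \<or> (Suc a, b - 1) \<in> S"
  \<comment> \<open>The factor x + 1, with x = z - ct p, falls to the addable side
    (\<open>e\<close>) or to the removable side (\<open>e'\<close>), never to both; likewise x - 1
    for \<open>n\<close> and \<open>n'\<close>. Hence the products \<open>e * e'\<close> and
    \<open>n * n'\<close> do not depend on the case.\<close>
  define e where "e = (if E then z - ct p + 1 else 1)"
  define n where "n = (if N then z - ct p - 1 else 1)"
  define e' where "e' = (if E then 1 else z - ct p + 1)"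
  define n' where "n' = (if N then 1 else z - ct p - 1)"
  have ab: "1 \<le> a" "1 \<le> b" "(a, b) \<notin> S" using pA addable_iff[OF add(1)] by auto
  have g: "(a, Suc b) \<notin> addable S" "(Suc a, b) \<notin> addable S"
    using ab pA addable_iff[OF add(1)] by auto
  have g': "(a - 1, b) \<notin> removable (insert (a, b) S)" "(a, b - 1) \<notin> removable (insert (a, b) S)"
    using ab by (auto simp: removable_iff[OF ap(1)])
  have c1: "ct (a, Suc b) = ct p - 1" "ct (Suc a, b) = ct p + 1"
    using p by (auto simp: node_content_def)
  have c2: "\<not> E \<Longrightarrow> ct (a - 1, b) = ct p - 1" "\<not> N \<Longrightarrow> ct (a, b - 1) = ct p + 1"
    using p ab by (auto simp: node_content_def E_def N_def)
  let ?A = "\<lambda>S. (\<Prod>p\<in>addable S. z - ct p)" and ?R = "\<lambda>S. (\<Prod>p\<in>removable S. z - ct p)"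
  have aS': "?A (insert p S) = (\<Prod>p\<in>addable S - {p}. z - ct p) * e * n"
    unfolding p addable_insert[OF add(1) pA] E_def[symmetric] N_def[symmetric]
    using fin g c1[unfolded p] by (simp add: e_def n_def p mult_ac diff_diff_eq add_ac diff_add_eq)
  have a: "?A S = (z - ct p) * (\<Prod>p\<in>addable S - {p}. z - ct p)"
    using fin add by (intro prod.remove) auto
  have rS: "?R S = (\<Prod>p\<in>removable (insert p S) - {p}. z - ct p) * e' * n'"
    unfolding p removable_insert[OF add(1) pA] E_def[symmetric] N_def[symmetric]
    using fin g' c2[unfolded p] ab by (simp add: e'_def n'_def p mult_ac diff_diff_eq add_ac diff_add_eq)
  have r: "?R (insert p S) = (z - ct p) * (\<Prod>p\<in>removable (insert p S) - {p}. z - ct p)"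
    using fin ap p by (intro prod.remove) auto
  define x where "x = z - ct p"
  have x: "x \<noteq> 0" "x^2 - 1 \<noteq> 0" "x + 1 \<noteq> 0" "x - 1 \<noteq> 0"
    using not_Ints_diff_nonzero[OF z, of "node_content p"] by (auto simp: x_def)
  have en: "e * e' = x + 1" "n * n' = x - 1" by (auto simp: e_def e'_def n_def n'_def x_def)
  have x2: "x^2 - 1 = (x + 1) * (x - 1)" by (simp add: power2_eq_square algebra_simps)
  have transition_gf': "transition_gf (insert p S) z = transition_gf S z * (x^2 / (x^2 - 1))"
    using transition_gf_insert[of S p z] ap p diagram_finite[OF add(1)] by (simp add: x_def)
  have "transition_gf S z * (x * (\<Prod>p\<in>addable S - {p}. z - ct p)) * e * n = (\<Prod>p\<in>removable (insert p S) - {p}. z - ct p) * (e * e') * (n * n')"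
    using add(3) unfolding a rS x_def by (simp add: mult_ac)
  then have "transition_gf S z * x * ?A (insert p S) = (\<Prod>p\<in>removable (insert p S) - {p}. z - ct p) * (x^2 - 1)"
    unfolding aS' en x2 by (simp add: mult_ac)
  then have "transition_gf (insert p S) z * ?A (insert p S) = x * (\<Prod>p\<in>removable (insert p S) - {p}. z - ct p)"
  proof -
    assume "transition_gf S z * x * ?A (insert p S) = (\<Prod>p\<in>removable (insert p S) - {p}. z - ct p) * (x^2 - 1)"
    then have "x * (transition_gf S z * x * ?A (insert p S)) / (x^2 - 1)
        = x * ((\<Prod>p\<in>removable (insert p S) - {p}. z - ct p) * (x^2 - 1)) / (x^2 - 1)" by simp
    then show ?thesis unfolding transition_gf' using x(2) by (simp add: power2_eq_square mult_ac)
  qed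
  then show ?case unfolding r x_def .
qed

text \<open>A diagonal that ends in a removable corner is blocked just after it, since the right
  neighbour of the corner is missing. Thus numerator and denominator of the corner form share no
  root, and residues at removable corners make sense.\<close>

lemma corner_contents_ne:
  assumes S: "diagram S" and "p \<in> addable S" "q \<in> removable S"
  shows "node_content p \<noteq> node_content q"
proof
  assume c: "node_content p = node_content q"
  obtain a b c d where [simp]: "p = (a, b)" "q = (c, d)" by fastforce
  have p: "(a, b) \<notin> S" "a = 1 \<or> (a - 1, b) \<in> S" "1 \<le> a" "1 \<le> b" and q: "(c, d) \<in> S" "(c, Suc d) \<notin> S"
    using assms(2,3) by (auto simp: addable_iff[OF S] removable_iff[OF S])
  have "1 \<le> c" "1 \<le> d" using diagram_pos[OF S q(1)] by auto
  from c have "node_content (a, b) = node_content (c, d)" by simp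
  then show False
  proof (cases rule: node_content_eq_cases)
    case 1
    then show ?thesis using p q by auto
  next
    case (2 k)
    then show ?thesis using diagram_down[OF S q(1), of a b] p by auto
  next
    case (3 k)
    then have "(c + k, d + Suc k) \<in> S" using p \<open>1 \<le> c\<close> by auto
    then show ?thesis using q diagram_down[OF S, of "c + k" "d + Suc k" c "Suc d"] \<open>1 \<le> c\<close>
      by auto
  qed
qed

section \<open>Partial fractions compared along the half-integers\<close>

lemma half_notin_Ints: "real n + 1 / 2 \<notin> \<int>"
proof
  assume "real n + 1 / 2 \<in> \<int>"
  then obtain i where "real n + 1 / 2 = of_int i" by (auto elim: Ints_cases)
  then have "2 * int n + 1 = 2 * i" by linarith
  then show False by presburger
qed

text \<open>Once the sign is normalised the leading coefficient is positive and eventually bounds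
  the polynomial from below. Half-integers are the points along which z tends to infinity here
  because they are never contents.\<close>

lemma poly_tendsto_0_imp_0:
  fixes Q :: "real poly"
  assumes "(\<lambda>n. poly Q (real n + 1 / 2)) \<longlonglongrightarrow> 0"
  shows "Q = 0"
proof (rule ccontr)
  assume "Q \<noteq> 0"
  define P where "P = smult (sgn (lead_coeff Q)) Q"
  have "lead_coeff Q \<noteq> 0" using \<open>Q \<noteq> 0\<close> by simp
  then have lc: "lead_coeff P > 0"
    by (metis P_def lead_coeff_smult mult.commute abs_sgn zero_less_abs_iff)
  have lim: "(\<lambda>n. poly P (real n + 1 / 2)) \<longlonglongrightarrow> 0"
    using tendsto_mult_right_zero[OF assms, of "sgn (lead_coeff Q)"] by (simp add: P_def)
  obtain m where m: "\<And>x. m \<le> x \<Longrightarrow> lead_coeff P \<le> poly P x"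
    using poly_pinfty_gt_lc[OF lc] by auto
  have "eventually (\<lambda>n. m \<le> real n + 1 / 2) sequentially" by real_asymp
  then have "eventually (\<lambda>n. lead_coeff P \<le> poly P (real n + 1 / 2)) sequentially"
    by eventually_elim (rule m)
  then have "lead_coeff P \<le> 0"
    using tendsto_lowerbound[OF lim] by auto
  then show False using lc by simp
qed

lemma prod_linear_dvd:
  fixes D :: "real poly"
  assumes "finite I" "inj_on c I" "\<And>i. i \<in> I \<Longrightarrow> poly D (c i) = 0"
  shows "(\<Prod>i\<in>I. [:- c i, 1:]) dvd D"
  using assms
proof (induction arbitrary: D rule: finite_induct)
  case (insert i I)
  obtain D' where D': "D = [:- c i, 1:] * D'"
    using insert.prems(2)[of i] by (auto simp: poly_eq_0_iff_dvd dvd_def)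
  have "poly D' (c j) = 0" if "j \<in> I" for j
  proof -
    have "c j - c i \<noteq> 0" using insert that by (auto simp: inj_on_def)
    then show ?thesis using insert.prems(2)[of j] that by (simp add: D')
  qed
  then have "(\<Prod>i\<in>I. [:- c i, 1:]) dvd D'" using insert by auto
  then show ?case unfolding D' prod.insert[OF insert.hyps(1,2)] by (rule mult_dvd_mono[OF dvd_refl])
qed simp

lemma tendsto_inverse_linear: "(\<lambda>n. a / (real n + 1 / 2 - c)) \<longlonglongrightarrow> 0"
  by real_asymp

text \<open>The limit hypothesis says that the polynomial part of the quotient is exactly z. The
  difference \<open>D\<close> of both sides vanishes at every \<open>c i\<close>, so the denominator
  \<open>B\<close> divides it, and the cofactor tends to 0 at infinity.\<close>

lemma partial_fractions:
  fixes A :: "real poly"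
  assumes I: "finite I" "inj_on c I"
    and lim: "(\<lambda>n. poly A (real n + 1 / 2) / (\<Prod>i\<in>I. real n + 1 / 2 - c i) - (real n + 1 / 2)) \<longlonglongrightarrow> 0"
  shows "poly A z = z * (\<Prod>i\<in>I. z - c i)
    + (\<Sum>i\<in>I. poly A (c i) / (\<Prod>j\<in>I - {i}. c i - c j) * (\<Prod>j\<in>I - {i}. z - c j))"
proof -
  define r where "r i = poly A (c i) / (\<Prod>j\<in>I - {i}. c i - c j)" for i
  define B where "B = (\<Prod>i\<in>I. [:- c i, 1:])"
  define D where "D = A - [:0, 1:] * B - (\<Sum>i\<in>I. smult (r i) (\<Prod>j\<in>I - {i}. [:- c j, 1:]))"
  have B: "poly B z = (\<Prod>i\<in>I. z - c i)" for z by (simp add: B_def poly_prod)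
  have D: "poly D z = poly A z - z * (\<Prod>i\<in>I. z - c i) - (\<Sum>i\<in>I. r i * (\<Prod>j\<in>I - {i}. z - c j))" for z
    by (simp add: D_def poly_sum poly_prod B)
  have "poly D (c i) = 0" if i: "i \<in> I" for i
  proof -
    have "(\<Prod>j\<in>I - {i}. c i - c j) \<noteq> 0"
      using I i by (auto simp: inj_on_def)
    moreover have "(\<Prod>j\<in>I. c i - c j) = 0" using I i by auto
    moreover have "(\<Sum>k\<in>I. r k * (\<Prod>j\<in>I - {k}. c i - c j)) = r i * (\<Prod>j\<in>I - {i}. c i - c j)"
      using I i by (subst sum.remove[OF I(1) i]) (auto intro!: sum.neutral)
    ultimately show ?thesis by (simp add: D r_def)
  qed
  then have "B dvd D" unfolding B_def using I by (intro prod_linear_dvd) auto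
  then obtain Q where Q: "D = B * Q" by (auto simp: dvd_def)
  have "eventually (\<lambda>n. \<forall>i\<in>I. c i < real n + 1 / 2) sequentially"
  proof (rule eventually_ball_finite[OF I(1)], intro ballI)
    fix i assume "i \<in> I"
    show "eventually (\<lambda>n. c i < real n + 1 / 2) sequentially" by real_asymp
  qed
  then have ev: "eventually (\<lambda>n. poly A (real n + 1 / 2) / (\<Prod>i\<in>I. real n + 1 / 2 - c i) - (real n + 1 / 2)
      - (\<Sum>i\<in>I. r i / (real n + 1 / 2 - c i)) = poly Q (real n + 1 / 2)) sequentially"
  proof eventually_elim
    case (elim n)
    define w where "w = real n + 1 / 2"
    have nz: "w - c i \<noteq> 0" if "i \<in> I" for i using elim that by (auto simp: w_def)
    have Bz: "poly B w \<noteq> 0" using nz I by (simp add: B)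
    have "r i / (w - c i) = r i * (\<Prod>j\<in>I - {i}. w - c j) / poly B w" if i: "i \<in> I" for i
      using nz I i Bz unfolding B prod.remove[OF I(1) i] by simp
    then have "(\<Sum>i\<in>I. r i / (w - c i)) = (\<Sum>i\<in>I. r i * (\<Prod>j\<in>I - {i}. w - c j)) / poly B w"
      by (simp add: sum_divide_distrib)
    moreover have "poly Q w = poly D w / poly B w" using Q Bz by simp
    ultimately show ?case
      using Bz unfolding w_def[symmetric] D B[symmetric] by (simp add: field_simps)
  qed
  have "(\<lambda>n. poly A (real n + 1 / 2) / (\<Prod>i\<in>I. real n + 1 / 2 - c i) - (real n + 1 / 2)
      - (\<Sum>i\<in>I. r i / (real n + 1 / 2 - c i))) \<longlonglongrightarrow> 0 - (\<Sum>i\<in>I. 0)"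
    by (intro tendsto_diff lim tendsto_sum tendsto_inverse_linear)
  then have "(\<lambda>n. poly Q (real n + 1 / 2)) \<longlonglongrightarrow> 0"
    using ev by (subst (asm) tendsto_cong[OF ev]) simp
  then have "Q = 0" by (rule poly_tendsto_0_imp_0)
  then have "poly D z = 0" using Q by simp
  then show ?thesis unfolding D r_def by simp
qed

lemma has_field_derivative_prod_linear:
  fixes z :: real
  assumes "finite I" "\<And>i. i \<in> I \<Longrightarrow> z - c i \<noteq> 0"
  shows "((\<lambda>z. \<Prod>i\<in>I. z - c i) has_field_derivative (\<Prod>i\<in>I. z - c i) * (\<Sum>i\<in>I. 1 / (z - c i))) (at z)"
  using assms
proof (induction rule: finite_induct)
  case (insert i I)
  have "((\<lambda>z. (z - c i) * (\<Prod>i\<in>I. z - c i)) has_field_derivative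
     (z - c i) * ((\<Prod>i\<in>I. z - c i) * (\<Sum>i\<in>I. 1 / (z - c i))) + 1 * (\<Prod>i\<in>I. z - c i)) (at z)"
    using insert by (auto intro!: derivative_eq_intros)
  moreover have "(z - c i) * ((\<Prod>i\<in>I. z - c i) * (\<Sum>i\<in>I. 1 / (z - c i))) + 1 * (\<Prod>i\<in>I. z - c i)
     = (\<Prod>i\<in>insert i I. z - c i) * (\<Sum>i\<in>insert i I. 1 / (z - c i))"
    using insert.hyps insert.prems[of i] by (simp add: distrib_left)
  ultimately show ?case using insert.hyps by simp
qed simp

definition box_prod :: "(nat \<times> nat) set \<Rightarrow> real \<Rightarrow> real" where
  "box_prod S z = (\<Prod>p\<in>S. 1 - 1 / (z - ct p)^2)"

lemma transition_gf_eq: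
  assumes z: "z \<notin> \<int>"
  shows "transition_gf S z = 1 / (z * box_prod S z)" "box_prod S z \<noteq> 0"
proof -
  have e: "(z - ct p)^2 / ((z - ct p)^2 - 1) = 1 / (1 - 1 / (z - ct p)^2)" for p
    using not_Ints_diff_nonzero[OF z, of "node_content p"] by (simp add: field_simps)
  then show "transition_gf S z = 1 / (z * box_prod S z)" by (simp add: transition_gf_def box_prod_def prod_dividef)
  have "1 - 1 / (z - ct p)^2 \<noteq> 0" for p
    using not_Ints_diff_nonzero[OF z, of "node_content p"] by (simp add: field_simps)
  then show "box_prod S z \<noteq> 0" by (cases "finite S") (auto simp: box_prod_def)
qed

text \<open>Each factor is 1 + O(1/z^2), so the product has no 1/z term. The first limit yields
  total mass one for the transition probabilities, the second their mean zero and the polynomial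
  part z of \<open>1 / transition_gf S z\<close>.\<close>

lemma box_prod_limits:
  assumes "finite S"
  shows "(\<lambda>n. box_prod S (real n + 1 / 2)) \<longlonglongrightarrow> 1"
    "(\<lambda>n. (real n + 1 / 2) * (box_prod S (real n + 1 / 2) - 1)) \<longlonglongrightarrow> 0"
  using assms
proof (induction rule: finite_induct)
  case empty
  { case 1 then show ?case by (simp add: box_prod_def) }
  { case 2 then show ?case by (simp add: box_prod_def) }
next
  case (insert p S)
  have l: "(\<lambda>n. 1 - 1 / (real n + 1 / 2 - c)^2) \<longlonglongrightarrow> 1"
    "(\<lambda>n. (real n + 1 / 2) / (real n + 1 / 2 - c)^2) \<longlonglongrightarrow> 0" for c
    by real_asymp+
  have box_prod: "box_prod (insert p S) z = (1 - 1 / (z - ct p)^2) * box_prod S z" for z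
    using insert by (simp add: box_prod_def)
  {
    case 1
    show ?case using tendsto_mult[OF l(1) insert.IH(1)] by (simp add: box_prod)
  next
    case 2
    have "(\<lambda>n. (real n + 1 / 2) * (box_prod S (real n + 1 / 2) - 1)
        - (real n + 1 / 2) / (real n + 1 / 2 - ct p)^2 * box_prod S (real n + 1 / 2)) \<longlonglongrightarrow> 0 - 0 * 1"
      by (intro tendsto_diff tendsto_mult l insert.IH)
    then show ?case by (simp add: box_prod algebra_simps)
  }
qed

text \<open>Kerov's form of the hook formula: the transition probabilities of the Plancherel growth
  process are the residues of \<open>transition_gf S\<close>.  Residues at the removable corners turn the induction
  hypothesis for the smaller diagrams into the partial fraction expansion of \<open>1 / transition_gf S\<close>, whose
  derivative closes the induction.\<close>
theorem transition_sum:
  assumes "diagram S" "z \<notin> \<int>"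
  shows "(\<Sum>p\<in>addable S. sdim (insert p S) / (z - ct p)) = (real (card S) + 1) * sdim S * transition_gf S z"
  using assms
proof (induction "card S" arbitrary: S z rule: less_induct)
  case less
  note S = less.prems(1)
  define n where "n = real (card S)"
  note fin = finite_addable[OF S] finite_removable[OF S] diagram_finite[OF S]
  define A where "A z = (\<Prod>p\<in>addable S. z - ct p)" for z
  define B where "B z = (\<Prod>p\<in>removable S. z - ct p)" for z
  define B' where "B' q z = (\<Prod>p\<in>removable S - {q}. z - ct p)" for q z
  define r where "r q = A (ct q) / B' q (ct q)" for q
  have ctinj: "inj_on ct (removable S)" "inj_on ct (addable S)"
    using node_content_inj_removable[OF S] node_content_inj_addable[OF S] by (auto simp: inj_on_def)
  have AB0: "A z \<noteq> 0" "B z \<noteq> 0" if "z \<notin> \<int>" for z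
    using not_Ints_diff_nonzero(1)[OF that] fin by (auto simp: A_def B_def)
  have GAB: "transition_gf S z = B z / A z" "transition_gf S z \<noteq> 0" if "z \<notin> \<int>" for z
    using transition_gf_corners[OF S that] AB0[OF that] by (auto simp: A_def B_def field_simps)
  have BB': "B z = (z - ct q) * B' q z" if "q \<in> removable S" for z q
    unfolding B_def B'_def using fin that by (intro prod.remove)
  have B'0: "B' q (ct q) \<noteq> 0" if "q \<in> removable S" for q
    using fin that ctinj(1) by (auto simp: B'_def inj_on_def)
  have A0: "A (ct q) \<noteq> 0" if "q \<in> removable S" for q
    using fin corner_contents_ne[OF S _ that] by (auto simp: A_def) metis
  \<comment> \<open>Off the integers \<open>A z / B z\<close> is
    \<open>1 / transition_gf S z\<close>, that is \<open>z * box_prod S z\<close>, so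
    \<open>box_prod_limits\<close> supplies the hypothesis of
    \<open>partial_fractions\<close>.\<close>
  have pf: "A z = z * B z + (\<Sum>q\<in>removable S. r q * B' q z)" for z
  proof -
    define Ap where "Ap = (\<Prod>p\<in>addable S. [:- ct p, 1:])"
    have Ap: "poly Ap z = A z" for z by (simp add: Ap_def A_def poly_prod)
    have "(real n + 1 / 2) * (box_prod S (real n + 1 / 2) - 1) = 
        poly Ap (real n + 1 / 2) / (\<Prod>i\<in>removable S. real n + 1 / 2 - ct i) - (real n + 1 / 2)" for n
    proof -
      have z: "real n + 1 / 2 \<notin> \<int>" by (rule half_notin_Ints)
      define w where "w = real n + 1 / 2"
      have "A w / B w = w * box_prod S w"
        using GAB[OF z] transition_gf_eq[OF z] AB0[OF z] unfolding w_def[symmetric] by (simp add: field_simps)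
      then show ?thesis unfolding Ap w_def[symmetric] B_def[symmetric] by (simp add: algebra_simps)
    qed
    then show ?thesis
      using partial_fractions[OF fin(2) ctinj(1), of Ap z] box_prod_limits(2)[OF fin(3)]
      unfolding Ap B_def r_def B'_def by simp
  qed
  \<comment> \<open>The induction hypothesis for \<open>S - {q}\<close> is multiplied by z - ct q,
    and z tends to ct q. On the left only p = q survives and contributes \<open>sdim S\<close>; on
    the right the factor (z - ct q)^2 - 1 tends to -1, whence the sign.\<close>
  have res: "n * sdim (S - {q}) = - r q * sdim S" if q: "q \<in> removable S" for q
  proof -
    note rq = removable_addable[OF S q]
    define x where "x = ct q"
    \<comment> \<open>The shift by 2 keeps the increment strictly between 0 and 1, so these points
      approach the integer x without being integers.\<close>
    define w where "w m = x + 1 / (real m + 2)" for m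
    have w: "w m \<notin> \<int>" for m
    proof
      assume "w m \<in> \<int>"
      then have "w m - x \<in> \<int>" unfolding x_def by auto
      then obtain i where "1 / (real m + 2) = real_of_int i" by (auto simp: w_def elim: Ints_cases)
      moreover have "0 < 1 / (real m + 2)" "1 / (real m + 2) < 1" by auto
      ultimately show False by simp
    qed
    have wx: "w \<longlonglongrightarrow> x" unfolding w_def by real_asymp
    have wx0: "w m - x \<noteq> 0" for m by (simp add: w_def)
    have "sdim S + (\<Sum>p\<in>addable (S - {q}) - {q}. (w m - x) * (sdim (insert p (S - {q})) / (w m - ct p)))
      = n * sdim (S - {q}) * (((w m - x)^2 - 1) * B' q (w m) / A (w m))" for m
    proof -
      have "(\<Sum>p\<in>addable (S - {q}). sdim (insert p (S - {q})) / (w m - ct p)) = n * sdim (S - {q}) * transition_gf (S - {q}) (w m)"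
        using less.hyps[OF _ rq(1) w] rq by (simp add: n_def)
      moreover have "(\<Sum>p\<in>addable (S - {q}). sdim (insert p (S - {q})) / (w m - ct p)) = 
          sdim S / (w m - x) + (\<Sum>p\<in>addable (S - {q}) - {q}. sdim (insert p (S - {q})) / (w m - ct p))"
        using sum.remove[OF finite_addable[OF rq(1)] rq(2), of "\<lambda>p. sdim (insert p (S - {q})) / (w m - ct p)"]
        unfolding rq(3) x_def by simp
      ultimately have "(w m - x) * (sdim S / (w m - x) + (\<Sum>p\<in>addable (S - {q}) - {q}. sdim (insert p (S - {q})) / (w m - ct p)))
        = (w m - x) * (n * sdim (S - {q}) * transition_gf (S - {q}) (w m))" by simp
      moreover have "(w m - x) * transition_gf (S - {q}) (w m) = ((w m - x)^2 - 1) * B' q (w m) / A (w m)"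
      proof -
        have nz: "(w m - x)^2 - 1 \<noteq> 0" using not_Ints_diff_nonzero(2)[OF w] by (simp add: x_def)
        have "transition_gf S (w m) = transition_gf (S - {q}) (w m) * ((w m - x)^2 / ((w m - x)^2 - 1))"
          using transition_gf_insert[of "S - {q}" q "w m"] fin unfolding rq(3) x_def by simp
        then have "transition_gf (S - {q}) (w m) * (w m - x)^2 = ((w m - x)^2 - 1) * (B' q (w m) * (w m - x) / A (w m))"
          using GAB(1)[OF w] nz BB'[OF q, of "w m"] by (simp add: x_def mult_ac nonzero_eq_divide_eq)
        then have "(w m - x) * ((w m - x) * transition_gf (S - {q}) (w m)) = (w m - x) * (((w m - x)^2 - 1) * B' q (w m) / A (w m))"
          by (simp add: power2_eq_square mult_ac)
        then show ?thesis using wx0[of m] mult_left_cancel by blast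
      qed
      moreover have "(w m - x) * (n * sdim (S - {q}) * transition_gf (S - {q}) (w m)) = n * sdim (S - {q}) * ((w m - x) * transition_gf (S - {q}) (w m))"
        by simp
      ultimately have "(w m - x) * (sdim S / (w m - x) + (\<Sum>p\<in>addable (S - {q}) - {q}. sdim (insert p (S - {q})) / (w m - ct p)))
        = n * sdim (S - {q}) * (((w m - x)^2 - 1) * B' q (w m) / A (w m))" by simp
      then show ?thesis using wx0[of m]
        by (simp add: distrib_left sum_distrib_left)
    qed
    moreover have "(\<lambda>m. sdim S + (\<Sum>p\<in>addable (S - {q}) - {q}. (w m - x) * (sdim (insert p (S - {q})) / (w m - ct p))))
       \<longlonglongrightarrow> sdim S + (\<Sum>p\<in>addable (S - {q}) - {q}. (x - x) * (sdim (insert p (S - {q})) / (x - ct p)))"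
    proof (intro tendsto_intros wx)
      fix p assume p: "p \<in> addable (S - {q}) - {q}"
      then show "x - ct p \<noteq> 0"
        using node_content_inj_addable[OF rq(1)] rq(2) by (auto simp: inj_on_def x_def)
    qed
    moreover have "(\<lambda>m. n * sdim (S - {q}) * (((w m - x)^2 - 1) * B' q (w m) / A (w m)))
       \<longlonglongrightarrow> n * sdim (S - {q}) * (((x - x)^2 - 1) * B' q x / A x)"
      unfolding B'_def A_def
      by (intro tendsto_intros wx) (use A0[OF q] in \<open>simp add: A_def x_def\<close>)
    ultimately have "sdim S = n * sdim (S - {q}) * (- B' q x / A x)"
      using LIMSEQ_unique by fastforce
    then show ?thesis using A0[OF q] B'0[OF q] by (simp add: r_def x_def field_simps)
  qed
  note z = less.prems(2)
  define P where "P = (\<Sum>p\<in>addable S. 1 / (z - ct p)) - (\<Sum>p\<in>removable S. 1 / (z - ct p))"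
  \<comment> \<open>Two derivatives of \<open>A / B\<close>: the quotient rule gives its value times
    the logarithmic derivative \<open>P\<close>, the partial fraction expansion gives the sum of
    squares.\<close>
  have der: "P / transition_gf S z = 1 - (\<Sum>q\<in>removable S. r q / (z - ct q)^2)"
  proof -
    have nz: "z - ct p \<noteq> 0" for p using not_Ints_diff_nonzero(1)[OF z] .
    have 1: "((\<lambda>z. A z / B z) has_field_derivative P / transition_gf S z) (at z)"
    proof -
      have "((\<lambda>z. A z / B z) has_field_derivative
         ((A z * (\<Sum>p\<in>addable S. 1 / (z - ct p))) * B z - A z * (B z * (\<Sum>p\<in>removable S. 1 / (z - ct p)))) / (B z * B z)) (at z)"
        unfolding A_def B_def using fin nz AB0[OF z]
        by (intro DERIV_divide has_field_derivative_prod_linear) (auto simp: A_def B_def)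
      moreover have "((A z * (\<Sum>p\<in>addable S. 1 / (z - ct p))) * B z - A z * (B z * (\<Sum>p\<in>removable S. 1 / (z - ct p)))) / (B z * B z)
         = P / transition_gf S z"
        unfolding GAB(1)[OF z] P_def using AB0[OF z] by (simp add: field_simps)
      ultimately show ?thesis by simp
    qed
    have 2: "((\<lambda>z. z + (\<Sum>q\<in>removable S. r q / (z - ct q))) has_field_derivative
        1 + (\<Sum>q\<in>removable S. - r q / (z - ct q)^2)) (at z)"
      using nz by (auto intro!: derivative_eq_intros sum.cong simp: power2_eq_square)
    have eq: "A w / B w = w + (\<Sum>q\<in>removable S. r q / (w - ct q))" if w: "w \<notin> \<int>" for w
    proof -
      have "r q / (w - ct q) = r q * B' q w / B w" if q: "q \<in> removable S" for q
        using BB'[OF q, of w] AB0(2)[OF w] by simp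
      then have "(\<Sum>q\<in>removable S. r q / (w - ct q)) = (\<Sum>q\<in>removable S. r q * B' q w) / B w"
        by (simp add: sum_divide_distrib)
      then show ?thesis unfolding pf[of w] using AB0(2)[OF w] by (simp add: field_simps)
    qed
    have "((\<lambda>z. A z / B z) has_field_derivative 1 + (\<Sum>q\<in>removable S. - r q / (z - ct q)^2)) (at z)"
      by (rule has_field_derivative_transform_within_open[OF 2, of "- \<int>"]) (use z eq closed_Ints in auto)
    then show ?thesis using DERIV_unique[OF 1] by (simp add: sum_negf)
  qed
  \<comment> \<open>The branching rule excludes the empty diagram, where both sides vanish because n
    = 0.\<close>
  have sumdim: "(\<Sum>q\<in>removable S. n * sdim (S - {q})) = n * sdim S"
  proof (cases "S = {}")
    case True
    then show ?thesis by (simp add: n_def removable_def)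
  next
    case False
    then show ?thesis using sdim_recursion[OF S] by (simp add: sum_distrib_left)
  qed
  have "(\<Sum>p\<in>addable S. sdim (insert p S) / (z - ct p)) =
     (\<Sum>q\<in>removable S. \<Sum>p\<in>addable (S - {q}). sdim (insert p (S - {q})) / (z - ct p)) + sdim S * P"
    using add_remove_swap[OF S, of "\<lambda>p. 1 / (z - ct p)"] by (simp add: P_def)
  also have "(\<Sum>q\<in>removable S. \<Sum>p\<in>addable (S - {q}). sdim (insert p (S - {q})) / (z - ct p))
     = (\<Sum>q\<in>removable S. n * sdim (S - {q}) * transition_gf (S - {q}) z)"
  proof (intro sum.cong refl)
    fix q assume q: "q \<in> removable S"
    note rq = removable_addable[OF S q]
    show "(\<Sum>p\<in>addable (S - {q}). sdim (insert p (S - {q})) / (z - ct p)) = n * sdim (S - {q}) * transition_gf (S - {q}) z"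
      using less.hyps[OF _ rq(1) z] rq by (simp add: n_def)
  qed
  also have "\<dots> = (\<Sum>q\<in>removable S. n * sdim (S - {q}) * (transition_gf S z * (1 - 1 / (z - ct q)^2)))"
  proof (intro sum.cong refl)
    fix q assume q: "q \<in> removable S"
    note rq = removable_addable[OF S q]
    have "transition_gf S z = transition_gf (S - {q}) z * ((z - ct q)^2 / ((z - ct q)^2 - 1))"
      using transition_gf_insert[of "S - {q}" q z] fin unfolding rq(3) by simp
    then have "transition_gf (S - {q}) z = transition_gf S z * (1 - 1 / (z - ct q)^2)"
      using not_Ints_diff_nonzero(1,2)[OF z, of "node_content q"] by (simp add: field_simps)
    then show "n * sdim (S - {q}) * transition_gf (S - {q}) z = n * sdim (S - {q}) * (transition_gf S z * (1 - 1 / (z - ct q)^2))" by simp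
  qed
  also have "\<dots> = transition_gf S z * ((\<Sum>q\<in>removable S. n * sdim (S - {q})) - (\<Sum>q\<in>removable S. n * sdim (S - {q}) / (z - ct q)^2))"
    by (simp add: sum_subtractf[symmetric] sum_distrib_left algebra_simps)
  also have "(\<Sum>q\<in>removable S. n * sdim (S - {q}) / (z - ct q)^2) = (\<Sum>q\<in>removable S. - r q * sdim S / (z - ct q)^2)"
    using res by (intro sum.cong refl) simp
  also have "\<dots> = sdim S * (P / transition_gf S z - 1)"
    unfolding der by (simp add: sum_distrib_left sum_negf mult.commute)
  finally have X: "(\<Sum>p\<in>addable S. sdim (insert p S) / (z - ct p)) =
      transition_gf S z * (n * sdim S - sdim S * (P / transition_gf S z - 1)) + sdim S * P"
    unfolding sumdim .
  have "transition_gf S z * (n * sdim S - sdim S * (D - 1)) + sdim S * (transition_gf S z * D) = (n + 1) * sdim S * transition_gf S z" for D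
    by (simp add: algebra_simps)
  from this[of "P / transition_gf S z"] show ?case
    unfolding n_def[symmetric] X using GAB(2)[OF z] by simp
qed

section \<open>Transition moments and the Plancherel expectation\<close>

definition trans_prob :: "(nat \<times> nat) set \<Rightarrow> nat \<times> nat \<Rightarrow> real" where
  "trans_prob S p = sdim (insert p S) / ((real (card S) + 1) * sdim S)"

definition trans_moment :: "(nat \<times> nat) set \<Rightarrow> nat \<Rightarrow> real" where
  "trans_moment S k = (\<Sum>p\<in>addable S. trans_prob S p * ct p ^ k)"

definition content_sum :: "(nat \<times> nat) set \<Rightarrow> nat \<Rightarrow> real" where
  "content_sum S k = (\<Sum>p\<in>S. ct p ^ k)"

lemma trans_prob_gf:
  assumes S: "diagram S" and z: "z \<notin> \<int>"
  shows "(\<Sum>p\<in>addable S. trans_prob S p / (z - ct p)) = transition_gf S z"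
proof -
  have c: "(real (card S) + 1) * sdim S \<noteq> 0" using sdim_pos[OF S] by (simp add: add_eq_0_iff)
  have "(\<Sum>p\<in>addable S. trans_prob S p / (z - ct p)) =
     (\<Sum>p\<in>addable S. sdim (insert p S) / (z - ct p)) / ((real (card S) + 1) * sdim S)"
    by (simp add: trans_prob_def sum_divide_distrib mult.commute)
  then show ?thesis using c unfolding transition_sum[OF S z] by simp
qed

lemma partial_fraction_limit:
  fixes a c :: "'a \<Rightarrow> real"
  assumes "finite I"
  shows "(\<lambda>n. (real n + 1 / 2) * (\<Sum>i\<in>I. a i / (real n + 1 / 2 - c i))) \<longlonglongrightarrow> (\<Sum>i\<in>I. a i)"
proof -
  have l: "(\<lambda>n. (real n + 1 / 2) / (real n + 1 / 2 - c)) \<longlonglongrightarrow> 1" for c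
    by real_asymp
  have "(\<lambda>n. \<Sum>i\<in>I. a i * ((real n + 1 / 2) / (real n + 1 / 2 - c i))) \<longlonglongrightarrow> (\<Sum>i\<in>I. a i * 1)"
    by (intro tendsto_sum tendsto_mult tendsto_const l)
  then show ?thesis by (simp add: sum_distrib_left mult_ac)
qed

lemma partial_fraction_shift:
  fixes a c :: "'a \<Rightarrow> real"
  assumes "\<And>i. i \<in> I \<Longrightarrow> z - c i \<noteq> 0"
  shows "z * (\<Sum>i\<in>I. a i / (z - c i)) - (\<Sum>i\<in>I. a i) = (\<Sum>i\<in>I. a i * c i / (z - c i))"
  unfolding sum_distrib_left sum_subtractf[symmetric]
proof (intro sum.cong refl)
  fix i assume "i \<in> I"
  then show "z * (a i / (z - c i)) - a i = a i * c i / (z - c i)"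
    using assms by (simp add: field_simps)
qed

text \<open>The coefficient of 1/z at infinity is the zeroth moment; multiplying by z and
  subtracting it raises every weight by a factor \<open>c i\<close>, which shifts the moments by one
  and allows induction.\<close>

lemma partial_fraction_moments:
  fixes a c :: "'a \<Rightarrow> real" and b d :: "'b \<Rightarrow> real"
  assumes I: "finite I" and J: "finite J"
    and c: "\<And>n i. i \<in> I \<Longrightarrow> real n + 1 / 2 - c i \<noteq> 0" and d: "\<And>n i. i \<in> J \<Longrightarrow> real n + 1 / 2 - d i \<noteq> 0"
    and eq: "\<And>n. (\<Sum>i\<in>I. a i / (real n + 1 / 2 - c i)) = (\<Sum>i\<in>J. b i / (real n + 1 / 2 - d i))"
  shows "(\<Sum>i\<in>I. a i * c i ^ k) = (\<Sum>i\<in>J. b i * d i ^ k)"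
  using eq
proof (induction k arbitrary: a b)
  case (0 a b)
  show ?case
    using partial_fraction_limit[OF I, of a c] partial_fraction_limit[OF J, of b d] LIMSEQ_unique
    unfolding 0 by simp
next
  case (Suc k a b)
  have e: "sum a I = sum b J"
    using partial_fraction_limit[OF I, of a c] partial_fraction_limit[OF J, of b d] LIMSEQ_unique
    unfolding Suc.prems by blast
  have "(\<Sum>i\<in>I. a i * c i / (real n + 1 / 2 - c i)) = (\<Sum>i\<in>J. b i * d i / (real n + 1 / 2 - d i))" for n
    using partial_fraction_shift[of I "real n + 1 / 2" c a] partial_fraction_shift[of J "real n + 1 / 2" d b]
    c d e Suc.prems[of n] by simp
  from Suc.IH[of "\<lambda>i. a i * c i" "\<lambda>i. b i * d i", OF this]
  show ?case by (simp add: mult_ac)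
qed

text \<open>That the transition probabilities sum to one is read off from the behaviour of the
  generating function at infinity, where z times it tends to 1.\<close>

lemma trans_moment_0: 
  assumes S: "diagram S"
  shows "trans_moment S 0 = 1"
proof -
  note fin = finite_addable[OF S] diagram_finite[OF S]
  have "(real n + 1 / 2) * (\<Sum>p\<in>addable S. trans_prob S p / (real n + 1 / 2 - ct p))
       = 1 / box_prod S (real n + 1 / 2)" for n
    unfolding trans_prob_gf[OF S half_notin_Ints] transition_gf_eq[OF half_notin_Ints] by (simp add: add_eq_0_iff)
  then have "(\<lambda>n. (real n + 1 / 2) * (\<Sum>p\<in>addable S. trans_prob S p / (real n + 1 / 2 - ct p))) \<longlonglongrightarrow> 1"
    using tendsto_divide[OF tendsto_const box_prod_limits(1)[OF fin(2)], of 1] by simp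
  then show ?thesis
    using LIMSEQ_unique[OF partial_fraction_limit[OF fin(1)]] by (simp add: trans_moment_def)
qed

text \<open>The added content is centred because z times the generating function has no 1/z
  term.\<close>

lemma trans_moment_1:
  assumes S: "diagram S"
  shows "trans_moment S (Suc 0) = 0"
proof -
  note fin = finite_addable[OF S] diagram_finite[OF S]
  have s: "(\<Sum>p\<in>addable S. trans_prob S p) = 1" using trans_moment_0[OF S] by (simp add: trans_moment_def)
  have "(real n + 1 / 2) * (\<Sum>p\<in>addable S. trans_prob S p * ct p / (real n + 1 / 2 - ct p))
       = - ((real n + 1 / 2) * (box_prod S (real n + 1 / 2) - 1)) / box_prod S (real n + 1 / 2)" for n
  proof -
    define w where "w = real n + 1 / 2"
    have w: "w \<notin> \<int>" unfolding w_def by (rule half_notin_Ints)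
    have "w \<noteq> 0" by (simp add: w_def add_eq_0_iff)
    have "(\<Sum>p\<in>addable S. trans_prob S p * ct p / (w - ct p)) = w * transition_gf S w - 1"
      using partial_fraction_shift[of "addable S" w ct "trans_prob S"] not_Ints_diff_nonzero[OF w]
      unfolding trans_prob_gf[OF S w] s by simp
    moreover have "w * transition_gf S w = 1 / box_prod S w" using transition_gf_eq(1)[OF w] \<open>w \<noteq> 0\<close> by simp
    ultimately have "(\<Sum>p\<in>addable S. trans_prob S p * ct p / (w - ct p)) = 1 / box_prod S w - 1" by simp
    also have "\<dots> = - (box_prod S w - 1) / box_prod S w" using transition_gf_eq(2)[OF w] by (simp add: field_simps)
    finally have e: "(\<Sum>p\<in>addable S. trans_prob S p * ct p / (w - ct p)) = - (box_prod S w - 1) / box_prod S w" .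
    show ?thesis unfolding w_def[symmetric] e by (simp only: mult_minus_right minus_divide_left times_divide_eq_right)
  qed
  then have "(\<lambda>n. (real n + 1 / 2) * (\<Sum>p\<in>addable S. trans_prob S p * ct p / (real n + 1 / 2 - ct p))) \<longlonglongrightarrow> - 0 / 1"
    using tendsto_divide[OF tendsto_minus[OF box_prod_limits(2)[OF fin(2)]] box_prod_limits(1)[OF fin(2)]] by simp
  then show ?thesis
    using LIMSEQ_unique[OF partial_fraction_limit[OF fin(1)]] by (simp add: trans_moment_def)
qed

text \<open>Clearing denominators in \<open>transition_gf_insert\<close> gives one identity between
  two Cauchy transforms, one for the new diagram and one for the old; comparing moments gives this
  recurrence.\<close>

lemma trans_moment_insert:
  assumes S: "diagram S" and q: "q \<in> addable S"
  shows "trans_moment (insert q S) (Suc (Suc k)) - 2 * ct q * trans_moment (insert q S) (Suc k)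
      + ((ct q)^2 - 1) * trans_moment (insert q S) k
    = trans_moment S (Suc (Suc k)) - 2 * ct q * trans_moment S (Suc k) + (ct q)^2 * trans_moment S k"
proof -
  define x where "x = ct q"
  note aq = addable_removable[OF S q]
  have sq: "w * (z - x)^2 / (z - c) = w * (z - 2 * x) + w * c + w * (c - x)^2 / (z - c)"
    if "z - c \<noteq> 0" for w z c :: real
  proof -
    have "w * (z - x)^2 = w * ((z - 2 * x) + c) * (z - c) + w * (c - x)^2"
      by (simp add: power2_eq_square algebra_simps)
    then show ?thesis using that by (simp add: add_divide_distrib distrib_left)
  qed
  \<comment> \<open>Multiplication by (z - x)^2 creates a polynomial part that depends only on the
    moments of order 0 and 1. These are 1 and 0 for every diagram, so the polynomial parts of the
    two diagrams cancel.\<close>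
  have gs: "(z - x)^2 * transition_gf D z = z - 2 * x + (\<Sum>p\<in>addable D. trans_prob D p * (ct p - x)^2 / (z - ct p))"
    if D: "diagram D" and z: "z \<notin> \<int>" for D z
  proof -
    have "(z - x)^2 * transition_gf D z = (\<Sum>p\<in>addable D. trans_prob D p * (z - x)^2 / (z - ct p))"
      unfolding trans_prob_gf[OF D z, symmetric] by (simp add: sum_distrib_left mult_ac)
    also have "\<dots> = (\<Sum>p\<in>addable D. trans_prob D p * (z - 2 * x) + trans_prob D p * ct p
        + trans_prob D p * (ct p - x)^2 / (z - ct p))"
      by (intro sum.cong refl sq not_Ints_diff_nonzero z)
    also have "\<dots> = z - 2 * x + (\<Sum>p\<in>addable D. trans_prob D p * (ct p - x)^2 / (z - ct p))"
      using trans_moment_0[OF D] trans_moment_1[OF D]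
      by (simp add: sum.distrib sum_distrib_right[symmetric] trans_moment_def)
    finally show ?thesis .
  qed
  have "(\<Sum>p\<in>addable (insert q S). trans_prob (insert q S) p * ((ct p - x)^2 - 1) / (z - ct p))
      = (\<Sum>p\<in>addable S. trans_prob S p * (ct p - x)^2 / (z - ct p))" if z: "z \<notin> \<int>" for z
  proof -
    have "transition_gf (insert q S) z * ((z - x)^2 - 1) = transition_gf S z * (z - x)^2"
      using transition_gf_insert[OF diagram_finite[OF S] aq(5)] not_Ints_diff_nonzero(2)[OF z]
      by (simp add: x_def)
    then have "(z - x)^2 * transition_gf (insert q S) z - transition_gf (insert q S) z = (z - x)^2 * transition_gf S z"
      by (simp add: algebra_simps)
    moreover have "(\<Sum>p\<in>addable (insert q S). trans_prob (insert q S) p * ((ct p - x)^2 - 1) / (z - ct p))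
        = (\<Sum>p\<in>addable (insert q S). trans_prob (insert q S) p * (ct p - x)^2 / (z - ct p)) - transition_gf (insert q S) z"
      unfolding trans_prob_gf[OF aq(1) z, symmetric]
      by (simp add: sum_subtractf right_diff_distrib diff_divide_distrib)
    ultimately show ?thesis
      unfolding gs[OF S z] gs[OF aq(1) z] by linarith
  qed
  then have "(\<Sum>p\<in>addable (insert q S). trans_prob (insert q S) p * ((ct p - x)^2 - 1) * ct p ^ k)
      = (\<Sum>p\<in>addable S. trans_prob S p * (ct p - x)^2 * ct p ^ k)"
    using half_notin_Ints not_Ints_diff_nonzero(1)
    by (intro partial_fraction_moments finite_addable S aq) auto
  then show ?thesis
    unfolding trans_moment_def x_def[symmetric]
    by (simp add: sum_distrib_left sum_subtractf[symmetric] sum.distrib[symmetric] power2_eq_square algebra_simps)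
qed

section \<open>The Plancherel measure as the marginal law of the growth process\<close>

definition shapes :: "nat \<Rightarrow> (nat \<times> nat) set set" where
  "shapes n = {S. diagram S \<and> card S = n}"

definition expect :: "nat \<Rightarrow> ((nat \<times> nat) set \<Rightarrow> real) \<Rightarrow> real" where
  "expect n f = (\<Sum>S\<in>shapes n. (sdim S)^2 / fact n * f S)"

lemma finite_shapes: "finite (shapes n)"
proof (rule finite_subset)
  show "shapes n \<subseteq> Pow ({..n} \<times> {..n})"
    using diagram_card_bound by (force simp: shapes_def)
qed auto

text \<open>One factor \<open>sdim S\<close> of the weight is expanded by the branching rule; pairs
  (diagram, corner) are then reread as pairs (smaller diagram, addable node), and the leftover ratio
  of dimensions is \<open>trans_prob\<close>.\<close>

lemma expect_Suc:
  "expect (Suc n) f = expect n (\<lambda>S. \<Sum>p\<in>addable S. trans_prob S p * f (insert p S))"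
proof -
  let ?X = "SIGMA S:shapes (Suc n). removable S" and ?Y = "SIGMA S:shapes n. addable S"
  have "expect (Suc n) f = (\<Sum>S\<in>shapes (Suc n). \<Sum>q\<in>removable S. sdim S * sdim (S - {q}) / fact (Suc n) * f S)"
    unfolding expect_def
  proof (intro sum.cong refl)
    fix S assume "S \<in> shapes (Suc n)"
    then have "diagram S" "S \<noteq> {}" by (auto simp: shapes_def)
    then have "(sdim S)^2 = (\<Sum>q\<in>removable S. sdim S * sdim (S - {q}))"
      using sdim_recursion by (simp add: power2_eq_square sum_distrib_left)
    then show "(sdim S)\<^sup>2 / fact (Suc n) * f S = (\<Sum>q\<in>removable S. sdim S * sdim (S - {q}) / fact (Suc n) * f S)"
      by (simp add: sum_divide_distrib sum_distrib_right)
  qed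
  also have "\<dots> = (\<Sum>(S,q)\<in>?X. sdim S * sdim (S - {q}) / fact (Suc n) * f S)"
    using finite_shapes finite_removable by (subst sum.Sigma) (auto simp: shapes_def)
  also have "\<dots> = (\<Sum>(S,p)\<in>?Y. sdim (insert p S) * sdim S / fact (Suc n) * f (insert p S))"
  proof (rule sum.reindex_bij_witness[where i = "\<lambda>(S, p). (insert p S, p)" and j = "\<lambda>(S, q). (S - {q}, q)"])
    fix x assume "x \<in> ?X"
    then obtain S q where x: "x = (S, q)" "diagram S" "card S = Suc n" "q \<in> removable S"
      by (auto simp: shapes_def)
    note r = removable_addable[OF x(2,4)]
    show "(\<lambda>(S, p). (insert p S, p)) ((\<lambda>(S, q). (S - {q}, q)) x) = x"
      using r x(1) by (simp add: insert_absorb)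
    show "(\<lambda>(S, q). (S - {q}, q)) x \<in> ?Y" using r x by (simp add: shapes_def)
    show "(case (\<lambda>(S, q). (S - {q}, q)) x of (S, p) \<Rightarrow> sdim (insert p S) * sdim S / fact (Suc n) * f (insert p S))
      = (case x of (S, q) \<Rightarrow> sdim S * sdim (S - {q}) / fact (Suc n) * f S)"
      using r(3) x(1) by simp
  next
    fix x assume "x \<in> ?Y"
    then obtain S p where x: "x = (S, p)" "diagram S" "card S = n" "p \<in> addable S"
      by (auto simp: shapes_def)
    note r = addable_removable[OF x(2,4)]
    show "(\<lambda>(S, q). (S - {q}, q)) ((\<lambda>(S, p). (insert p S, p)) x) = x"
      using r x(1) by simp
    show "(\<lambda>(S, p). (insert p S, p)) x \<in> ?X" using r x by (simp add: shapes_def)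
  qed
  also have "\<dots> = (\<Sum>S\<in>shapes n. \<Sum>p\<in>addable S. sdim (insert p S) * sdim S / fact (Suc n) * f (insert p S))"
    using finite_shapes finite_addable by (subst sum.Sigma) (auto simp: shapes_def)
  also have "\<dots> = expect n (\<lambda>S. \<Sum>p\<in>addable S. trans_prob S p * f (insert p S))"
    unfolding expect_def
  proof (intro sum.cong refl)
    fix S assume "S \<in> shapes n"
    then have "sdim S > 0" "card S = n" using sdim_pos by (auto simp: shapes_def)
    then show "(\<Sum>p\<in>addable S. sdim (insert p S) * sdim S / fact (Suc n) * f (insert p S)) =
      (sdim S)\<^sup>2 / fact n * (\<Sum>p\<in>addable S. trans_prob S p * f (insert p S))"
      unfolding sum_distrib_left
      by (intro sum.cong refl) (simp add: trans_prob_def power2_eq_square mult_ac add.commute)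
  qed
  finally show ?thesis .
qed

lemma shapes_0: "shapes 0 = {{}}"
  by (auto simp: shapes_def diagram_finite)

lemma expect_0: "expect 0 f = f {}"
  by (simp add: expect_def shapes_0)

lemma expect_cong: "(\<And>S. diagram S \<Longrightarrow> card S = n \<Longrightarrow> f S = g S) \<Longrightarrow> expect n f = expect n g"
  unfolding expect_def by (intro sum.cong) (auto simp: shapes_def)

lemma expect_mono: "(\<And>S. diagram S \<Longrightarrow> card S = n \<Longrightarrow> f S \<le> g S) \<Longrightarrow> expect n f \<le> expect n g"
  unfolding expect_def by (intro sum_mono mult_left_mono) (auto simp: shapes_def)

lemma expect_nonneg: "(\<And>S. diagram S \<Longrightarrow> card S = n \<Longrightarrow> 0 \<le> f S) \<Longrightarrow> 0 \<le> expect n f"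
  unfolding expect_def by (intro sum_nonneg mult_nonneg_nonneg) (auto simp: shapes_def)

lemma expect_add: "expect n (\<lambda>S. f S + g S) = expect n f + expect n g"
  by (simp add: expect_def sum.distrib distrib_left)

lemma expect_diff: "expect n (\<lambda>S. f S - g S) = expect n f - expect n g"
  by (simp add: expect_def sum_subtractf right_diff_distrib)

lemma expect_cmult: "expect n (\<lambda>S. c * f S) = c * expect n f"
  by (simp add: expect_def sum_distrib_left mult_ac)

lemma expect_sum: "expect n (\<lambda>S. \<Sum>i\<in>I. f i S) = (\<Sum>i\<in>I. expect n (f i))"
  unfolding expect_def sum_distrib_left by (rule sum.swap)

text \<open>Equivalent to the squares of the dimensions summing to n!, here a consequence of the
  transition probabilities summing to one at every step.\<close>

lemma expect_const: "expect n (\<lambda>S. c) = c"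
proof (induction n)
  case 0
  show ?case by (simp add: expect_0)
next
  case (Suc n)
  have "(\<Sum>p\<in>addable S. trans_prob S p * c) = c" if "diagram S" for S
    using trans_moment_0[OF that] by (simp add: trans_moment_def sum_distrib_right[symmetric])
  then have "expect n (\<lambda>S. \<Sum>p\<in>addable S. trans_prob S p * c) = expect n (\<lambda>S. c)"
    by (intro expect_cong)
  then show ?case unfolding expect_Suc Suc .
qed

section \<open>Semicircle moments and asymptotic summation\<close>

text \<open>The Catalan numbers, read off from the expansion of \<open>(1 - sqrt (1 - 4 x)) / (2 x)\<close>.\<close>
definition cat :: "nat \<Rightarrow> real" where
  "cat i = (- 1) ^ i * 2 * 4 ^ i * ((1/2) gchoose (Suc i))"

lemma cat_0: "cat 0 = 1"
  by (simp add: cat_def)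

text \<open>This first-order recurrence is the form in which the Catalan numbers are later matched
  with the integrals of \<open>rho\<close>.\<close>

lemma cat_Suc: "(real i + 2) * cat (Suc i) = (4 * real i + 2) * cat i"
proof -
  have "(1/2 :: real) * (1/2 gchoose Suc i) = real (Suc i) * (1/2 gchoose Suc i) + real (Suc (Suc i)) * (1/2 gchoose Suc (Suc i))"
    by (rule gbinomial_mult_1)
  then have *: "(real i + 2) * (1/2 gchoose Suc (Suc i)) = - (real i + 1/2) * (1/2 gchoose Suc i)"
    by (simp add: algebra_simps)
  have "(real i + 2) * cat (Suc i) = (- 1) ^ Suc i * 2 * 4 ^ Suc i * ((real i + 2) * (1/2 gchoose Suc (Suc i)))"
    by (simp add: cat_def)
  also have "\<dots> = (4 * real i + 2) * cat i"
    unfolding * by (simp add: cat_def algebra_simps)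
  finally show ?thesis .
qed

text \<open>The square of the series of sqrt (1 - 4 x) is 1 - 4 x, so by Vandermonde its
  coefficients beyond degree one vanish; the two end terms of the convolution are moved to the other
  side.\<close>

lemma cat_convolution: "(\<Sum>i\<le>m. cat i * cat (m - i)) = cat (Suc m)"
proof -
  let ?g = "\<lambda>k. (1/2 :: real) gchoose k"
  have "(\<Sum>k=0..Suc (Suc m). ?g k * ?g (Suc (Suc m) - k)) = (1/2 + 1/2 :: real) gchoose Suc (Suc m)"
    by (rule gbinomial_Vandermonde)
  also have "\<dots> = 0"
    using binomial_gbinomial[of 1 "Suc (Suc m)", where ?'a = real] by (simp add: binomial_eq_0)
  also have "(\<Sum>k=0..Suc (Suc m). ?g k * ?g (Suc (Suc m) - k)) =
      ?g (Suc (Suc m)) + (\<Sum>k\<le>m. ?g (Suc k) * ?g (Suc (m - k))) + ?g (Suc (Suc m))"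
  proof -
    have "(\<Sum>k=0..Suc (Suc m). ?g k * ?g (Suc (Suc m) - k)) = ?g (Suc (Suc m)) + (\<Sum>k\<le>Suc m. ?g (Suc k) * ?g (Suc m - k))"
      unfolding atMost_atLeast0[symmetric] by (subst sum.atMost_Suc_shift) simp
    also have "(\<Sum>k\<le>Suc m. ?g (Suc k) * ?g (Suc m - k)) = (\<Sum>k\<le>m. ?g (Suc k) * ?g (Suc m - k)) + ?g (Suc (Suc m))"
      by simp
    also have "(\<Sum>k\<le>m. ?g (Suc k) * ?g (Suc m - k)) = (\<Sum>k\<le>m. ?g (Suc k) * ?g (Suc (m - k)))"
      by (intro sum.cong refl) (simp add: Suc_diff_le)
    finally show ?thesis by simp
  qed
  finally have s: "(\<Sum>k\<le>m. ?g (Suc k) * ?g (Suc (m - k))) = - 2 * ?g (Suc (Suc m))" by simp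
  have "(\<Sum>i\<le>m. cat i * cat (m - i)) = (\<Sum>i\<le>m. (- 1) ^ m * 4 * 4 ^ m * (?g (Suc i) * ?g (Suc (m - i))))"
  proof (intro sum.cong refl)
    fix i assume "i \<in> {..m}"
    then have "m = i + (m - i)" by simp
    then have "(- 1 :: real) ^ m = (- 1) ^ i * (- 1) ^ (m - i)" "(4 :: real) ^ m = 4 ^ i * 4 ^ (m - i)"
      by (metis power_add)+
    then show "cat i * cat (m - i) = (- 1) ^ m * 4 * 4 ^ m * (?g (Suc i) * ?g (Suc (m - i)))"
      by (simp add: cat_def)
  qed
  also have "\<dots> = (- 1) ^ m * 4 * 4 ^ m * (- 2 * ?g (Suc (Suc m)))"
    by (simp add: s sum_distrib_left[symmetric])
  finally show ?thesis by (simp add: cat_def)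
qed

text \<open>The moments of the semicircle law on [-2, 2] with variance one, given by their values
  instead of an integral.\<close>

definition semicircle_moment :: "nat \<Rightarrow> real" where
  "semicircle_moment k = (if even k then cat (k div 2) else 0)"

lemma semicircle_convolution:
  "(\<Sum>j\<le>k. semicircle_moment j * semicircle_moment (k - j)) = semicircle_moment (k + 2)"
proof (cases "even k")
  case False
  then have "semicircle_moment j * semicircle_moment (k - j) = 0" if "j \<le> k" for j
    using that by (auto simp: semicircle_moment_def)
  then show ?thesis using False by (subst sum.neutral) (auto simp: semicircle_moment_def)
next
  case True
  then obtain m where m: "k = 2 * m" by (auto elim: evenE)
  have "(\<Sum>j\<le>k. semicircle_moment j * semicircle_moment (k - j)) =
      (\<Sum>j\<in>(\<lambda>i. 2 * i) ` {..m}. semicircle_moment j * semicircle_moment (k - j))"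
  proof (rule sum.mono_neutral_right)
    show "\<forall>j\<in>{..k} - (\<lambda>i. 2 * i) ` {..m}. semicircle_moment j * semicircle_moment (k - j) = 0"
      by (auto simp: m semicircle_moment_def image_iff elim!: evenE)
  qed (auto simp: m)
  also have "\<dots> = (\<Sum>i\<le>m. cat i * cat (m - i))"
    by (subst sum.reindex) (auto simp: m semicircle_moment_def inj_on_def diff_mult_distrib2[symmetric])
  finally show ?thesis using cat_convolution by (simp add: m semicircle_moment_def)
qed

text \<open>Averaging with the reflection of j into k - j replaces the weight j + 1 by (k + 2) / 2.
  This is the equation that a limit of the transition moments has to satisfy: the left side is the
  mean increment, the right side the derivative of a multiple of n^((k + 2) / 2).\<close>

lemma semicircle_weighted_convolution:
  "(\<Sum>j\<le>k. (real j + 1) * semicircle_moment j * semicircle_moment (k - j))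
    = (real k + 2) / 2 * semicircle_moment (k + 2)"
proof -
  let ?s = semicircle_moment
  define X where "X = (\<Sum>j\<le>k. (real j + 1) * ?s j * ?s (k - j))"
  have "X = (\<Sum>j\<le>k. (real (k - j) + 1) * ?s (k - j) * ?s (k - (k - j)))"
    unfolding X_def by (rule sum.reindex_bij_witness[where i = "\<lambda>j. k - j" and j = "\<lambda>j. k - j"]) auto
  also have "\<dots> = (\<Sum>j\<le>k. (real (k - j) + 1) * ?s (k - j) * ?s j)"
    by (intro sum.cong refl) simp
  finally have "X + X = (\<Sum>j\<le>k. (real j + 1) * ?s j * ?s (k - j)) + (\<Sum>j\<le>k. (real (k - j) + 1) * ?s (k - j) * ?s j)"
    unfolding X_def by simp
  also have "\<dots> = (\<Sum>j\<le>k. (real k + 2) * (?s j * ?s (k - j)))"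
    unfolding sum.distrib[symmetric] by (intro sum.cong refl) (simp add: of_nat_diff algebra_simps)
  also have "\<dots> = (real k + 2) * ?s (k + 2)"
    by (simp add: sum_distrib_left[symmetric] semicircle_convolution)
  finally show ?thesis unfolding X_def by simp
qed

section \<open>From asymptotics of increments to asymptotics of values\<close>

lemma stolz_cesaro:
  fixes a b :: "nat \<Rightarrow> real"
  assumes b: "strict_mono b" "filterlim b at_top sequentially"
    and lim: "(\<lambda>n. (a (Suc n) - a n) / (b (Suc n) - b n)) \<longlonglongrightarrow> L"
  shows "(\<lambda>n. a n / b n) \<longlonglongrightarrow> L"
proof (rule LIMSEQ_I)
  fix e :: real assume e: "0 < e"
  obtain N where N: "\<And>n. n \<ge> N \<Longrightarrow> \<bar>(a (Suc n) - a n) / (b (Suc n) - b n) - L\<bar> < e / 2"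
    using LIMSEQ_D[OF lim, of "e / 2"] e by auto
  have increment: "\<bar>(a (Suc n) - L * b (Suc n)) - (a n - L * b n)\<bar> \<le> e / 2 * (b (Suc n) - b n)" if "n \<ge> N" for n
  proof -
    define D where "D = b (Suc n) - b n"
    have D: "D > 0" using b(1) by (simp add: D_def strict_mono_Suc_iff)
    have "(E / D - L) * D = E - L * D" for E
      using D by (simp add: left_diff_distrib)
    from this[of "a (Suc n) - a n"]
    have eq: "((a (Suc n) - a n) / D - L) * D = (a (Suc n) - L * b (Suc n)) - (a n - L * b n)"
      by (simp add: D_def right_diff_distrib)
    have "\<bar>((a (Suc n) - a n) / D - L) * D\<bar> \<le> e / 2 * D"
      using N[OF that] D by (simp add: abs_mult D_def[symmetric] mult_right_mono)
    then show ?thesis unfolding eq unfolding D_def .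
  qed
  have telescope: "\<bar>(a n - L * b n) - (a N - L * b N)\<bar> \<le> e / 2 * (b n - b N)" if "n \<ge> N" for n
    using that
  proof (induction n rule: dec_induct)
    case (step n)
    then show ?case using increment[of n] unfolding right_diff_distrib by linarith
  qed simp
  have main: "\<bar>a n - L * b n\<bar> \<le> e / 2 * b n + (\<bar>a N - L * b N\<bar> + e / 2 * \<bar>b N\<bar>)" if "n \<ge> N" for n
  proof -
    have "\<bar>(a n - L * b n) - (a N - L * b N)\<bar> \<le> e / 2 * b n - e / 2 * b N"
      using telescope[OF that] by (simp add: right_diff_distrib)
    moreover have "e / 2 * (- b N) \<le> e / 2 * \<bar>b N\<bar>" using e by (intro mult_left_mono) auto
    then have "- (e / 2 * b N) \<le> e / 2 * \<bar>b N\<bar>" unfolding mult_minus_right .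
    ultimately show ?thesis by linarith
  qed
  define C where "C = \<bar>a N - L * b N\<bar> + e / 2 * \<bar>b N\<bar>"
  have "eventually (\<lambda>n. b n > max 1 (2 * C / e + 1)) sequentially"
    using b(2) unfolding filterlim_at_top_dense by blast
  then have "eventually (\<lambda>n. norm (a n / b n - L) < e) sequentially"
    using eventually_ge_at_top[of N]
  proof eventually_elim
    case (elim n)
    then have bn: "b n > 0" "2 * C / e < b n" by auto
    have "C < e / 2 * b n" using bn e by (simp add: field_simps)
    then have "\<bar>a n - L * b n\<bar> < e * b n" using main[OF elim(2)] C_def by (simp add: field_simps)
    moreover have "a n / b n - L = (a n - L * b n) / b n" using bn by (simp add: field_simps)
    ultimately show ?case using bn by (simp add: field_simps)
  qed
  then show "\<exists>no. \<forall>n\<ge>no. norm (a n / b n - L) < e" by (simp add: eventually_sequentially)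
qed

text \<open>The derivative of (1 + t)^((k + 2) / 2) at 0, taken along t = 1/n.\<close>

lemma sqrt_power_increment:
  "(\<lambda>n. (sqrt (real (Suc n)) ^ (k + 2) - sqrt (real n) ^ (k + 2)) / sqrt (real n) ^ k) \<longlonglongrightarrow> (real k + 2) / 2"
proof -
  have "((\<lambda>t. sqrt (1 + t) ^ (k + 2)) has_field_derivative (real k + 2) / 2) (at 0)"
    by (auto intro!: derivative_eq_intros simp: field_simps)
  then have "((\<lambda>h. (sqrt (1 + h) ^ (k + 2) - 1) / h) \<longlongrightarrow> (real k + 2) / 2) (at 0)"
    by (simp add: DERIV_def)
  moreover have "filterlim (\<lambda>n. 1 / real n) (at 0) sequentially"
    by real_asymp
  ultimately have "(\<lambda>n. (sqrt (1 + 1 / real n) ^ (k + 2) - 1) / (1 / real n)) \<longlonglongrightarrow> (real k + 2) / 2"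
    by (rule filterlim_compose)
  moreover have "eventually (\<lambda>n. (sqrt (1 + 1 / real n) ^ (k + 2) - 1) / (1 / real n) =
     (sqrt (real (Suc n)) ^ (k + 2) - sqrt (real n) ^ (k + 2)) / sqrt (real n) ^ k) sequentially"
    using eventually_gt_at_top[of 0]
  proof eventually_elim
    case (elim n)
    have n: "real (Suc n) = real n * (1 + 1 / real n)" using elim by (simp add: field_simps)
    have s: "sqrt (real (Suc n)) = sqrt (real n) * sqrt (1 + 1 / real n)" unfolding n by (rule real_sqrt_mult)
    have P: "sqrt (real n) ^ (k + 2) = sqrt (real n) ^ k * real n" by (simp add: power_add)
    have "sqrt (real (Suc n)) ^ (k + 2) - sqrt (real n) ^ (k + 2) = sqrt (real n) ^ k * (real n * (sqrt (1 + 1 / real n) ^ (k + 2) - 1))"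
      unfolding s power_mult_distrib P by (simp only: right_diff_distrib mult_1_right mult.assoc)
    then show ?case using elim by simp
  qed
  ultimately show ?thesis by (rule Lim_transform_eventually)
qed

lemma sqrt_power_stolz:
  fixes a :: "nat \<Rightarrow> real"
  assumes "(\<lambda>n. (a (Suc n) - a n) / sqrt (real n) ^ k) \<longlonglongrightarrow> (real k + 2) / 2 * L"
  shows "(\<lambda>n. a n / sqrt (real n) ^ (k + 2)) \<longlonglongrightarrow> L"
proof (rule stolz_cesaro)
  show "strict_mono (\<lambda>n. sqrt (real n) ^ (k + 2))"
    by (intro strict_monoI power_strict_mono) auto
  show "filterlim (\<lambda>n. sqrt (real n) ^ (k + 2)) at_top sequentially"
    by (intro filterlim_pow_at_top filterlim_compose[OF sqrt_at_top] filterlim_real_sequentially) auto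
  have "(\<lambda>n. ((a (Suc n) - a n) / sqrt (real n) ^ k) / ((sqrt (real (Suc n)) ^ (k + 2) - sqrt (real n) ^ (k + 2)) / sqrt (real n) ^ k))
     \<longlonglongrightarrow> ((real k + 2) / 2 * L) / ((real k + 2) / 2)"
    by (intro tendsto_divide assms sqrt_power_increment) auto
  moreover have "eventually (\<lambda>n. ((a (Suc n) - a n) / sqrt (real n) ^ k) / ((sqrt (real (Suc n)) ^ (k + 2) - sqrt (real n) ^ (k + 2)) / sqrt (real n) ^ k) = (a (Suc n) - a n) / (sqrt (real (Suc n)) ^ (k + 2) - sqrt (real n) ^ (k + 2))) sequentially"
    using eventually_gt_at_top[of 0] by eventually_elim simp
  ultimately show "(\<lambda>n. (a (Suc n) - a n) / (sqrt (real (Suc n)) ^ (k + 2) - sqrt (real n) ^ (k + 2))) \<longlonglongrightarrow> L"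
    by (auto intro: Lim_transform_eventually simp: add_eq_0_iff)
qed

section \<open>Asymptotics of monomials in the transition moments and content sums\<close>

text \<open>The algebra of functions on diagrams generated by the transition moments and the content
  sums, graded so that \<open>trans_moment _ k\<close> has weight \<open>k\<close> and \<open>content_sum _ k\<close> weight \<open>k + 2\<close>.\<close>
datatype gen = Mom nat | Con nat

fun gval :: "(nat \<times> nat) set \<Rightarrow> gen \<Rightarrow> real" where
  "gval S (Mom k) = trans_moment S k"
| "gval S (Con k) = content_sum S k"

fun gweight :: "gen \<Rightarrow> nat" where
  "gweight (Mom k) = k"
| "gweight (Con k) = k + 2"

text \<open>A content sum of order k accumulates transition moments of size
  \<open>semicircle_moment k\<close> times n^(k/2); summing over n divides by k/2 + 1 and raises the
  power by one, which also explains its weight k + 2.\<close>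

fun glim :: "gen \<Rightarrow> real" where
  "glim (Mom k) = semicircle_moment k"
| "glim (Con k) = semicircle_moment k / (real k / 2 + 1)"

definition mono_val :: "gen list \<Rightarrow> (nat \<times> nat) set \<Rightarrow> real" where
  "mono_val gs S = prod_list (map (gval S) gs)"

definition mono_weight :: "gen list \<Rightarrow> nat" where
  "mono_weight gs = sum_list (map gweight gs)"

definition mono_lim :: "gen list \<Rightarrow> real" where
  "mono_lim gs = prod_list (map glim gs)"

lemma mono_simps [simp]:
  "mono_val [] S = 1" "mono_val (g # gs) S = gval S g * mono_val gs S" "mono_val (gs @ hs) S = mono_val gs S * mono_val hs S"
  "mono_weight [] = 0" "mono_weight (g # gs) = gweight g + mono_weight gs" "mono_weight (gs @ hs) = mono_weight gs + mono_weight hs"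
  "mono_lim [] = 1" "mono_lim (g # gs) = glim g * mono_lim gs" "mono_lim (gs @ hs) = mono_lim gs * mono_lim hs"
  by (simp_all add: mono_val_def mono_weight_def mono_lim_def)

text \<open>The real argument stands for the content of the added node and has weight 1. The bound
  is an integer because k - 2 and k - 3 may be negative; a negative bound admits only the zero
  function.\<close>

inductive weight_le :: "int \<Rightarrow> ((nat \<times> nat) set \<Rightarrow> real \<Rightarrow> real) \<Rightarrow> bool" where
  weight_le_zero: "weight_le K (\<lambda>S x. 0)"
| weight_le_add: "weight_le K f \<Longrightarrow> weight_le K g \<Longrightarrow> weight_le K (\<lambda>S x. f S x + g S x)"
| weight_le_mono: "int (mono_weight gs) + int r \<le> K \<Longrightarrow> weight_le K (\<lambda>S x. a * mono_val gs S * x ^ r)"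

lemma weight_le_trans: "weight_le J f \<Longrightarrow> J \<le> K \<Longrightarrow> weight_le K f"
proof (induction J f rule: weight_le.induct)
  case (weight_le_mono gs r J a)
  then show ?case by (intro weight_le.weight_le_mono) simp
qed (simp_all add: weight_le_zero weight_le_add)

lemma weight_le_mult:
  assumes "weight_le J f" "weight_le K g"
  shows "weight_le (J + K) (\<lambda>S x. f S x * g S x)"
  using assms(1)
proof (induction J f rule: weight_le.induct)
  case (weight_le_zero J)
  show ?case by (simp add: weight_le.weight_le_zero)
next
  case (weight_le_add J f h)
  then show ?case using weight_le.weight_le_add by (simp add: distrib_right)
next
  case (weight_le_mono gs r J a)
  show ?case using assms(2)
  proof (induction K g rule: weight_le.induct)
    case (weight_le_zero K)
    show ?case by (simp add: weight_le.weight_le_zero)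
  next
    case (weight_le_add K f h)
    then show ?case using weight_le.weight_le_add by (simp add: distrib_left)
  next
    case (weight_le_mono hs s K b)
    have "weight_le (J + K) (\<lambda>S x. (a * b) * mono_val (gs @ hs) S * x ^ (r + s))"
      using weight_le_mono \<open>int (mono_weight gs) + int r \<le> J\<close> by (intro weight_le.weight_le_mono) auto
    then show ?case by (simp add: power_add mult_ac)
  qed
qed

lemma weight_le_single:
  "weight_le (int (gweight g)) (\<lambda>S x. gval S g)" "weight_le (int (mono_weight gs)) (\<lambda>S x. mono_val gs S)"
  "weight_le 1 (\<lambda>S x. x)" "weight_le (int (r::nat)) (\<lambda>S x. x ^ r)" "weight_le 0 (\<lambda>S x. a)"
  using weight_le_mono[of "[g]" 0 _ 1] weight_le_mono[of gs 0 _ 1] weight_le_mono[of "[]" 1 1 1]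
    weight_le_mono[of "[]" r r 1] weight_le_mono[of "[]" 0 0 a]
  by simp_all

lemma weight_le_cmult: "weight_le K f \<Longrightarrow> weight_le K (\<lambda>S x. a * f S x)"
  using weight_le_mult[OF weight_le_single(5)[of a], of K f] by simp

text \<open>\<open>mom_lead\<close> is the part of weight \<open>k - 2\<close> of the increment of the \<open>k\<close>-th transition moment
  when a node of content \<open>x\<close> is added; \<open>mom_rest\<close> has smaller weight.\<close>
fun mom_lead :: "nat \<Rightarrow> (nat \<times> nat) set \<Rightarrow> real \<Rightarrow> real" where
  "mom_lead 0 S x = 0"
| "mom_lead (Suc 0) S x = 0"
| "mom_lead (Suc (Suc k)) S x = (\<Sum>j\<le>k. (real j + 1) * (x ^ j * trans_moment S (k - j)))"

text \<open>The coefficients j + 1 are those of 1 / (1 - x t)^2, so they solve the recurrence with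
  double root x that \<open>trans_moment_insert\<close> prescribes.\<close>

lemma mom_lead_rec:
  "mom_lead (Suc (Suc k)) S x = 2 * x * mom_lead (Suc k) S x - x\<^sup>2 * mom_lead k S x + trans_moment S k"
proof -
  consider "k = 0" | "k = 1" | m where "k = Suc (Suc m)" by (metis One_nat_def not0_implies_Suc)
  then show ?thesis
  proof cases
    case (3 m)
    \<comment> \<open>All terms are brought to the same powers and range, so that only coefficients
      remain to be compared: 2 j - (j - 1) = j + 1 for positive j, while at j = 0 the truncated
      difference is 0 and the indicator supplies the 1.\<close>
    let ?f = "\<lambda>c. \<Sum>j\<le>Suc (Suc m). c j * (x ^ j * trans_moment S (k - j))"
    have "2 * x * mom_lead (Suc k) S x = ?f (\<lambda>j. 2 * real j)"
      unfolding 3 sum.atMost_Suc_shift[of _ "Suc m"]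
      by (simp add: sum_distrib_left algebra_simps del: sum.atMost_Suc)
    moreover have "x\<^sup>2 * mom_lead k S x = ?f (\<lambda>j. real (j - 1))"
      unfolding 3 sum.atMost_Suc_shift[of _ "Suc m"] sum.atMost_Suc_shift[of _ m]
      by (simp add: sum_distrib_left power2_eq_square algebra_simps del: sum.atMost_Suc)
    moreover have "trans_moment S k = ?f (\<lambda>j. if j = 0 then 1 else 0)"
      by (subst sum.remove[of _ 0]) auto
    moreover have "mom_lead (Suc (Suc k)) S x = ?f (\<lambda>j. real j + 1)" by (simp add: 3 del: sum.atMost_Suc)
    moreover have "?f (\<lambda>j. real j + 1) = ?f (\<lambda>j. 2 * real j) - ?f (\<lambda>j. real (j - 1)) + ?f (\<lambda>j. if j = 0 then 1 else 0)"
      unfolding sum_subtractf[symmetric] sum.distrib[symmetric] left_diff_distrib[symmetric] distrib_right[symmetric]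
      by (intro sum.cong refl) (auto simp: of_nat_diff)
    ultimately show ?thesis by simp
  qed (auto simp: power2_eq_square)
qed

text \<open>The recurrence of \<open>mom_lead_rec\<close> with another source:
  \<open>trans_moment_insert\<close> contains the lower moment of the enlarged diagram, whose old
  value feeds \<open>mom_lead\<close> and whose own increment feeds \<open>mom_rest\<close>.\<close>

fun mom_rest :: "nat \<Rightarrow> (nat \<times> nat) set \<Rightarrow> real \<Rightarrow> real" where
  "mom_rest 0 S x = 0"
| "mom_rest (Suc 0) S x = 0"
| "mom_rest (Suc (Suc k)) S x = (2 * (x * mom_rest (Suc k) S x) + (- 1) * (x * (x * mom_rest k S x)))
     + (mom_lead k S x + mom_rest k S x)"

lemma trans_moment_increment:
  assumes S: "diagram S" "p \<in> addable S"
  shows "trans_moment (insert p S) k = trans_moment S k + mom_lead k S (ct p) + mom_rest k S (ct p)"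
proof (induction k rule: less_induct)
  case (less k)
  consider "k = 0" | "k = 1" | m where "k = Suc (Suc m)" by (metis One_nat_def not0_implies_Suc)
  then show ?case
  proof cases
    case 1
    then show ?thesis using trans_moment_0 S addable_removable(1)[OF S] by simp
  next
    case 2
    then show ?thesis using trans_moment_1 S addable_removable(1)[OF S] by simp
  next
    case (3 m)
    define x where "x = ct p"
    let ?M = "trans_moment (insert p S)" and ?N = "trans_moment S"
    have "?M k = ?N k + 2 * x * (?M (Suc m) - ?N (Suc m)) - x\<^sup>2 * (?M m - ?N m) + ?M m"
      using trans_moment_insert[OF S, of m] unfolding 3 x_def by (simp add: algebra_simps)
    moreover have "?M (Suc m) - ?N (Suc m) = mom_lead (Suc m) S x + mom_rest (Suc m) S x"
      "?M m - ?N m = mom_lead m S x + mom_rest m S x" "?M m = ?N m + mom_lead m S x + mom_rest m S x"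
      using less.IH[of m] less.IH[of "Suc m"] 3 by (simp_all add: x_def)
    moreover have "mom_lead k S x = 2 * x * mom_lead (Suc m) S x - x\<^sup>2 * mom_lead m S x + ?N m"
      unfolding 3 by (rule mom_lead_rec)
    ultimately show ?thesis unfolding 3 x_def[symmetric]
      by (simp add: algebra_simps power2_eq_square del: mom_lead.simps)
  qed
qed

lemma weight_le_sum:
  "finite I \<Longrightarrow> (\<And>i. i \<in> I \<Longrightarrow> weight_le K (f i)) \<Longrightarrow> weight_le K (\<lambda>S x. \<Sum>i\<in>I. f i S x)"
  by (induction rule: finite_induct) (simp_all add: weight_le_zero weight_le_add)

lemma weight_le_mom_lead: "weight_le (int k - 2) (mom_lead k)"
proof -
  consider "k = 0" | "k = 1" | m where "k = Suc (Suc m)" by (metis One_nat_def not0_implies_Suc)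
  then show ?thesis
  proof cases
    case (3 m)
    have "weight_le (int m) (\<lambda>S x. \<Sum>j\<le>m. (real j + 1) * (x ^ j * trans_moment S (m - j)))"
    proof (intro weight_le_sum weight_le_cmult)
      fix j assume "j \<in> {..m}"
      then show "weight_le (int m) (\<lambda>S x. x ^ j * trans_moment S (m - j))"
        using weight_le_mult[OF weight_le_single(4) weight_le_single(1)[of "Mom (m - j)"], of j]
        by (simp add: of_nat_diff)
    qed simp
    moreover have "mom_lead k = (\<lambda>S x. \<Sum>j\<le>m. (real j + 1) * (x ^ j * trans_moment S (m - j)))"
      unfolding 3 by (intro ext) (rule mom_lead.simps)
    ultimately show ?thesis by (simp add: 3)
  next
    case 1
    then have "mom_lead k = (\<lambda>S x. 0)" by (intro ext) simp
    then show ?thesis by (simp only: weight_le_zero)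
  next
    case 2
    then have "mom_lead k = (\<lambda>S x. 0)" by (intro ext) simp
    then show ?thesis by (simp only: weight_le_zero)
  qed
qed

lemma weight_le_mom_rest: "weight_le (int k - 3) (mom_rest k)"
proof (induction k rule: less_induct)
  case (less k)
  consider "k = 0" | "k = 1" | m where "k = Suc (Suc m)" by (metis One_nat_def not0_implies_Suc)
  then show ?case
  proof cases
    case (3 m)
    have 1: "weight_le (int (Suc m) - 3) (mom_rest (Suc m))" "weight_le (int m - 3) (mom_rest m)"
      using less[of "Suc m"] less[of m] 3 by simp_all
    have "weight_le (int k - 3) (\<lambda>S x. 2 * (x * mom_rest (Suc m) S x))"
      using weight_le_cmult[OF weight_le_mult[OF weight_le_single(3) 1(1)]] by (simp add: 3)
    moreover have "weight_le (int k - 3) (\<lambda>S x. - 1 * (x * (x * mom_rest m S x)))"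
      using weight_le_cmult[OF weight_le_mult[OF weight_le_single(3) weight_le_mult[OF weight_le_single(3) 1(2)]], of "-1"]
      by (simp add: 3)
    moreover have "weight_le (int k - 3) (\<lambda>S x. mom_lead m S x)"
      using weight_le_trans[OF weight_le_mom_lead[of m]] by (simp add: 3)
    moreover have "weight_le (int k - 3) (\<lambda>S x. mom_rest m S x)"
      using weight_le_trans[OF 1(2)] by (simp add: 3)
    ultimately have "weight_le (int k - 3) (\<lambda>S x. (2 * (x * mom_rest (Suc m) S x) + (- 1) * (x * (x * mom_rest m S x)))
      + (mom_lead m S x + mom_rest m S x))" by (intro weight_le_add)
    moreover have "mom_rest k = (\<lambda>S x. (2 * (x * mom_rest (Suc m) S x) + (- 1) * (x * (x * mom_rest m S x)))
      + (mom_lead m S x + mom_rest m S x))" unfolding 3 by (intro ext) simp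
    ultimately show ?thesis by simp
  next
    case 1
    then have "mom_rest k = (\<lambda>S x. 0)" by (intro ext) simp
    then show ?thesis by (simp only: weight_le_zero)
  next
    case 2
    then have "mom_rest k = (\<lambda>S x. 0)" by (intro ext) simp
    then show ?thesis by (simp only: weight_le_zero)
  qed
qed

fun glead :: "gen \<Rightarrow> (nat \<times> nat) set \<Rightarrow> real \<Rightarrow> real" where
  "glead (Mom k) = mom_lead k"
| "glead (Con k) = (\<lambda>S x. x ^ k)"

fun grest :: "gen \<Rightarrow> (nat \<times> nat) set \<Rightarrow> real \<Rightarrow> real" where
  "grest (Mom k) = mom_rest k"
| "grest (Con k) = (\<lambda>S x. 0)"

lemma gval_increment:
  assumes S: "diagram S" "p \<in> addable S"
  shows "gval (insert p S) g = gval S g + glead g S (ct p) + grest g S (ct p)"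
  using S trans_moment_increment[OF S] addable_removable(5)[OF S] diagram_finite[OF S(1)]
  by (cases g) (auto simp: content_sum_def)

lemma weight_le_glead: "weight_le (int (gweight g) - 2) (glead g)"
  using weight_le_mom_lead weight_le_single(4) by (cases g) auto

lemma weight_le_grest: "weight_le (int (gweight g) - 3) (grest g)"
  using weight_le_mom_rest weight_le_zero by (cases g) auto

text \<open>The Leibniz rule for the leading increments: one factor is varied at a time.\<close>

fun mono_lead :: "gen list \<Rightarrow> (nat \<times> nat) set \<Rightarrow> real \<Rightarrow> real" where
  "mono_lead [] S x = 0"
| "mono_lead (g # gs) S x = glead g S x * mono_val gs S + gval S g * mono_lead gs S x"

lemma weight_le_mono_lead: "weight_le (int (mono_weight gs) - 2) (mono_lead gs)"
proof (induction gs)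
  case Nil
  have "mono_lead [] = (\<lambda>S x. 0)" by (intro ext) simp
  then show ?case by (simp add: weight_le_zero)
next
  case (Cons g gs)
  have "weight_le (int (mono_weight (g # gs)) - 2) (\<lambda>S x. glead g S x * mono_val gs S)"
    using weight_le_mult[OF weight_le_glead[of g] weight_le_single(2)[of gs]] by (simp add: algebra_simps)
  moreover have "weight_le (int (mono_weight (g # gs)) - 2) (\<lambda>S x. gval S g * mono_lead gs S x)"
    using weight_le_mult[OF weight_le_single(1)[of g] Cons] by (simp add: algebra_simps)
  ultimately have "weight_le (int (mono_weight (g # gs)) - 2) (\<lambda>S x. glead g S x * mono_val gs S + gval S g * mono_lead gs S x)"
    by (rule weight_le_add)
  moreover have "mono_lead (g # gs) = (\<lambda>S x. glead g S x * mono_val gs S + gval S g * mono_lead gs S x)"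
    by (intro ext) simp
  ultimately show ?case by simp
qed

text \<open>Expanding the product, a term with a \<open>grest\<close> factor loses weight three or
  more, and so does one with two varied factors, since each \<open>glead\<close> already loses
  two.\<close>

lemma mono_increment:
  "\<exists>R. weight_le (int (mono_weight gs) - 3) R \<and> (\<forall>S p. diagram S \<longrightarrow> p \<in> addable S \<longrightarrow>
     mono_val gs (insert p S) = mono_val gs S + mono_lead gs S (ct p) + R S (ct p))"
proof (induction gs)
  case Nil
  show ?case by (intro exI[of _ "\<lambda>S x. 0"]) (simp add: weight_le_zero)
next
  case (Cons g gs)
  then obtain R where R: "weight_le (int (mono_weight gs) - 3) R"
    "\<And>S p. diagram S \<Longrightarrow> p \<in> addable S \<Longrightarrow>
     mono_val gs (insert p S) = mono_val gs S + mono_lead gs S (ct p) + R S (ct p)" by blast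
  define R' where "R' = (\<lambda>S x. grest g S x * mono_val gs S + (gval S g * R S x + (glead g S x * R S x
     + (grest g S x * R S x + (glead g S x * mono_lead gs S x + grest g S x * mono_lead gs S x)))))"
  let ?K = "int (mono_weight (g # gs)) - 3"
  have "weight_le ?K R'" unfolding R'_def
  proof (intro weight_le_add)
    show "weight_le ?K (\<lambda>S x. grest g S x * mono_val gs S)"
      using weight_le_trans[OF weight_le_mult[OF weight_le_grest[of g] weight_le_single(2)[of gs]], of ?K] by simp
    show "weight_le ?K (\<lambda>S x. gval S g * R S x)"
      using weight_le_trans[OF weight_le_mult[OF weight_le_single(1)[of g] R(1)], of ?K] by simp
    show "weight_le ?K (\<lambda>S x. glead g S x * R S x)"
      using weight_le_trans[OF weight_le_mult[OF weight_le_glead[of g] R(1)], of ?K] by simp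
    show "weight_le ?K (\<lambda>S x. grest g S x * R S x)"
      using weight_le_trans[OF weight_le_mult[OF weight_le_grest[of g] R(1)], of ?K] by simp
    show "weight_le ?K (\<lambda>S x. glead g S x * mono_lead gs S x)"
      using weight_le_trans[OF weight_le_mult[OF weight_le_glead[of g] weight_le_mono_lead[of gs]], of ?K] by simp
    show "weight_le ?K (\<lambda>S x. grest g S x * mono_lead gs S x)"
      using weight_le_trans[OF weight_le_mult[OF weight_le_grest[of g] weight_le_mono_lead[of gs]], of ?K] by simp
  qed
  moreover have "mono_val (g # gs) (insert p S) = mono_val (g # gs) S + mono_lead (g # gs) S (ct p) + R' S (ct p)"
    if "diagram S" "p \<in> addable S" for S p
    unfolding mono_simps mono_lead.simps R(2)[OF that] gval_increment[OF that] R'_def by (simp add: algebra_simps)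
  ultimately show ?case by blast
qed

definition growth_expect :: "nat \<Rightarrow> ((nat \<times> nat) set \<Rightarrow> real \<Rightarrow> real) \<Rightarrow> real" where
  "growth_expect n f = expect n (\<lambda>S. \<Sum>p\<in>addable S. trans_prob S p * f S (ct p))"

lemma growth_expect_add: "growth_expect n (\<lambda>S x. f S x + g S x) = growth_expect n f + growth_expect n g"
  by (simp add: growth_expect_def expect_add[symmetric] sum.distrib distrib_left)

lemma growth_expect_cmult: "growth_expect n (\<lambda>S x. c * f S x) = c * growth_expect n f"
  by (simp add: growth_expect_def expect_cmult[symmetric] sum_distrib_left mult_ac)

lemma growth_expect_sum: "growth_expect n (\<lambda>S x. \<Sum>i\<in>I. f i S x) = (\<Sum>i\<in>I. growth_expect n (f i))"
  unfolding growth_expect_def expect_sum[symmetric] sum_distrib_left by (subst sum.swap) simp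

text \<open>Averaging over the added node turns the power x^r into the generator
  \<open>Mom r\<close> of the same weight, so one-step expectations never leave the algebra.\<close>

lemma growth_expect_mono:
  "growth_expect n (\<lambda>S x. mono_val gs S * x ^ r) = expect n (mono_val (Mom r # gs))"
  unfolding growth_expect_def
  by (rule expect_cong) (simp add: trans_moment_def sum_distrib_left sum_distrib_right mult_ac)

text \<open>Each monomial of smaller weight is of its own order by the hypothesis, and the surplus
  powers of \<open>1 / sqrt n\<close> send it to 0.\<close>

lemma weight_le_growth_expect:
  assumes "weight_le J f" "J \<le> int K - 1"
    and IH: "\<And>hs. mono_weight hs < K \<Longrightarrow> (\<lambda>n. expect n (mono_val hs) / sqrt (real n) ^ mono_weight hs) \<longlonglongrightarrow> mono_lim hs"
  shows "(\<lambda>n. growth_expect n f / sqrt (real n) ^ K) \<longlonglongrightarrow> 0"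
  using assms(1,2)
proof (induction J f rule: weight_le.induct)
  case (weight_le_zero J)
  show ?case by (simp add: growth_expect_def expect_const)
next
  case (weight_le_add J f g)
  then show ?case using tendsto_add[of _ 0 _ _ 0] by (simp add: growth_expect_add add_divide_distrib)
next
  case (weight_le_mono gs r J a)
  define w where "w = mono_weight (Mom r # gs)"
  have w: "w < K" using weight_le_mono by (simp add: w_def)
  have "(\<lambda>n. a * (expect n (mono_val (Mom r # gs)) / sqrt (real n) ^ w) * (1 / sqrt (real n)) ^ (K - w)) \<longlonglongrightarrow> a * mono_lim (Mom r # gs) * 0 ^ (K - w)"
    unfolding w_def by (intro tendsto_intros IH) (use w w_def in simp, real_asymp)
  moreover have "a * (expect n (mono_val (Mom r # gs)) / sqrt (real n) ^ w) * (1 / sqrt (real n)) ^ (K - w)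
     = growth_expect n (\<lambda>S x. a * mono_val gs S * x ^ r) / sqrt (real n) ^ K" for n
  proof -
    have "sqrt (real n) ^ K = sqrt (real n) ^ w * sqrt (real n) ^ (K - w)" using w by (simp flip: power_add)
    then show ?thesis
      by (simp add: growth_expect_cmult growth_expect_mono mult.assoc power_divide del: mono_simps)
  qed
  ultimately show ?case using w by (simp add: power_0_left)
qed

text \<open>The list \<open>ks\<close> collects the factors already passed by the Leibniz rule.
  Every generator g contributes \<open>gweight g / 2 * glim g\<close> times the limits of the
  others: by \<open>semicircle_weighted_convolution\<close> for a transition moment, by cancellation
  of k/2 + 1 for a content sum. The contributions add up to half the total weight.\<close>

lemma mono_lead_growth_expect:
  assumes IH: "\<And>hs. mono_weight hs = K \<Longrightarrow> (\<lambda>n. expect n (mono_val hs) / sqrt (real n) ^ K) \<longlonglongrightarrow> mono_lim hs"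
    and "mono_weight gs + mono_weight ks = K + 2"
  shows "(\<lambda>n. growth_expect n (\<lambda>S x. mono_val ks S * mono_lead gs S x) / sqrt (real n) ^ K)
    \<longlonglongrightarrow> real (mono_weight gs) / 2 * mono_lim gs * mono_lim ks"
  using assms(2)
proof (induction gs arbitrary: ks)
  case Nil
  then show ?case by (simp add: growth_expect_def expect_const)
next
  case (Cons g gs)
  have 1: "(\<lambda>n. growth_expect n (\<lambda>S x. mono_val (ks @ gs) S * glead g S x) / sqrt (real n) ^ K)
     \<longlonglongrightarrow> real (gweight g) / 2 * glim g * mono_lim (ks @ gs)"
  proof (cases g)
    case (Con k)
    then have "(\<lambda>n. expect n (mono_val (Mom k # ks @ gs)) / sqrt (real n) ^ K) \<longlonglongrightarrow> mono_lim (Mom k # ks @ gs)"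
      using Cons.prems by (intro IH) simp
    moreover have "real (gweight g) / 2 * glim g = semicircle_moment k"
      using Con by (simp add: field_simps)
    moreover have "growth_expect n (\<lambda>S x. mono_val (ks @ gs) S * glead g S x) = expect n (mono_val (Mom k # ks @ gs))" for n
      unfolding Con glead.simps by (rule growth_expect_mono)
    ultimately show ?thesis by (simp only: mono_simps(8) glim.simps)
  next
    case (Mom k)
    consider "k = 0" | "k = 1" | m where "k = Suc (Suc m)" by (metis One_nat_def not0_implies_Suc)
    then show ?thesis
    proof cases
      case (3 m)
      have e: "growth_expect n (\<lambda>S x. mono_val (ks @ gs) S * glead g S x) =
        (\<Sum>j\<le>m. (real j + 1) * expect n (mono_val (Mom j # Mom (m - j) # ks @ gs)))" for n
        unfolding growth_expect_mono[symmetric] growth_expect_cmult[symmetric] growth_expect_sum[symmetric] Mom 3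
        by (simp add: sum_distrib_left mult_ac)
      have "(\<lambda>n. \<Sum>j\<le>m. (real j + 1) * (expect n (mono_val (Mom j # Mom (m - j) # ks @ gs)) / sqrt (real n) ^ K))
        \<longlonglongrightarrow> (\<Sum>j\<le>m. (real j + 1) * mono_lim (Mom j # Mom (m - j) # ks @ gs))"
        using Cons.prems Mom 3 by (intro tendsto_sum tendsto_mult tendsto_const IH) auto
      also have "(\<Sum>j\<le>m. (real j + 1) * mono_lim (Mom j # Mom (m - j) # ks @ gs))
        = (\<Sum>j\<le>m. (real j + 1) * semicircle_moment j * semicircle_moment (m - j)) * mono_lim (ks @ gs)"
        unfolding sum_distrib_right by (intro sum.cong refl) simp
      also have "\<dots> = real (gweight g) / 2 * glim g * mono_lim (ks @ gs)"
        unfolding semicircle_weighted_convolution Mom 3 by simp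
      finally show ?thesis unfolding e by (simp only: sum_divide_distrib times_divide_eq_right)
    qed (auto simp: Mom semicircle_moment_def growth_expect_def expect_const)
  qed
  have 2: "(\<lambda>n. growth_expect n (\<lambda>S x. mono_val (g # ks) S * mono_lead gs S x) / sqrt (real n) ^ K)
    \<longlonglongrightarrow> real (mono_weight gs) / 2 * mono_lim gs * mono_lim (g # ks)"
    using Cons.prems by (intro Cons.IH) simp
  have "growth_expect n (\<lambda>S x. mono_val ks S * mono_lead (g # gs) S x) =
    growth_expect n (\<lambda>S x. mono_val (ks @ gs) S * glead g S x) + growth_expect n (\<lambda>S x. mono_val (g # ks) S * mono_lead gs S x)" for n
    unfolding growth_expect_add[symmetric] by (simp add: algebra_simps)
  then show ?case using tendsto_add[OF 1 2] by (simp add: add_divide_distrib algebra_simps)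
qed

text \<open>For weight k + 2 the mean increment involves only monomials of weight at most k, which
  are known by induction, and \<open>sqrt_power_stolz\<close> sums it. Since \<open>mono_lim\<close>
  is a product, generators become asymptotically deterministic.\<close>

theorem mono_expect_asymptotics:
  "(\<lambda>n. expect n (mono_val gs) / sqrt (real n) ^ mono_weight gs) \<longlonglongrightarrow> mono_lim gs"
proof (induction "mono_weight gs" arbitrary: gs rule: less_induct)
  case less
  obtain R where R: "weight_le (int (mono_weight gs) - 3) R"
    "\<And>S p. diagram S \<Longrightarrow> p \<in> addable S \<Longrightarrow>
     mono_val gs (insert p S) = mono_val gs S + mono_lead gs S (ct p) + R S (ct p)"
    using mono_increment by blast
  have step: "expect (Suc n) (mono_val gs) - expect n (mono_val gs) = growth_expect n (mono_lead gs) + growth_expect n R" for n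
  proof -
    have "expect (Suc n) (mono_val gs) = expect n (\<lambda>S. mono_val gs S + (\<Sum>p\<in>addable S. trans_prob S p * (mono_lead gs S (ct p) + R S (ct p))))"
      unfolding expect_Suc
    proof (rule expect_cong)
      fix S assume S: "diagram S"
      have "(\<Sum>p\<in>addable S. trans_prob S p * mono_val gs (insert p S)) =
        (\<Sum>p\<in>addable S. trans_prob S p * mono_val gs S + trans_prob S p * (mono_lead gs S (ct p) + R S (ct p)))"
        using R(2)[OF S] by (intro sum.cong refl) (simp add: algebra_simps)
      also have "\<dots> = (\<Sum>p\<in>addable S. trans_prob S p) * mono_val gs S + (\<Sum>p\<in>addable S. trans_prob S p * (mono_lead gs S (ct p) + R S (ct p)))"
        by (simp add: sum.distrib sum_distrib_right)
      also have "(\<Sum>p\<in>addable S. trans_prob S p) = 1" using trans_moment_0[OF S] by (simp add: trans_moment_def)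
      finally show "(\<Sum>p\<in>addable S. trans_prob S p * mono_val gs (insert p S)) =
        mono_val gs S + (\<Sum>p\<in>addable S. trans_prob S p * (mono_lead gs S (ct p) + R S (ct p)))" by simp
    qed
    then show ?thesis unfolding growth_expect_add[symmetric] by (simp add: expect_add growth_expect_def)
  qed
  consider "mono_weight gs = 0" | "mono_weight gs = 1" | k where "mono_weight gs = k + 2"
    by (metis One_nat_def add_2_eq_Suc' not0_implies_Suc)
  then show ?case
  proof cases
    case (3 k)
    have "(\<lambda>n. growth_expect n (\<lambda>S x. mono_val [] S * mono_lead gs S x) / sqrt (real n) ^ k)
      \<longlonglongrightarrow> real (mono_weight gs) / 2 * mono_lim gs * mono_lim []"
      using less 3 by (intro mono_lead_growth_expect) auto
    from tendsto_add[OF this weight_le_growth_expect[OF R(1), of k]] less 3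
    have "(\<lambda>n. (expect (Suc n) (mono_val gs) - expect n (mono_val gs)) / sqrt (real n) ^ k) \<longlonglongrightarrow> (real k + 2) / 2 * mono_lim gs"
      unfolding step add_divide_distrib by (simp add: add_divide_distrib add.commute[of 1])
    then show ?thesis unfolding 3 by (rule sqrt_power_stolz)
  next
    case 1
    \<comment> \<open>Below weight two no increment is analysed: weight 0 leaves only factors
      \<open>Mom 0\<close>, identically 1, and weight 1 forces a factor \<open>Mom 1\<close>,
      identically 0.\<close>
    then have "\<forall>g\<in>set gs. g = Mom 0"
    proof (induction gs)
      case (Cons g gs)
      then show ?case by (cases g) auto
    qed simp
    then have "mono_lim gs = 1" "diagram S \<Longrightarrow> mono_val gs S = 1" for S
      by (induction gs) (auto simp: semicircle_moment_def cat_0 trans_moment_0)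
    then show ?thesis using 1 expect_cong[of _ "mono_val gs" "\<lambda>S. 1"] by (simp add: expect_const)
  next
    case 2
    then have "Mom 1 \<in> set gs"
    proof (induction gs)
      case (Cons g gs)
      then show ?case by (cases g) (auto simp: add_is_1)
    qed simp
    then have "mono_lim gs = 0" "diagram S \<Longrightarrow> mono_val gs S = 0" for S
      by (induction gs) (auto simp: semicircle_moment_def trans_moment_1)
    then show ?thesis using expect_cong[of _ "mono_val gs" "\<lambda>S. 0"] by (simp add: expect_const)
  qed
qed

section \<open>The limit shape\<close>

lemma Omega_eq: "\<bar>u\<bar> \<le> 2 \<Longrightarrow> Omega u = 2 / pi * (u * arcsin (u / 2) + sqrt (4 - u\<^sup>2))"
  by (simp add: Omega_def)

lemma Omega_outside: "2 \<le> \<bar>u\<bar> \<Longrightarrow> Omega u = \<bar>u\<bar>"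
proof -
  assume "2 \<le> \<bar>u\<bar>"
  then consider "\<bar>u\<bar> > 2" | "u = 2" | "u = - 2" by linarith
  then show ?thesis by cases (auto simp: Omega_def)
qed

lemma Omega_minus: "Omega (- u) = Omega u"
  by (auto simp: Omega_def arcsin_minus)

lemma sqrt_4_half: 
  assumes "\<bar>u\<bar> < 2"
  shows "sqrt (1 - (u / 2)\<^sup>2) = sqrt (4 - u\<^sup>2) / 2" "0 < 4 - u\<^sup>2"
proof -
  have eq: "1 - (u / 2)\<^sup>2 = (4 - u\<^sup>2) / 4" by (simp add: power2_eq_square field_simps)
  show "sqrt (1 - (u / 2)\<^sup>2) = sqrt (4 - u\<^sup>2) / 2" unfolding eq by (simp add: real_sqrt_divide)
  have "u\<^sup>2 < 2\<^sup>2" using assms power2_abs[of u] power_strict_mono[of "\<bar>u\<bar>" 2 2] by simp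
  then show "0 < 4 - u\<^sup>2" by simp
qed

lemma DERIV_arcsin_half:
  assumes "\<bar>u\<bar> < 2"
  shows "((\<lambda>u. arcsin (u / 2)) has_field_derivative 1 / sqrt (4 - u\<^sup>2)) (at u)"
proof -
  have "((\<lambda>u. arcsin (u / 2)) has_field_derivative inverse (sqrt (1 - (u / 2)\<^sup>2)) * (1 / 2)) (at u)"
    by (rule DERIV_chain2[OF DERIV_arcsin]) (use assms in \<open>auto intro!: derivative_eq_intros\<close>)
  then show ?thesis unfolding sqrt_4_half(1)[OF assms] by (simp add: field_simps)
qed

lemma DERIV_sqrt_4:
  assumes "\<bar>u\<bar> < 2"
  shows "((\<lambda>u. sqrt (4 - u\<^sup>2)) has_field_derivative - u / sqrt (4 - u\<^sup>2)) (at u)"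
  using sqrt_4_half(2)[OF assms]
  by (auto intro!: derivative_eq_intros simp: field_simps)

lemma DERIV_Omega:
  assumes u: "\<bar>u\<bar> < 2"
  shows "(Omega has_field_derivative 2 / pi * arcsin (u / 2)) (at u)"
proof -
  have "((\<lambda>u. 2 / pi * (u * arcsin (u / 2) + sqrt (4 - u\<^sup>2))) has_field_derivative
     2 / pi * (u * (1 / sqrt (4 - u\<^sup>2)) + 1 * arcsin (u / 2) + - u / sqrt (4 - u\<^sup>2))) (at u)"
    by (intro DERIV_cmult DERIV_add DERIV_sqrt_4 u DERIV_mult[OF DERIV_ident DERIV_arcsin_half[OF u], THEN DERIV_cong]) simp
  then have d: "((\<lambda>u. 2 / pi * (u * arcsin (u / 2) + sqrt (4 - u\<^sup>2))) has_field_derivative 2 / pi * arcsin (u / 2)) (at u)"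
    by simp
  have ev: "eventually (\<lambda>v. 2 / pi * (v * arcsin (v / 2) + sqrt (4 - v\<^sup>2)) = Omega v) (nhds u)"
    using eventually_nhds_in_open[of "{-2<..<2}" u] u
    by (rule_tac eventually_mono[OF eventually_nhds_in_open[of "{-2<..<2}" u]]) (auto simp: Omega_def)
  show ?thesis using DERIV_cong_ev[OF refl ev refl] d by blast
qed

lemma continuous_on_Omega_inner: "continuous_on {-2..2} Omega"
proof -
  have "continuous_on {-2..2} (\<lambda>u::real. 2 / pi * (u * arcsin (u / 2) + sqrt (4 - u\<^sup>2)))"
    by (intro continuous_intros) auto
  then show ?thesis by (subst continuous_on_cong[OF refl]) (auto simp: Omega_def)
qed

lemma continuous_on_Omega: "continuous_on A Omega"
proof -
  have "continuous_on ({-2..2} \<union> ({..-2} \<union> {2..})) Omega"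
  proof (rule continuous_on_closed_Un)
    have "continuous_on ({..-2} \<union> {2..}) (\<lambda>u::real. \<bar>u\<bar>)" by (intro continuous_intros)
    then show "continuous_on ({..-2} \<union> {2..}) Omega"
      by (subst continuous_on_cong[OF refl]) (auto simp: Omega_outside)
  qed (auto intro: continuous_on_Omega_inner)
  then show ?thesis by (rule continuous_on_subset) auto
qed

lemma arcsin_half_bounds:
  "\<bar>u\<bar> < 2 \<Longrightarrow> 2 / pi * arcsin (u / 2) < 1" "\<bar>u\<bar> < 2 \<Longrightarrow> - 1 < 2 / pi * arcsin (u / 2)"
proof -
  assume "\<bar>u\<bar> < 2"
  then have "- (pi / 2) < arcsin (u / 2) \<and> arcsin (u / 2) < pi / 2"
    by (intro arcsin_lt_bounded) auto
  then show "2 / pi * arcsin (u / 2) < 1" "- 1 < 2 / pi * arcsin (u / 2)"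
    by (auto simp: field_simps)
qed

text \<open>The uniqueness in the definition of \<open>x_plus\<close> involves \<open>deriv Omega\<close> at the end points too.\<close>
lemma DERIV_Omega_2: "(Omega has_field_derivative 1) (at 2)"
proof -
  have lim: "(Omega has_field_derivative 1) (at_left 2)"
  proof -
    have "((\<lambda>y. (Omega y - Omega 2) / (y - 2)) \<longlongrightarrow> 1) (at_left 2)"
    proof (rule lhopital_left)
      show "((\<lambda>y. Omega y - Omega 2) \<longlongrightarrow> 0) (at_left 2)"
        using continuous_on_Omega[of UNIV]
        by (auto simp: continuous_on_eq_continuous_at isCont_def LIM_zero_iff intro: filterlim_mono at_le)
      show "((\<lambda>y. y - 2) \<longlongrightarrow> 0) (at_left (2::real))" by (auto intro!: tendsto_eq_intros)
      have ev: "eventually (\<lambda>y. y \<in> {0<..<2}) (at_left (2::real))" by (rule eventually_at_leftI[of 0]) auto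
      show "eventually (\<lambda>y. y - 2 \<noteq> 0) (at_left (2::real))" using ev by eventually_elim auto
      show "eventually (\<lambda>y. (1::real) \<noteq> 0) (at_left (2::real))" by simp
      show "eventually (\<lambda>y. ((\<lambda>y. Omega y - Omega 2) has_real_derivative 2 / pi * arcsin (y / 2)) (at y)) (at_left 2)"
        using ev by eventually_elim (auto intro!: derivative_eq_intros DERIV_Omega)
      show "eventually (\<lambda>y. ((\<lambda>y. y - 2) has_real_derivative 1) (at y)) (at_left 2)"
        by (auto intro!: derivative_eq_intros always_eventually)
      have "((\<lambda>y. 2 / pi * arcsin (y / 2)) \<longlongrightarrow> 2 / pi * arcsin (2 / 2)) (at 2 within {-2..2})"
      proof -
        have "continuous_on {-2..2} (\<lambda>y::real. 2 / pi * arcsin (y / 2))" by (intro continuous_intros) auto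
        then show ?thesis unfolding continuous_on_def by (rule bspec) simp
      qed
      moreover have "at (2::real) within {-2..2} = at_left 2" by (rule at_within_Icc_at_left) simp
      ultimately show "((\<lambda>y. 2 / pi * arcsin (y / 2) / 1) \<longlongrightarrow> 1) (at_left 2)" by simp
    qed
    then show ?thesis by (simp add: has_field_derivative_iff)
  qed
  have "((\<lambda>y. y) has_field_derivative 1) (at_right (2::real))" by (rule DERIV_ident)
  then have "((\<lambda>y. (Omega y - Omega 2) / (y - 2)) \<longlongrightarrow> 1) (at_right 2)"
    unfolding has_field_derivative_iff
    by (rule Lim_transform_eventually) (auto simp: eventually_at_filter Omega_outside)
  with lim have "((\<lambda>y. (Omega y - Omega 2) / (y - 2)) \<longlongrightarrow> 1) (at 2)"
    unfolding has_field_derivative_iff by (simp add: filterlim_split_at)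
  then show ?thesis by (simp add: has_field_derivative_iff)
qed

lemma DERIV_Omega_minus_2: "(Omega has_field_derivative - 1) (at (- 2))"
proof -
  have "((\<lambda>u. Omega (- u)) has_field_derivative 1 * - 1) (at (- 2))"
    by (rule DERIV_chain2[where f = Omega]) (use DERIV_Omega_2 in \<open>auto intro!: derivative_eq_intros\<close>)
  then show ?thesis by (simp add: Omega_minus)
qed

text \<open>The witness inverts 2/pi arcsin (u/2) explicitly. For uniqueness the end points must be
  excluded; there the derivative is 1 or -1, which a in [0, 1) rules out.\<close>

lemma x_plus_eq:
  assumes a: "0 \<le> a" "a < 1"
  shows "x_plus a = 2 * sin (pi * a / 2)" "0 \<le> x_plus a" "x_plus a < 2" "2 / pi * arcsin (x_plus a / 2) = a"
proof -
  define x where "x = 2 * sin (pi * a / 2)"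
  have b: "0 \<le> pi * a / 2" "pi * a / 2 < pi / 2" using a by auto
  have nb: "- (pi / 2) \<le> pi * a / 2" by (rule order_trans[OF _ b(1)]) simp
  have as: "arcsin (x / 2) = pi * a / 2"
    unfolding x_def nonzero_mult_div_cancel_left[OF zero_neq_numeral[symmetric]]
    using nb b(2) by (intro arcsin_sin) auto
  have x0: "0 \<le> x" unfolding x_def using b by (intro mult_nonneg_nonneg sin_ge_zero) auto
  have "sin (pi * a / 2) < sin (pi / 2)" using b(2) nb by (intro sin_monotone_2pi) auto
  then have x2: "x < 2" by (simp add: x_def)
  have dx: "deriv Omega u = 2 / pi * arcsin (u / 2)" if "\<bar>u\<bar> < 2" for u
    using DERIV_Omega[OF that] by (rule DERIV_imp_deriv)
  have eq: "x_plus a = x" unfolding x_plus_def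
  proof (rule the_equality)
    show "x \<in> {-2..2} \<and> deriv Omega x = a" using x0 x2 dx[of x] as by simp
    fix y assume y: "y \<in> {-2..2} \<and> deriv Omega y = a"
    then have "y \<noteq> 2" "y \<noteq> - 2"
      using a DERIV_imp_deriv[OF DERIV_Omega_2] DERIV_imp_deriv[OF DERIV_Omega_minus_2] by auto
    then have y2: "\<bar>y\<bar> < 2" using y by auto
    then have "arcsin (y / 2) = arcsin (x / 2)" using dx[OF y2] y as by (simp add: field_simps)
    then have "y / 2 = x / 2" using y2 x0 x2 by (subst (asm) arcsin_eq_iff) auto
    then show "y = x" by simp
  qed
  show "x_plus a = 2 * sin (pi * a / 2)" "0 \<le> x_plus a" "x_plus a < 2"
    using eq x0 x2 by (auto simp: x_def)
  show "2 / pi * arcsin (x_plus a / 2) = a"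
    unfolding eq as by simp
qed

text \<open>On [0, 2] the difference \<open>Omega u - u\<close> decreases strictly to 0, and
  \<open>Omega\<close> is even. Strictness makes \<open>rho\<close> positive up to the end points,
  which forces long arms.\<close>

lemma Omega_ge_abs: "\<bar>u\<bar> \<le> Omega u" 
  and Omega_gt_abs: "\<bar>u\<bar> < 2 \<Longrightarrow> \<bar>u\<bar> < Omega u"
proof -
  have pos: "u < Omega u" if "0 \<le> u" "u < 2" for u
  proof -
    have "Omega 2 - 2 < Omega u - u"
    proof (rule DERIV_neg_imp_decreasing_open[where f = "\<lambda>u. Omega u - u"])
      fix v assume v: "u < v" "v < 2"
      show "\<exists>y. ((\<lambda>u. Omega u - u) has_real_derivative y) (at v) \<and> y < 0"
        using v that arcsin_half_bounds[of v]
        by (intro exI[of _ "2 / pi * arcsin (v / 2) - 1"]) (auto intro!: derivative_eq_intros DERIV_Omega)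
    qed (use that in \<open>auto intro!: continuous_intros continuous_on_Omega\<close>)
    then show ?thesis by (simp add: Omega_outside)
  qed
  show gt: "\<bar>u\<bar> < 2 \<Longrightarrow> \<bar>u\<bar> < Omega u" for u
    using pos[of u] pos[of "- u"] Omega_minus[of u] by (cases "0 \<le> u") auto
  show "\<bar>u\<bar> \<le> Omega u" using gt[of u] Omega_outside[of u] by (cases "\<bar>u\<bar> < 2") auto
qed

text \<open>The maximum of the limit shape on its support is attained at the end points; this keeps
  a + b below about \<open>2 * sqrt n\<close> on the whole diagram.\<close>

lemma Omega_le_2: "\<bar>u\<bar> \<le> 2 \<Longrightarrow> Omega u \<le> 2"
proof -
  have pos: "Omega u \<le> 2" if "0 \<le> u" "u \<le> 2" for u
  proof -
    have "Omega u \<le> Omega 2"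
    proof (rule DERIV_nonneg_imp_increasing_open[where f = Omega])
      fix v assume v: "u < v" "v < 2"
      have "0 \<le> arcsin (v / 2)" using v that arcsin_le_arcsin[of 0 "v / 2"] by simp
      then show "\<exists>y. (Omega has_real_derivative y) (at v) \<and> 0 \<le> y"
        using v that by (intro exI[of _ "2 / pi * arcsin (v / 2)"] conjI DERIV_Omega) auto
    qed (use that in \<open>auto intro!: continuous_on_Omega\<close>)
    then show ?thesis by (simp add: Omega_outside)
  qed
  show "\<bar>u\<bar> \<le> 2 \<Longrightarrow> Omega u \<le> 2"
    using pos[of u] pos[of "- u"] Omega_minus[of u] by (cases "0 \<le> u") auto
qed

text \<open>The derivative 2/pi arcsin (u/2) - a changes sign at \<open>x_plus a\<close>. Outside
  [-2, 2] the function is at least (1 - a) |u|, hence at least its value at 2.\<close>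

lemma F_alpha_min:
  assumes a: "0 \<le> a" "a < 1"
  shows "F_alpha a (x_plus a) \<le> F_alpha a u"
proof -
  note x = x_plus_eq[OF a]
  have der: "(F_alpha a has_real_derivative 2 / pi * arcsin (v / 2) - a) (at v)" if "\<bar>v\<bar> < 2" for v
    unfolding F_alpha_def[abs_def] using that
    by (auto intro!: derivative_eq_intros DERIV_Omega)
  have cont: "continuous_on A (F_alpha a)" for A
    unfolding F_alpha_def[abs_def] by (intro continuous_intros continuous_on_Omega)
  have inner: "F_alpha a (x_plus a) \<le> F_alpha a u" if u: "\<bar>u\<bar> \<le> 2" for u
  proof (cases "u \<le> x_plus a")
    case True
    show ?thesis
    proof (rule DERIV_nonpos_imp_decreasing_open[OF True _ cont])
      fix v assume v: "u < v" "v < x_plus a"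
      then have "arcsin (v / 2) \<le> arcsin (x_plus a / 2)" using u x by (intro arcsin_le_arcsin) auto
      then have "2 / pi * arcsin (v / 2) \<le> 2 / pi * arcsin (x_plus a / 2)" by (intro mult_left_mono) auto
      then show "\<exists>y. (F_alpha a has_real_derivative y) (at v) \<and> y \<le> 0"
        using v u x by (intro exI[of _ "2 / pi * arcsin (v / 2) - a"] conjI der) auto
    qed
  next
    case False
    show ?thesis
    proof (rule DERIV_nonneg_imp_increasing_open[of "x_plus a" u, OF _ _ cont])
      show "x_plus a \<le> u" using False by simp
      fix v assume v: "x_plus a < v" "v < u"
      then have "arcsin (x_plus a / 2) \<le> arcsin (v / 2)" using u x by (intro arcsin_le_arcsin) auto
      then have "2 / pi * arcsin (x_plus a / 2) \<le> 2 / pi * arcsin (v / 2)" by (intro mult_left_mono) auto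
      then show "\<exists>y. (F_alpha a has_real_derivative y) (at v) \<and> 0 \<le> y"
        using v u x by (intro exI[of _ "2 / pi * arcsin (v / 2) - a"] conjI der) auto
    qed
  qed
  show ?thesis
  proof (cases "\<bar>u\<bar> \<le> 2")
    case False
    have "a * u \<le> a * \<bar>u\<bar>" using a by (intro mult_left_mono) auto
    moreover have "2 * (1 - a) \<le> \<bar>u\<bar> * (1 - a)" using False a by (intro mult_right_mono) auto
    ultimately have "F_alpha a 2 \<le> F_alpha a u"
      using False by (simp add: F_alpha_def Omega_outside algebra_simps)
    then show ?thesis using inner[of 2] by simp
  qed (rule inner)
qed

text \<open>A diagonal of content c with d nodes reaches height |c| + 2 d in Russian coordinates, so
  half the excess of the limit shape over |u| is the scaled diagonal length.\<close>

definition rho :: "real \<Rightarrow> real" where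
  "rho u = (Omega u - \<bar>u\<bar>) / 2"

lemma rho_nonneg: "0 \<le> rho u"
  using Omega_ge_abs by (simp add: rho_def)

lemma continuous_on_rho: "continuous_on A rho"
  unfolding rho_def[abs_def] by (intro continuous_intros continuous_on_Omega) auto

text \<open>The absolute value puts a kink of \<open>rho\<close> at 0, so smooth primitives are
  sought on half the support; symmetry gives the rest.\<close>

definition half_moment :: "nat \<Rightarrow> real" where
  "half_moment k = integral {0..2} (\<lambda>u. u ^ k * rho u)"

lemma half_moment_has_integral: "((\<lambda>u. u ^ k * rho u) has_integral half_moment k) {0..2}"
  unfolding half_moment_def
  by (intro integrable_integral integrable_continuous_real continuous_intros continuous_on_rho)

text \<open>On (0, 2) \<open>rho u\<close> is (u arcsin (u/2) + sqrt (4 - u^2)) / pi - u/2. The same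
  q stands before arcsin and in the last term to match this shape, and as arcsin 1 = pi/2 such a
  primitive vanishes at 2.\<close>

lemma DERIV_bulk:
  assumes u: "\<bar>u\<bar> < 2" and q: "(q has_real_derivative q') (at u)" and r: "(r has_real_derivative r') (at u)"
  shows "((\<lambda>u. (q u * arcsin (u / 2) + r u * sqrt (4 - u\<^sup>2)) / pi - q u / 2) has_real_derivative
    (q' * arcsin (u / 2) + (q u * (1 / sqrt (4 - u\<^sup>2)) + (r' * sqrt (4 - u\<^sup>2) + r u * (- u / sqrt (4 - u\<^sup>2))))) / pi - q' / 2) (at u)"
  by (rule DERIV_cong[OF DERIV_diff[OF DERIV_cdivide[OF DERIV_add[OF DERIV_mult[OF q DERIV_arcsin_half[OF u]]
      DERIV_mult[OF r DERIV_sqrt_4[OF u]]]] DERIV_cdivide[OF q]]]) simp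

lemma half_moment_0: "half_moment 0 = 1 / 2"
proof -
  \<comment> \<open>The constant 1 is chosen so that u^2/2 + 1 - 3/4 u^2 is a multiple of 4 - u^2,
    which removes the 1/s terms. It also produces the value: \<open>H 2\<close> is 0 and
    \<open>H 0\<close> is -1/2.\<close>
  define H where "H u = ((u\<^sup>2 / 2 + 1) * arcsin (u / 2) + 3 / 4 * u * sqrt (4 - u\<^sup>2)) / pi - (u\<^sup>2 / 2 + 1) / 2" for u
  have "((\<lambda>u. u ^ 0 * rho u) has_integral H 2 - H 0) {0..2}"
  proof (rule fundamental_theorem_of_calculus_interior)
    show "continuous_on {0..2} H" unfolding H_def[abs_def] by (intro continuous_intros) auto
    fix u :: real assume u: "u \<in> {0<..<2}"
    then have u2: "\<bar>u\<bar> < 2" by auto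
    define s where "s = sqrt (4 - u\<^sup>2)"
    have s: "s > 0" "s * s = 4 - u * u" using sqrt_4_half(2)[OF u2] by (auto simp: s_def power2_eq_square)
    have "(H has_real_derivative ((u * arcsin (u / 2) + ((u\<^sup>2 / 2 + 1) * (1 / s)
        + (3 / 4 * s + 3 / 4 * u * (- u / s)))) / pi - u / 2)) (at u)"
      unfolding H_def[abs_def] s_def
      by (rule DERIV_bulk[OF u2]) (auto intro!: derivative_eq_intros)
    moreover have "(u\<^sup>2 / 2 + 1) * (1 / s) + (3 / 4 * s + 3 / 4 * u * (- u / s)) = s"
    proof -
      have "s * (s * s) + s * (u * u) = 4 * s" unfolding distrib_left[symmetric] using s(2) by simp
      then show ?thesis using s(1) by (simp add: field_simps power2_eq_square)
    qed
    then have "(u * arcsin (u / 2) + ((u\<^sup>2 / 2 + 1) * (1 / s)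
        + (3 / 4 * s + 3 / 4 * u * (- u / s)))) / pi - u / 2 = rho u"
      using u by (simp add: rho_def Omega_eq s_def field_simps)
    ultimately show "(H has_vector_derivative u ^ 0 * rho u) (at u)"
      by (simp add: has_real_derivative_iff_has_vector_derivative)
  qed simp
  then have "half_moment 0 = H 2 - H 0"
    using half_moment_has_integral has_integral_unique by blast
  also have "H 2 - H 0 = 1 / 2" by (simp add: H_def field_simps)
  finally show ?thesis .
qed

text \<open>The primitive \<open>H\<close> comes from the ansatz of a polynomial times \<open>arcsin\<close> plus a polynomial
  times \<open>sqrt\<close> by comparing coefficients; it vanishes at both end points.\<close>
lemma half_moment_rec:
  "(real k + 4)\<^sup>2 * half_moment (k + 2) = 4 * (real k + 1) * (real k + 2) * half_moment k"
proof -
  define q where "q u = (real k + 4) * u ^ (k + 4) - 4 * (real k + 1) * u ^ (k + 2)" for u :: real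
  define r where "r u = (real k + 5) * u ^ (k + 3) - 4 * (real k + 2) * u ^ (k + 1)" for u :: real
  define H where "H u = (q u * arcsin (u / 2) + r u * sqrt (4 - u\<^sup>2)) / pi - q u / 2" for u
  let ?f = "\<lambda>u. (real k + 4)\<^sup>2 * (u ^ (k + 2) * rho u) - 4 * (real k + 1) * (real k + 2) * (u ^ k * rho u)"
  have I: "(?f has_integral H 2 - H 0) {0..2}"
  proof (rule fundamental_theorem_of_calculus_interior)
    show "continuous_on {0..2} H" unfolding H_def[abs_def] q_def r_def by (intro continuous_intros) auto
    fix u :: real assume u: "u \<in> {0<..<2}"
    then have u2: "\<bar>u\<bar> < 2" by auto
    define s where "s = sqrt (4 - u\<^sup>2)"
    have s: "s > 0" "s * s = 4 - u * u" using sqrt_4_half(2)[OF u2] by (auto simp: s_def power2_eq_square)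
    define q' where "q' = ((real k + 4)\<^sup>2 * u\<^sup>2 - 4 * (real k + 1) * (real k + 2)) * (u * u ^ k)"
    define r' where "r' = ((real k + 5) * (real k + 3) * u\<^sup>2 - 4 * (real k + 2) * (real k + 1)) * u ^ k"
    have pw: "((\<lambda>u. u ^ Suc m) has_real_derivative real (Suc m) * u ^ m) (at u)" for m
      using DERIV_pow[of "Suc m" u] by simp
    have e: "k + 4 = Suc (k + 3)" "k + 3 = Suc (k + 2)" "k + 2 = Suc (k + 1)" "k + 1 = Suc k" by auto
    have q: "(q has_real_derivative q') (at u)"
    proof -
      have "((\<lambda>u. (real k + 4) * u ^ Suc (k + 3) - 4 * (real k + 1) * u ^ Suc (k + 1)) has_real_derivative
        (real k + 4) * (real (Suc (k + 3)) * u ^ (k + 3)) - 4 * (real k + 1) * (real (Suc (k + 1)) * u ^ (k + 1))) (at u)"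
        by (intro DERIV_diff DERIV_cmult pw)
      then show ?thesis
        unfolding q_def[abs_def] q'_def by (simp add: algebra_simps power2_eq_square eval_nat_numeral)
    qed
    have r: "(r has_real_derivative r') (at u)"
    proof -
      have "((\<lambda>u. (real k + 5) * u ^ Suc (k + 2) - 4 * (real k + 2) * u ^ Suc k) has_real_derivative
        (real k + 5) * (real (Suc (k + 2)) * u ^ (k + 2)) - 4 * (real k + 2) * (real (Suc k) * u ^ k)) (at u)"
        by (intro DERIV_diff DERIV_cmult pw)
      then show ?thesis
        unfolding r_def[abs_def] r'_def by (simp add: algebra_simps power2_eq_square eval_nat_numeral)
    qed
    have "(H has_real_derivative ((q' * arcsin (u / 2) + (q u * (1 / s) + (r' * s + r u * (- u / s)))) / pi - q' / 2)) (at u)"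
      unfolding H_def[abs_def] s_def by (rule DERIV_bulk[OF u2 q r])
    moreover have "q u * (1 / s) + (r' * s + r u * (- u / s)) = ((real k + 4)\<^sup>2 * u\<^sup>2 - 4 * (real k + 1) * (real k + 2)) * u ^ k * s"
    proof -
      \<comment> \<open>The polynomials were matched so that this difference carries the factor 4 -
        u^2; the singular 1/s terms then combine to a multiple of s.\<close>
      have "q u - u * r u = u\<^sup>2 * u ^ k * (4 - u * u)"
        by (simp add: q_def r_def algebra_simps power2_eq_square eval_nat_numeral)
      then have "q u * (1 / s) + r u * (- u / s) = u\<^sup>2 * u ^ k * (s * s) / s"
        unfolding s(2) by (simp add: diff_divide_distrib[symmetric] mult.commute)
      also have "\<dots> = u\<^sup>2 * u ^ k * s" using s(1) by simp
      finally show ?thesis unfolding r'_def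
        by (simp add: algebra_simps power2_eq_square)
    qed
    then have "(q' * arcsin (u / 2) + (q u * (1 / s) + (r' * s + r u * (- u / s)))) / pi - q' / 2 =
      ((real k + 4)\<^sup>2 * u\<^sup>2 - 4 * (real k + 1) * (real k + 2)) * u ^ k * rho u"
      using u by (simp add: rho_def Omega_eq s_def q'_def) (simp add: field_simps)
    moreover have "((real k + 4)\<^sup>2 * u\<^sup>2 - 4 * (real k + 1) * (real k + 2)) * u ^ k * rho u = ?f u"
      by (simp add: algebra_simps power_add power2_eq_square)
    ultimately show "(H has_vector_derivative ?f u) (at u)"
      by (simp only: has_real_derivative_iff_has_vector_derivative)
  qed simp
  have z: "(0::real) ^ (k + 4) = 0" "(0::real) ^ (k + 3) = 0" "(0::real) ^ (k + 2) = 0" "(0::real) ^ (k + 1) = 0"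
    by simp_all
  have H: "H 2 = 0" by (simp add: H_def)
  have H': "H 0 = 0" by (simp add: H_def q_def r_def z del: power_Suc)
  have J: "(?f has_integral ((real k + 4)\<^sup>2 * half_moment (k + 2) - 4 * (real k + 1) * (real k + 2) * half_moment k)) {0..2}"
    by (intro has_integral_diff has_integral_mult_right half_moment_has_integral)
  show ?thesis using has_integral_unique[OF I J] H H' by simp
qed

lemma half_moment_even: "2 * half_moment (2 * j) = cat j / (real j + 1)"
proof (induction j)
  case 0
  show ?case by (simp add: half_moment_0 cat_0)
next
  case (Suc j)
  have "(2 * real j + 4)\<^sup>2 * (2 * half_moment (2 * Suc j)) = 4 * (2 * real j + 1) * (2 * real j + 2) * (2 * half_moment (2 * j))"
    using half_moment_rec[of "2 * j"] by simp
  also have "\<dots> = 4 * (2 * real j + 1) * 2 * ((real j + 1) * (2 * half_moment (2 * j)))"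
    by (simp add: algebra_simps)
  also have "\<dots> = 4 * (2 * real j + 1) * 2 * ((real j + 1) * (cat j / (real j + 1)))"
    unfolding Suc ..
  also have "\<dots> = 4 * ((4 * real j + 2) * cat j)"
  proof -
    have e: "(real j + 1) * (cat j / (real j + 1)) = cat j" by (simp add: add_eq_0_iff)
    show ?thesis unfolding e by (simp add: algebra_simps)
  qed
  also have "\<dots> = 4 * (real j + 2) * cat (Suc j)" unfolding cat_Suc[symmetric] by simp
  also have "(2 * real j + 4)\<^sup>2 = 4 * (real j + 2) * (real j + 2)" by (simp add: power2_eq_square algebra_simps)
  finally have "(real j + 2) * (2 * half_moment (2 * Suc j)) = cat (Suc j)" by (simp add: add_eq_0_iff)
  then show ?case by (simp add: field_simps)
qed

text \<open>The value is \<open>glim (Con k)\<close>: \<open>rho\<close> has the limiting moments of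
  the contents. The reflected half contributes the sign (-1)^k, which cancels odd moments and
  doubles even ones.\<close>

theorem rho_moment: "((\<lambda>u. u ^ k * rho u) has_integral semicircle_moment k / (real k / 2 + 1)) {-2..2}"
proof -
  have "((\<lambda>u. (- u) ^ k * rho (- u)) has_integral half_moment k) {-2..-0}"
    using half_moment_has_integral[of k] has_integral_reflect_real[of "\<lambda>u. u ^ k * rho u" "half_moment k" 2 0] by simp
  then have "((\<lambda>u. (- 1) ^ k * ((- u) ^ k * rho (- u))) has_integral (- 1) ^ k * half_moment k) {-2..0}"
    by (intro has_integral_mult_right) simp
  moreover have "(- 1) ^ k * ((- u) ^ k * rho (- u)) = u ^ k * rho u" for u :: real
    by (simp add: rho_def Omega_minus power_mult_distrib[symmetric] mult.assoc[symmetric])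
  ultimately have "((\<lambda>u. u ^ k * rho u) has_integral (- 1) ^ k * half_moment k) {-2..0}" by simp
  from has_integral_combine[OF _ _ this half_moment_has_integral]
  have "((\<lambda>u. u ^ k * rho u) has_integral (- 1) ^ k * half_moment k + half_moment k) {-2..2}" by simp
  moreover have "(- 1) ^ k * half_moment k + half_moment k = semicircle_moment k / (real k / 2 + 1)"
  proof (cases "even k")
    case True
    then obtain j where "k = 2 * j" by (auto elim: evenE)
    then show ?thesis using half_moment_even[of j] by (simp add: semicircle_moment_def)
  qed (simp add: semicircle_moment_def)
  ultimately show ?thesis by simp
qed

section \<open>Convergence of the empirical content distribution\<close>

text \<open>Formulated through the failure probability, so that conjunctions reduce to a union bound
  by additivity of \<open>expect\<close>.\<close>

definition whp :: "(nat \<Rightarrow> (nat \<times> nat) set \<Rightarrow> bool) \<Rightarrow> bool" where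
  "whp Q \<longleftrightarrow> (\<lambda>n. expect n (\<lambda>S. of_bool (\<not> Q n S))) \<longlonglongrightarrow> 0"

lemma whp_mono:
  assumes "whp Q" "eventually (\<lambda>n. \<forall>S. diagram S \<longrightarrow> card S = n \<longrightarrow> Q n S \<longrightarrow> R n S) sequentially"
  shows "whp R"
  unfolding whp_def
proof (rule tendsto_sandwich[OF _ _ tendsto_const assms(1)[unfolded whp_def]])
  show "eventually (\<lambda>n. 0 \<le> expect n (\<lambda>S. of_bool (\<not> R n S))) sequentially"
    by (intro always_eventually allI expect_nonneg) auto
  show "eventually (\<lambda>n. expect n (\<lambda>S. of_bool (\<not> R n S)) \<le> expect n (\<lambda>S. of_bool (\<not> Q n S))) sequentially"
    using assms(2) by eventually_elim (intro expect_mono, auto)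
qed

lemma whp_conj:
  assumes "whp Q" "whp R"
  shows "whp (\<lambda>n S. Q n S \<and> R n S)"
  unfolding whp_def
proof (rule tendsto_sandwich[OF _ _ tendsto_const])
  show "(\<lambda>n. expect n (\<lambda>S. of_bool (\<not> Q n S)) + expect n (\<lambda>S. of_bool (\<not> R n S))) \<longlonglongrightarrow> 0"
    using tendsto_add[OF assms[unfolded whp_def]] by simp
  show "eventually (\<lambda>n. 0 \<le> expect n (\<lambda>S. of_bool (\<not> (Q n S \<and> R n S)))) sequentially"
    by (intro always_eventually allI expect_nonneg) auto
  show "eventually (\<lambda>n. expect n (\<lambda>S. of_bool (\<not> (Q n S \<and> R n S)))
     \<le> expect n (\<lambda>S. of_bool (\<not> Q n S)) + expect n (\<lambda>S. of_bool (\<not> R n S))) sequentially"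
    unfolding expect_add[symmetric] by (intro always_eventually allI expect_mono) auto
qed

lemma whp_True: "whp (\<lambda>n S. True)"
  by (simp add: whp_def expect_const)

lemma whp_ball_finite:
  assumes "finite I" "\<And>i. i \<in> I \<Longrightarrow> whp (Q i)"
  shows "whp (\<lambda>n S. \<forall>i\<in>I. Q i n S)"
  using assms by (induction rule: finite_induct) (simp_all add: whp_True whp_conj)

lemma markov:
  assumes "\<And>S. diagram S \<Longrightarrow> card S = n \<Longrightarrow> 0 \<le> f S" "0 < \<epsilon>"
  shows "expect n (\<lambda>S. of_bool (\<not> f S \<le> \<epsilon>)) \<le> expect n f / \<epsilon>"
proof -
  have "expect n (\<lambda>S. of_bool (\<not> f S \<le> \<epsilon>)) \<le> expect n (\<lambda>S. (1 / \<epsilon>) * f S)"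
    using assms by (intro expect_mono) (auto simp: field_simps)
  then show ?thesis unfolding expect_cmult by simp
qed

lemma whp_markov:
  assumes "\<And>n S. diagram S \<Longrightarrow> card S = n \<Longrightarrow> 0 \<le> f n S" "(\<lambda>n. expect n (f n)) \<longlonglongrightarrow> 0" "0 < \<epsilon>"
  shows "whp (\<lambda>n S. f n S \<le> \<epsilon>)"
  unfolding whp_def
proof (rule tendsto_sandwich[OF _ _ tendsto_const])
  show "(\<lambda>n. expect n (f n) / \<epsilon>) \<longlonglongrightarrow> 0"
    using tendsto_divide[OF assms(2) tendsto_const, of \<epsilon>] assms(3) by simp
  show "eventually (\<lambda>n. 0 \<le> expect n (\<lambda>S. of_bool (\<not> f n S \<le> \<epsilon>))) sequentially"
    by (intro always_eventually allI expect_nonneg) auto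
  show "eventually (\<lambda>n. expect n (\<lambda>S. of_bool (\<not> f n S \<le> \<epsilon>)) \<le> expect n (f n) / \<epsilon>) sequentially"
    using assms by (intro always_eventually allI markov) auto
qed

definition empirical :: "nat \<Rightarrow> (nat \<times> nat) set \<Rightarrow> (real \<Rightarrow> real) \<Rightarrow> real" where
  "empirical n S f = (\<Sum>p\<in>S. f (ct p / sqrt (real n))) / real n"

definition rho_integral :: "(real \<Rightarrow> real) \<Rightarrow> real" where
  "rho_integral f = integral {-2..2} (\<lambda>u. f u * rho u)"

definition lln :: "(real \<Rightarrow> real) \<Rightarrow> bool" where
  "lln f \<longleftrightarrow> (\<forall>\<epsilon>>0. whp (\<lambda>n S. \<bar>empirical n S f - rho_integral f\<bar> \<le> \<epsilon>))"

lemma rho_integral_power: "rho_integral (\<lambda>u. u ^ k) = semicircle_moment k / (real k / 2 + 1)"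
  unfolding rho_integral_def using rho_moment by (rule integral_unique)

text \<open>A second moment argument: the monomials with one and with two copies of
  \<open>Con k\<close> have scaled limits c and c^2, so the mean square deviation tends to c^2 - 2
  c^2 + c^2.\<close>

lemma lln_power: "lln (\<lambda>u. u ^ k)"
  unfolding lln_def
proof (intro allI impI)
  fix \<epsilon> :: real assume e: "0 < \<epsilon>"
  define c where "c = semicircle_moment k / (real k / 2 + 1)"
  define X where "X n S = content_sum S k / sqrt (real n) ^ (k + 2)" for n S
  have "(\<lambda>n. expect n (\<lambda>S. (X n S - c)\<^sup>2)) \<longlonglongrightarrow> c * c - 2 * c * c + c\<^sup>2"
  proof -
    have 1: "(\<lambda>n. expect n (mono_val [Con k]) / sqrt (real n) ^ (k + 2)) \<longlonglongrightarrow> c"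
      using mono_expect_asymptotics[of "[Con k]"] by (simp add: c_def)
    have "mono_weight [Con k, Con k] = (k + 2) + (k + 2)" by simp
    then have 2: "(\<lambda>n. expect n (mono_val [Con k, Con k]) / (sqrt (real n) ^ (k + 2) * sqrt (real n) ^ (k + 2))) \<longlonglongrightarrow> c * c"
      using mono_expect_asymptotics[of "[Con k, Con k]"] unfolding power_add[symmetric] by (simp add: c_def)
    have "expect n (\<lambda>S. (X n S - c)\<^sup>2) = expect n (mono_val [Con k, Con k]) / (sqrt (real n) ^ (k + 2) * sqrt (real n) ^ (k + 2))
       - 2 * c * (expect n (mono_val [Con k]) / sqrt (real n) ^ (k + 2)) + c\<^sup>2" for n
    proof -
      define s where "s = sqrt (real n) ^ (k + 2)"
      have X: "X n S = content_sum S k / s" for S by (simp only: X_def s_def)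
      have "expect n (\<lambda>S. (X n S - c)\<^sup>2) = expect n (\<lambda>S. (1 / (s * s)) * mono_val [Con k, Con k] S
         - (2 * c / s) * mono_val [Con k] S + c\<^sup>2)"
        by (intro expect_cong) (simp add: X power2_eq_square algebra_simps)
      then show ?thesis unfolding expect_add expect_diff expect_cmult expect_const s_def[symmetric] by (simp del: mono_simps)
    qed
    then show ?thesis by (simp only:) (intro tendsto_intros 1 2)
  qed
  then have "(\<lambda>n. expect n (\<lambda>S. (X n S - c)\<^sup>2)) \<longlonglongrightarrow> 0" by (simp add: power2_eq_square)
  then have "whp (\<lambda>n S. (X n S - c)\<^sup>2 \<le> \<epsilon>\<^sup>2)"
    using e by (intro whp_markov) auto
  moreover have "empirical n S (\<lambda>u. u ^ k) = X n S" for n S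
  proof -
    have e: "sqrt (real n) ^ (k + 2) = sqrt (real n) ^ k * real n" by (simp add: power_add)
    show ?thesis unfolding X_def e
      by (simp add: empirical_def content_sum_def power_divide sum_divide_distrib)
  qed
  ultimately show "whp (\<lambda>n S. \<bar>empirical n S (\<lambda>u. u ^ k) - rho_integral (\<lambda>u. u ^ k)\<bar> \<le> \<epsilon>)"
    unfolding rho_integral_power c_def[symmetric] using e
    by (simp add: abs_le_square_iff[symmetric])
qed

lemma rho_integrable: "continuous_on {-2..2} f \<Longrightarrow> (\<lambda>u. f u * rho u) integrable_on {-2..2}"
  by (intro integrable_continuous_real continuous_intros continuous_on_rho)

lemma lln_polynomial: "lln (\<lambda>u. \<Sum>i\<le>N. a i * u ^ i)"
  unfolding lln_def
proof (intro allI impI)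
  fix \<epsilon> :: real assume e: "0 < \<epsilon>"
  \<comment> \<open>The summand 1 avoids a division by zero for the zero polynomial.\<close>
  define \<delta> where "\<delta> = \<epsilon> / ((\<Sum>i\<le>N. \<bar>a i\<bar>) + 1)"
  have s: "0 \<le> (\<Sum>i\<le>N. \<bar>a i\<bar>)" by (intro sum_nonneg) auto
  then have d: "0 < \<delta>" unfolding \<delta>_def using e by (intro divide_pos_pos add_nonneg_pos) auto
  have "whp (\<lambda>n S. \<forall>i\<in>{..N}. \<bar>empirical n S (\<lambda>u. u ^ i) - rho_integral (\<lambda>u. u ^ i)\<bar> \<le> \<delta>)"
    using lln_power d by (intro whp_ball_finite) (auto simp: lln_def)
  then show "whp (\<lambda>n S. \<bar>empirical n S (\<lambda>u. \<Sum>i\<le>N. a i * u ^ i) - rho_integral (\<lambda>u. \<Sum>i\<le>N. a i * u ^ i)\<bar> \<le> \<epsilon>)"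
  proof (rule whp_mono[OF _ always_eventually], intro allI impI)
    fix n S assume h: "\<forall>i\<in>{..N}. \<bar>empirical n S (\<lambda>u. u ^ i) - rho_integral (\<lambda>u. u ^ i)\<bar> \<le> \<delta>"
    have 1: "empirical n S (\<lambda>u. \<Sum>i\<le>N. a i * u ^ i) = (\<Sum>i\<le>N. a i * empirical n S (\<lambda>u. u ^ i))"
      unfolding empirical_def by (subst sum.swap) (simp add: sum_distrib_left sum_divide_distrib)
    have 2: "rho_integral (\<lambda>u. \<Sum>i\<le>N. a i * u ^ i) = (\<Sum>i\<le>N. a i * rho_integral (\<lambda>u. u ^ i))"
    proof -
      have "((\<lambda>u. \<Sum>i\<le>N. a i * (u ^ i * rho u)) has_integral (\<Sum>i\<le>N. a i * rho_integral (\<lambda>u. u ^ i))) {-2..2}"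
        unfolding rho_integral_power by (intro has_integral_sum has_integral_mult_right rho_moment) auto
      then show ?thesis unfolding rho_integral_def
        by (simp add: sum_distrib_right mult.assoc integral_unique)
    qed
    have "\<bar>empirical n S (\<lambda>u. \<Sum>i\<le>N. a i * u ^ i) - rho_integral (\<lambda>u. \<Sum>i\<le>N. a i * u ^ i)\<bar>
       = \<bar>\<Sum>i\<le>N. a i * (empirical n S (\<lambda>u. u ^ i) - rho_integral (\<lambda>u. u ^ i))\<bar>"
      unfolding 1 2 by (simp add: sum_subtractf right_diff_distrib)
    also have "\<dots> \<le> (\<Sum>i\<le>N. \<bar>a i\<bar> * \<delta>)"
      using h by (intro order_trans[OF sum_abs] sum_mono) (auto simp: abs_mult intro!: mult_left_mono)
    also have "\<dots> = (\<Sum>i\<le>N. \<bar>a i\<bar>) * \<delta>" by (simp add: sum_distrib_right)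
    also have "\<dots> \<le> \<epsilon>"
    proof -
      have "A * (\<epsilon> / (A + 1)) \<le> \<epsilon>" if "0 \<le> A" for A :: real
        using that e by (simp add: field_simps)
      then show ?thesis unfolding \<delta>_def using s by blast
    qed
    finally show "\<bar>empirical n S (\<lambda>u. \<Sum>i\<le>N. a i * u ^ i) - rho_integral (\<lambda>u. \<Sum>i\<le>N. a i * u ^ i)\<bar> \<le> \<epsilon>" .
  qed
qed

lemma rho_integral_bounds:
  assumes "continuous_on {-2..2} f" "continuous_on {-2..2} g" "\<And>u. \<bar>u\<bar> \<le> 2 \<Longrightarrow> f u \<le> g u"
  shows "rho_integral f \<le> rho_integral g"
  unfolding rho_integral_def
  using assms rho_nonneg by (intro integral_le rho_integrable mult_right_mono) auto

lemma rho_integral_const: "rho_integral (\<lambda>u. c) = c"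
proof -
  have "((\<lambda>u. c * (u ^ 0 * rho u)) has_integral c * (semicircle_moment 0 / (real 0 / 2 + 1))) {-2..2}"
    by (intro has_integral_mult_right rho_moment)
  then have "((\<lambda>u. c * rho u) has_integral c) {-2..2}" by (simp add: semicircle_moment_def cat_0)
  then show ?thesis unfolding rho_integral_def by (rule integral_unique)
qed

lemma rho_integral_diff:
  assumes "continuous_on {-2..2} f" "continuous_on {-2..2} g"
  shows "rho_integral (\<lambda>u. f u - g u) = rho_integral f - rho_integral g"
  unfolding rho_integral_def left_diff_distrib
  using assms by (intro integral_diff rho_integrable)

text \<open>Beyond \<open>[-3, 3]\<close> the test function and its polynomial approximation are dominated by a
  small multiple of a high power, which the moments control.\<close>
theorem lln_continuous:
  assumes cont: "continuous_on UNIV \<phi>" and bdd: "\<And>u. \<bar>\<phi> u\<bar> \<le> C"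
  shows "lln \<phi>"
  unfolding lln_def
proof (intro allI impI)
  fix \<epsilon> :: real assume e: "0 < \<epsilon>"
  \<comment> \<open>Four shares: two for replacing \<open>\<phi>\<close> by g under the empirical
    measure, one for the law of large numbers for g, one for replacing g by \<open>\<phi>\<close>
    under the limit.\<close>
  define \<eta> where "\<eta> = \<epsilon> / 4"
  have eta: "0 < \<eta>" using e by (simp add: \<eta>_def)
  obtain g where g: "real_polynomial_function g" "\<And>u. u \<in> {-3..3} \<Longrightarrow> \<bar>\<phi> u - g u\<bar> < \<eta>"
    using Stone_Weierstrass_real_polynomial_function[of "{-3..3::real}" \<phi> \<eta>] cont eta continuous_on_subset
    by (metis UNIV_I compact_Icc subsetI)
  obtain a N where gN: "g = (\<lambda>u. \<Sum>i\<le>N. a i * u ^ i)"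
    using g(1) unfolding real_polynomial_function_iff_sum by blast
  define B where "B = C + (\<Sum>i\<le>N. \<bar>a i\<bar>)"
  have C0: "0 \<le> C" using bdd[of 0] by simp
  have B0: "0 \<le> B" unfolding B_def using C0 by (intro add_nonneg_nonneg sum_nonneg) auto
  have tail: "\<bar>\<phi> u - g u\<bar> \<le> B * u ^ (2 * N)" if u: "3 \<le> \<bar>u\<bar>" for u
  proof -
    have p: "1 \<le> \<bar>u\<bar> ^ (2 * N)" using u by (intro one_le_power) simp
    have "\<bar>g u\<bar> \<le> (\<Sum>i\<le>N. \<bar>a i\<bar> * \<bar>u\<bar> ^ (2 * N))"
      unfolding gN using u
      by (intro order_trans[OF sum_abs] sum_mono) (auto simp: abs_mult power_abs intro!: mult_left_mono power_increasing)
    moreover have "\<bar>\<phi> u\<bar> \<le> C * \<bar>u\<bar> ^ (2 * N)"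
      using bdd[of u] mult_left_mono[OF p C0] by simp
    ultimately have "\<bar>\<phi> u - g u\<bar> \<le> B * \<bar>u\<bar> ^ (2 * N)"
      by (simp add: B_def distrib_right sum_distrib_right)
    then show ?thesis by (simp add: power_even_abs)
  qed
  \<comment> \<open>For |u| at least 3, u^(2N) is at most 9^N / 9^m u^(2m), while the limiting
    moment of order 2m is at most 4^m because the support is [-2, 2]. The ratio 4/9 makes the tail
    small; the factor 2 absorbs the error 1 allowed in that empirical moment.\<close>
  have "(\<lambda>m. 2 * B * 9 ^ N * (4 / 9) ^ m) \<longlonglongrightarrow> 2 * B * 9 ^ N * 0"
    by (intro tendsto_intros LIMSEQ_realpow_zero) auto
  then have "eventually (\<lambda>m. 2 * B * 9 ^ N * (4 / 9) ^ m < \<eta>) sequentially"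
    using order_tendstoD(2)[of _ "2 * B * 9 ^ N * 0" sequentially \<eta>] eta by simp
  then obtain m where m: "N \<le> m" "2 * B * 9 ^ N * (4 / 9) ^ m < \<eta>"
    using eventually_conj[OF _ eventually_ge_at_top[of N]] by (metis (mono_tags, lifting) eventually_happens' sequentially_bot)
  define D where "D = B * 9 ^ N / 9 ^ m"
  have D0: "0 \<le> D" using B0 by (simp add: D_def)
  have dom: "\<bar>\<phi> u - g u\<bar> \<le> \<eta> + D * u ^ (2 * m)" for u
  proof (cases "\<bar>u\<bar> \<le> 3")
    case True
    then have "\<bar>\<phi> u - g u\<bar> < \<eta>" by (intro g(2)) auto
    moreover have "0 \<le> D * u ^ (2 * m)" using D0 by (simp add: zero_le_even_power)
    ultimately show ?thesis by simp
  next
    case False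
    have "9 ^ (m - N) \<le> (u\<^sup>2) ^ (m - N)"
    proof (rule power_mono)
      have "3\<^sup>2 \<le> \<bar>u\<bar>\<^sup>2" using False by (intro power_mono) auto
      then show "9 \<le> u\<^sup>2" by simp
    qed simp
    then have "(u\<^sup>2) ^ N * 9 ^ (m - N) \<le> (u\<^sup>2) ^ N * (u\<^sup>2) ^ (m - N)" by (intro mult_left_mono) auto
    also have "\<dots> = u ^ (2 * m)" using m(1) by (simp add: power_add[symmetric] power_mult)
    finally have "u ^ (2 * N) * 9 ^ (m - N) \<le> u ^ (2 * m)" by (simp add: power_mult)
    moreover have "(9::real) ^ m = 9 ^ N * 9 ^ (m - N)" using m(1) by (simp add: power_add[symmetric])
    ultimately have "u ^ (2 * N) \<le> 9 ^ N / 9 ^ m * u ^ (2 * m)"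
      by (simp add: field_simps)
    then have "B * u ^ (2 * N) \<le> B * (9 ^ N / 9 ^ m * u ^ (2 * m))" using B0 by (rule mult_left_mono)
    then show ?thesis using tail[of u] False eta by (simp add: D_def)
  qed
  have mom: "rho_integral (\<lambda>u. u ^ (2 * m)) \<le> 4 ^ m"
  proof -
    have "rho_integral (\<lambda>u. u ^ (2 * m)) \<le> rho_integral (\<lambda>u. 4 ^ m)"
    proof (rule rho_integral_bounds)
      fix u :: real assume "\<bar>u\<bar> \<le> 2"
      then have "\<bar>u\<bar> ^ (2 * m) \<le> 2 ^ (2 * m)" by (intro power_mono) auto
      then show "u ^ (2 * m) \<le> 4 ^ m" by (simp add: power_even_abs power_mult)
    qed (intro continuous_intros)+
    then show ?thesis by (simp add: rho_integral_const)
  qed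
  have gI: "\<bar>rho_integral g - rho_integral \<phi>\<bar> \<le> \<eta>"
  proof -
    have c: "continuous_on {-2..2} \<phi>" "continuous_on {-2..2} g"
      using cont continuous_on_subset unfolding gN by (blast, intro continuous_intros)
    have b: "g u - \<phi> u \<le> \<eta>" "- \<eta> \<le> g u - \<phi> u" if "\<bar>u\<bar> \<le> 2" for u
      using g(2)[of u] that by (auto simp: abs_less_iff abs_le_iff)
    have "rho_integral (\<lambda>u. g u - \<phi> u) \<le> rho_integral (\<lambda>u. \<eta>)"
      by (rule rho_integral_bounds) (intro continuous_intros c b | assumption)+
    moreover have "rho_integral (\<lambda>u. - \<eta>) \<le> rho_integral (\<lambda>u. g u - \<phi> u)"
      by (rule rho_integral_bounds) (intro continuous_intros c b | assumption)+
    ultimately show ?thesis by (simp add: rho_integral_const rho_integral_diff[OF c(2,1)])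
  qed
  have "whp (\<lambda>n S. \<bar>empirical n S g - rho_integral g\<bar> \<le> \<eta>
      \<and> \<bar>empirical n S (\<lambda>u. u ^ (2 * m)) - rho_integral (\<lambda>u. u ^ (2 * m))\<bar> \<le> 1)"
    using lln_polynomial[of a N] lln_power[of "2 * m"] eta unfolding gN lln_def by (intro whp_conj) auto
  then show "whp (\<lambda>n S. \<bar>empirical n S \<phi> - rho_integral \<phi>\<bar> \<le> \<epsilon>)"
  proof (rule whp_mono[OF _ eventually_mono[OF eventually_gt_at_top[of 0]]], intro allI impI)
    fix n S assume n: "0 < n" and S: "diagram S" "card S = n"
      and h: "\<bar>empirical n S g - rho_integral g\<bar> \<le> \<eta>
      \<and> \<bar>empirical n S (\<lambda>u. u ^ (2 * m)) - rho_integral (\<lambda>u. u ^ (2 * m))\<bar> \<le> 1"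
    have "\<bar>empirical n S \<phi> - empirical n S g\<bar> = \<bar>\<Sum>p\<in>S. \<phi> (ct p / sqrt (real n)) - g (ct p / sqrt (real n))\<bar> / real n"
      by (simp add: empirical_def sum_subtractf diff_divide_distrib[symmetric] abs_divide)
    also have "\<dots> \<le> (\<Sum>p\<in>S. \<eta> + D * (ct p / sqrt (real n)) ^ (2 * m)) / real n"
      by (intro divide_right_mono order_trans[OF sum_abs] sum_mono dom) auto
    also have "\<dots> = \<eta> + D * empirical n S (\<lambda>u. u ^ (2 * m))"
      using n S by (simp add: empirical_def sum.distrib sum_distrib_left add_divide_distrib)
    also have "empirical n S (\<lambda>u. u ^ (2 * m)) \<le> 4 ^ m + 1" using h mom by linarith
    then have "D * empirical n S (\<lambda>u. u ^ (2 * m)) \<le> D * (4 ^ m + 1)" using D0 by (rule mult_left_mono)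
    also have "\<dots> \<le> D * (2 * 4 ^ m)" using D0 by (intro mult_left_mono) auto
    also have "\<dots> < \<eta>" using m(2) by (simp add: D_def power_divide mult_ac)
    finally have "\<bar>empirical n S \<phi> - empirical n S g\<bar> \<le> 2 * \<eta>" by simp
    then show "\<bar>empirical n S \<phi> - rho_integral \<phi>\<bar> \<le> \<epsilon>"
      using h gI unfolding \<eta>_def by linarith
  qed
qed

section \<open>Convergence of the diagonals\<close>

definition diag_count :: "(nat \<times> nat) set \<Rightarrow> int \<Rightarrow> nat" where
  "diag_count S c = card {p \<in> S. node_content p = c}"

lemma card_insert_le_Suc': "card (insert x A) \<le> Suc (card A)"
  by (cases "finite A") (auto simp: card_insert_if)

text \<open>Moving up one row embeds the diagonal c + 1 into the diagonal c, except for a node of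
  the first row, which must sit in column -c; moving left one column does the converse, except for a
  node of the first column in row c + 1.\<close>

lemma diag_count_step:
  assumes S: "diagram S"
  shows "\<bar>int (diag_count S (c + 1)) - int (diag_count S c)\<bar> \<le> 1"
proof -
  let ?D = "\<lambda>c. {p \<in> S. node_content p = c}"
  have fin: "finite (?D c)" for c using diagram_finite[OF S] by simp
  have 1: "diag_count S (c + 1) \<le> Suc (diag_count S c)"
  proof -
    have "?D (c + 1) \<subseteq> insert (1, nat (- c)) ((\<lambda>p. (Suc (fst p), snd p)) ` ?D c)"
    proof
      fix p assume "p \<in> ?D (c + 1)"
      then obtain a b where p: "p = (a, b)" "(a, b) \<in> S" "int a - int b = c + 1" by (cases p) (auto simp: node_content_def)
      show "p \<in> insert (1, nat (- c)) ((\<lambda>p. (Suc (fst p), snd p)) ` ?D c)"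
      proof (cases "a = 1")
        case True
        then show ?thesis using p by auto
      next
        case False
        then have "1 \<le> a - 1" "a - 1 \<le> a" using diagram_pos[OF S p(2)] by auto
        then have "(a - 1, b) \<in> S" using diagram_down[OF S p(2), of "a - 1" b] diagram_pos[OF S p(2)] by auto
        then have "(a - 1, b) \<in> ?D c" using p(3) \<open>1 \<le> a - 1\<close> by (auto simp: node_content_def)
        moreover have "p = (Suc (fst (a - 1, b)), snd (a - 1, b))" using p(1) \<open>1 \<le> a - 1\<close> by auto
        ultimately show ?thesis by blast
      qed
    qed
    then have "diag_count S (c + 1) \<le> card (insert (1, nat (- c)) ((\<lambda>p. (Suc (fst p), snd p)) ` ?D c))"
      unfolding diag_count_def using fin by (intro card_mono) auto
    also have "\<dots> \<le> Suc (card ((\<lambda>p. (Suc (fst p), snd p)) ` ?D c))" by (rule card_insert_le_Suc')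
    also have "\<dots> \<le> Suc (card (?D c))" using card_image_le[OF fin] by simp
    finally show ?thesis by (simp add: diag_count_def)
  qed
  have 2: "diag_count S c \<le> Suc (diag_count S (c + 1))"
  proof -
    have "?D c \<subseteq> insert (nat (c + 1), 1) ((\<lambda>p. (fst p, Suc (snd p))) ` ?D (c + 1))"
    proof
      fix p assume "p \<in> ?D c"
      then obtain a b where p: "p = (a, b)" "(a, b) \<in> S" "int a - int b = c" by (cases p) (auto simp: node_content_def)
      show "p \<in> insert (nat (c + 1), 1) ((\<lambda>p. (fst p, Suc (snd p))) ` ?D (c + 1))"
      proof (cases "b = 1")
        case True
        then show ?thesis using p by auto
      next
        case False
        then have "1 \<le> b - 1" "b - 1 \<le> b" using diagram_pos[OF S p(2)] by auto
        then have "(a, b - 1) \<in> S" using diagram_down[OF S p(2), of a "b - 1"] diagram_pos[OF S p(2)] by auto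
        then have "(a, b - 1) \<in> ?D (c + 1)" using p(3) \<open>1 \<le> b - 1\<close> by (auto simp: node_content_def)
        moreover have "p = (fst (a, b - 1), Suc (snd (a, b - 1)))" using p(1) \<open>1 \<le> b - 1\<close> by auto
        ultimately show ?thesis by blast
      qed
    qed
    then have "diag_count S c \<le> card (insert (nat (c + 1), 1) ((\<lambda>p. (fst p, Suc (snd p))) ` ?D (c + 1)))"
      unfolding diag_count_def using fin by (intro card_mono) auto
    also have "\<dots> \<le> Suc (card ((\<lambda>p. (fst p, Suc (snd p))) ` ?D (c + 1)))" by (rule card_insert_le_Suc')
    also have "\<dots> \<le> Suc (card (?D (c + 1)))" using card_image_le[OF fin] by simp
    finally show ?thesis by (simp add: diag_count_def)
  qed
  show ?thesis using 1 2 by linarith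
qed

lemma diag_count_lipschitz:
  assumes S: "diagram S"
  shows "\<bar>real (diag_count S c) - real (diag_count S c')\<bar> \<le> \<bar>real_of_int c - real_of_int c'\<bar>"
proof -
  have up: "\<bar>int (diag_count S (c + int k)) - int (diag_count S c)\<bar> \<le> int k" for c k
  proof (induction k)
    case (Suc k)
    then show ?case using diag_count_step[OF S, of "c + int k"] by (simp add: algebra_simps)
  qed simp
  have "\<bar>int (diag_count S c) - int (diag_count S c')\<bar> \<le> \<bar>c - c'\<bar>"
    using up[of c' "nat (c - c')"] up[of c "nat (c' - c)"] by (cases "c' \<le> c") auto
  then have "real_of_int \<bar>int (diag_count S c) - int (diag_count S c')\<bar> \<le> real_of_int \<bar>c - c'\<bar>"
    by (simp only: of_int_le_iff)
  then show ?thesis by simp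
qed

lemma downward_closed_initial:
  assumes fin: "finite J" and pos: "\<And>j. j \<in> J \<Longrightarrow> 1 \<le> (j::nat)"
    and down: "\<And>i j. j \<in> J \<Longrightarrow> 1 \<le> i \<Longrightarrow> i \<le> j \<Longrightarrow> i \<in> J"
  shows "J = {1..card J}"
proof (cases "J = {}")
  case False
  have "J = {1..Max J}"
  proof
    show "J \<subseteq> {1..Max J}" using Max_ge[OF fin] pos by auto
    show "{1..Max J} \<subseteq> J" using down[OF Max_in[OF fin False]] by auto
  qed
  then show ?thesis by (metis card_atLeastAtMost diff_Suc_1)
qed simp

text \<open>The nodes of a diagonal form an initial segment of it, and (a, b) is the position number
  \<open>min a b\<close> on its diagonal. Hence the diagonal lengths determine the diagram.\<close>

lemma mem_diagram_iff:
  assumes S: "diagram S" and ab: "1 \<le> a" "1 \<le> b"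
  shows "(a, b) \<in> S \<longleftrightarrow> min a b \<le> diag_count S (int a - int b)"
proof -
  define k where "k = min a b"
  \<comment> \<open>The diagonal starts at (x + 1, y + 1), with x or y equal to zero.\<close>
  define x where "x = a - k"
  define y where "y = b - k"
  have xy: "x = 0 \<or> y = 0" "a = x + k" "b = y + k" "1 \<le> k" using ab by (auto simp: x_def y_def k_def min_def)
  define J where "J = {j. 1 \<le> j \<and> (x + j, y + j) \<in> S}"
  have im: "(\<lambda>j. (x + j, y + j)) ` J = {p \<in> S. node_content p = int a - int b}"
  proof
    show "(\<lambda>j. (x + j, y + j)) ` J \<subseteq> {p \<in> S. node_content p = int a - int b}"
      using xy by (auto simp: J_def node_content_def)
    show "{p \<in> S. node_content p = int a - int b} \<subseteq> (\<lambda>j. (x + j, y + j)) ` J"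
    proof
      fix p assume "p \<in> {p \<in> S. node_content p = int a - int b}"
      then obtain c d where p: "p = (c, d)" "(c, d) \<in> S" "int c - int d = int a - int b"
        by (cases p) (auto simp: node_content_def)
      have cd: "1 \<le> c" "1 \<le> d" using diagram_pos[OF S p(2)] by auto
      have e: "int c - int d = int x - int y" using p(3) xy by auto
      define j where "j = min c d"
      have "c = x + j" "d = y + j" "1 \<le> j" using e xy(1) cd by (auto simp: j_def min_def)
      then show "p \<in> (\<lambda>j. (x + j, y + j)) ` J" using p by (auto simp: J_def)
    qed
  qed
  have inj: "inj_on (\<lambda>j. (x + j, y + j)) J" by (auto simp: inj_on_def)
  have cardJ: "card J = diag_count S (int a - int b)"
    using card_image[OF inj] unfolding im diag_count_def by simp
  have "finite ((\<lambda>j. (x + j, y + j)) ` J)" unfolding im using diagram_finite[OF S] by simp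
  then have finJ: "finite J" using finite_imageD inj by blast
  have "J = {1..card J}"
  proof (rule downward_closed_initial[OF finJ])
    fix i j assume "j \<in> J" "1 \<le> i" "i \<le> j"
    then show "i \<in> J" using diagram_down[OF S, of "x + j" "y + j" "x + i" "y + i"] by (auto simp: J_def)
  qed (simp add: J_def)
  moreover have "(a, b) \<in> S \<longleftrightarrow> k \<in> J" using xy by (simp add: J_def)
  ultimately show ?thesis unfolding k_def[symmetric] cardJ[symmetric] using xy(4)
    by (metis atLeastAtMost_iff)
qed

section \<open>Tent functions and their Riemann sums\<close>

lemma riemann_sum:
  fixes f :: "real \<Rightarrow> real"
  assumes lip: "\<And>x y. \<bar>f x - f y\<bar> \<le> \<bar>x - y\<bar>" and h: "0 \<le> h"
  shows "\<bar>integral {a..a + real m * h} f - (\<Sum>i<m. h * f (a + real i * h))\<bar> \<le> real m * h\<^sup>2"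
proof -
  have cont: "continuous_on A f" for A
  proof (rule continuous_onI)
    fix x e :: real assume "0 < e"
    then show "\<exists>d>0. \<forall>x'\<in>A. dist x' x < d \<longrightarrow> dist (f x') (f x) \<le> e"
    proof (intro exI[of _ e] conjI ballI impI)
      fix x' assume "dist x' x < e"
      then show "dist (f x') (f x) \<le> e" using lip[of x' x] by (simp add: dist_real_def)
    qed
  qed
  have int: "f integrable_on {x..y}" for x y by (rule integrable_continuous_real[OF cont])
  have step: "\<bar>integral {x..x + h} f - h * f x\<bar> \<le> h\<^sup>2" for x
  proof -
    have "norm (integral {x..x + h} (\<lambda>t. f t - f x)) \<le> h * (x + h - x)"
    proof (rule integral_bound)
      fix t assume "t \<in> {x..x + h}"
      then show "norm (f t - f x) \<le> h" using lip[of t x] by auto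
    qed (use h in \<open>auto intro!: continuous_intros cont\<close>)
    moreover have "integral {x..x + h} (\<lambda>t. f t - f x) = integral {x..x + h} f - h * f x"
      using h by (subst integral_diff[OF int]) auto
    ultimately show ?thesis by (simp add: power2_eq_square)
  qed
  show ?thesis
  proof (induction m)
    case (Suc m)
    have "integral {a..a + real m * h} f + integral {a + real m * h..a + real m * h + h} f = integral {a..a + real m * h + h} f"
      using h by (intro Henstock_Kurzweil_Integration.integral_combine int) auto
    moreover have "a + real (Suc m) * h = a + real m * h + h" by (simp add: algebra_simps)
    ultimately show ?case using Suc step[of "a + real m * h"]
      by (simp add: algebra_simps abs_le_iff)
  qed simp
qed

text \<open>Height and half-width agree, so the slope is one and \<open>riemann_sum\<close> applies
  without a constant.\<close>

definition tent :: "real \<Rightarrow> real \<Rightarrow> real \<Rightarrow> real" where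
  "tent u0 \<delta> u = max 0 (\<delta> - \<bar>u - u0\<bar>)"

lemma tent_props:
  "0 \<le> tent u0 \<delta> u" "\<bar>tent u0 \<delta> x - tent u0 \<delta> y\<bar> \<le> \<bar>x - y\<bar>" "0 \<le> \<delta> \<Longrightarrow> tent u0 \<delta> u \<le> \<delta>"
  "\<delta> \<le> \<bar>u - u0\<bar> \<Longrightarrow> tent u0 \<delta> u = 0"
  by (auto simp: tent_def)

lemma continuous_on_tent: "continuous_on A (tent u0 \<delta>)"
  unfolding tent_def[abs_def] by (intro continuous_intros)

text \<open>Rounding up makes the scaled grid cover [-2, 2]. The tents considered vanish outside
  that interval, so the half-open range of contents loses nothing.\<close>

definition grid_bound :: "nat \<Rightarrow> nat" where
  "grid_bound n = nat \<lceil>2 * sqrt (real n)\<rceil>"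

lemma tent_riemann:
  assumes "0 < \<delta>" "\<delta> \<le> 2 - \<bar>u0\<bar>"
  shows "(\<lambda>n. (\<Sum>c\<in>{- int (grid_bound n)..<int (grid_bound n)}. tent u0 \<delta> (real_of_int c / sqrt (real n))) / sqrt (real n))
    \<longlonglongrightarrow> integral {-2..2} (tent u0 \<delta>)"
proof -
  let ?t = "tent u0 \<delta>"
  define R where "R n = (\<Sum>c\<in>{- int (grid_bound n)..<int (grid_bound n)}. ?t (real_of_int c / sqrt (real n))) / sqrt (real n)" for n
  have bound: "\<bar>R n - integral {-2..2} ?t\<bar> \<le> 2 * (2 * sqrt (real n) + 1) / real n" if n: "0 < n" for n
  proof -
    define N where "N = grid_bound n"
    define h where "h = 1 / sqrt (real n)"
    have h: "0 < h" using n by (simp add: h_def)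
    have N: "2 * sqrt (real n) \<le> real N" "real N \<le> 2 * sqrt (real n) + 1"
    proof -
      have "0 \<le> \<lceil>2 * sqrt (real n)\<rceil>" by (simp add: zero_le_ceiling order.strict_trans2[of _ 0])
      then have "real N = real_of_int \<lceil>2 * sqrt (real n)\<rceil>" by (simp add: N_def grid_bound_def)
      then show "2 * sqrt (real n) \<le> real N" "real N \<le> 2 * sqrt (real n) + 1" by linarith+
    qed
    have Nh: "2 \<le> real N * h" using N(1) n by (simp add: h_def field_simps)
    have "(\<Sum>c\<in>{- int N..<int N}. ?t (real_of_int c / sqrt (real n)) / sqrt (real n)) = (\<Sum>i<2 * N. h * ?t (- (real N * h) + real i * h))"
      by (rule sum.reindex_bij_witness[where i = "\<lambda>i. int i - int N" and j = "\<lambda>c. nat (c + int N)"])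
        (auto simp: h_def add_divide_distrib diff_divide_distrib of_nat_nat)
    then have R: "R n = (\<Sum>i<2 * N. h * ?t (- (real N * h) + real i * h))"
      by (simp add: R_def N_def sum_divide_distrib)
    have "integral {-2..2} ?t = integral {- (real N * h)..- (real N * h) + real (2 * N) * h} ?t"
    proof -
      have "(?t has_integral integral {-2..2} ?t) {-2..2}"
        by (intro integrable_integral integrable_continuous_real continuous_on_tent)
      then have "(?t has_integral integral {-2..2} ?t) {- (real N * h)..real N * h}"
        by (rule has_integral_on_superset) (use Nh assms in \<open>auto intro!: tent_props(4)\<close>)
      moreover have "- (real N * h) + real (2 * N) * h = real N * h" by (simp add: algebra_simps)
      ultimately show ?thesis using integral_unique by metis
    qed
    then have "\<bar>R n - integral {-2..2} ?t\<bar> \<le> real (2 * N) * h\<^sup>2"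
      using riemann_sum[of ?t h "- (real N * h)" "2 * N"] tent_props(2) h unfolding R by (simp add: abs_minus_commute)
    also have "\<dots> = 2 * real N / real n" using n by (simp add: h_def power_divide)
    also have "\<dots> \<le> 2 * (2 * sqrt (real n) + 1) / real n" using N(2) by (intro divide_right_mono) auto
    finally show ?thesis .
  qed
  have "(\<lambda>n. R n - integral {-2..2} ?t) \<longlonglongrightarrow> 0"
  proof (rule Lim_null_comparison)
    show "eventually (\<lambda>n. norm (R n - integral {-2..2} ?t) \<le> 2 * (2 * sqrt (real n) + 1) / real n) sequentially"
      using eventually_gt_at_top[of 0] by eventually_elim (use bound in simp)
    show "(\<lambda>n. 2 * (2 * sqrt (real n) + 1) / real n) \<longlonglongrightarrow> 0" by real_asymp
  qed
  then show ?thesis unfolding R_def by (simp add: LIM_zero_iff)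
qed

lemma tent_integral_pos:
  assumes "0 < \<delta>" "\<delta> \<le> 2 - \<bar>u0\<bar>"
  shows "0 < integral {-2..2} (tent u0 \<delta>)"
proof -
  have "0 < \<delta> * (\<delta> / 2)" using assms(1) by simp
  also have "\<dots> = integral {u0 - \<delta> / 2..u0 + \<delta> / 2} (\<lambda>u. \<delta> / 2)" using assms(1) by simp
  also have "\<dots> \<le> integral {u0 - \<delta> / 2..u0 + \<delta> / 2} (tent u0 \<delta>)"
  proof (intro integral_le integrable_continuous_real continuous_on_tent continuous_intros)
    fix u assume "u \<in> {u0 - \<delta> / 2..u0 + \<delta> / 2}"
    then have "\<bar>u - u0\<bar> \<le> \<delta> / 2" unfolding atLeastAtMost_iff by linarith
    then show "\<delta> / 2 \<le> tent u0 \<delta> u" unfolding tent_def by linarith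
  qed
  also have "\<dots> \<le> integral {-2..2} (tent u0 \<delta>)"
    using assms by (intro integral_subset_le integrable_continuous_real continuous_on_tent) (auto simp: tent_props)
  finally show ?thesis .
qed

lemma empirical_tent:
  assumes S: "diagram S" and d: "\<delta> \<le> 2 - \<bar>u0\<bar>" and n: "0 < n"
  shows "empirical n S (tent u0 \<delta>) = (\<Sum>c\<in>{- int (grid_bound n)..<int (grid_bound n)}.
      real (diag_count S c) * tent u0 \<delta> (real_of_int c / sqrt (real n))) / real n"
proof -
  let ?t = "\<lambda>c. tent u0 \<delta> (real_of_int c / sqrt (real n))"
  let ?C = "{- int (grid_bound n)..<int (grid_bound n)}"
  have out: "?t c = 0" if "c \<notin> ?C" for c
  proof (rule tent_props(4))
    have N: "2 * sqrt (real n) \<le> real (grid_bound n)" unfolding grid_bound_def by linarith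
    have "real (grid_bound n) \<le> \<bar>real_of_int c\<bar>" using that by auto
    then have "2 * sqrt (real n) \<le> \<bar>real_of_int c\<bar>" using N by linarith
    then have "2 \<le> \<bar>real_of_int c / sqrt (real n)\<bar>" using n by (simp add: field_simps)
    then show "\<delta> \<le> \<bar>real_of_int c / sqrt (real n) - u0\<bar>" using d by linarith
  qed
  have fS: "finite S" using S by (rule diagram_finite)
  have "(\<Sum>p\<in>S. ?t (node_content p)) = (\<Sum>p\<in>{p \<in> S. node_content p \<in> ?C}. ?t (node_content p))"
    using fS out by (intro sum.mono_neutral_right) auto
  also have "\<dots> = (\<Sum>c\<in>?C. \<Sum>p\<in>{p \<in> {p \<in> S. node_content p \<in> ?C}. node_content p = c}. ?t (node_content p))"
    using fS by (intro sum.group[symmetric]) auto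
  also have "\<dots> = (\<Sum>c\<in>?C. real (diag_count S c) * ?t c)"
  proof (intro sum.cong refl)
    fix c assume c: "c \<in> ?C"
    then have "{p \<in> {p \<in> S. node_content p \<in> ?C}. node_content p = c} = {p \<in> S. node_content p = c}" by auto
    then show "(\<Sum>p\<in>{p \<in> {p \<in> S. node_content p \<in> ?C}. node_content p = c}. ?t (node_content p)) = real (diag_count S c) * ?t c"
      by (simp add: diag_count_def)
  qed
  finally show ?thesis by (simp add: empirical_def)
qed

lemma abs_diff_le_add_1:
  fixes a b x y :: real
  shows "\<bar>a - x\<bar> \<le> y \<Longrightarrow> \<bar>x - b\<bar> \<le> 1 \<Longrightarrow> \<bar>a - b\<bar> \<le> y + 1"
  by linarith

text \<open>Integrating against a narrow tent yields a weighted average of the diagonal lengths near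
  u0. The Lipschitz bound makes this average agree with the single diagonal up to the width, and
  continuity of \<open>rho\<close> does the same for the limit.\<close>

theorem diag_count_pointwise:
  assumes u0: "\<bar>u0\<bar> < 2" and e: "0 < \<epsilon>"
  shows "whp (\<lambda>n S. \<bar>real (diag_count S \<lfloor>u0 * sqrt (real n)\<rfloor>) / sqrt (real n) - rho u0\<bar> \<le> \<epsilon>)"
proof -
  have "isCont rho u0" using continuous_on_rho[of UNIV] by (simp add: continuous_on_eq_continuous_at)
  then obtain \<delta>1 where d1: "0 < \<delta>1" "\<And>u. \<bar>u - u0\<bar> < \<delta>1 \<Longrightarrow> \<bar>rho u - rho u0\<bar> < \<epsilon> / 8"
    using e unfolding continuous_at_eps_delta by (metis half_gt_zero dist_real_def zero_less_divide_iff zero_less_numeral)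
  \<comment> \<open>Three demands on the width: small oscillation of \<open>rho\<close>, small
    oscillation of the diagonal lengths, and support inside [-2, 2].\<close>
  define \<delta> where "\<delta> = min \<delta>1 (min (\<epsilon> / 8) (2 - \<bar>u0\<bar>))"
  have d: "0 < \<delta>" "\<delta> \<le> \<delta>1" "\<delta> \<le> \<epsilon> / 8" "\<delta> \<le> 2 - \<bar>u0\<bar>" using d1(1) e u0 unfolding \<delta>_def by linarith+
  define t where "t = tent u0 \<delta>"
  define T where "T = integral {-2..2} t"
  have T: "0 < T" unfolding T_def t_def by (rule tent_integral_pos) (use d in auto)
  define C where "C n = {- int (grid_bound n)..<int (grid_bound n)}" for n
  define R where "R n = (\<Sum>c\<in>C n. t (real_of_int c / sqrt (real n))) / sqrt (real n)" for n
  have R: "R \<longlonglongrightarrow> T" using tent_riemann[OF d(1,4)] by (simp add: R_def[abs_def] C_def t_def T_def)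
  have tc: "continuous_on A t" for A unfolding t_def by (rule continuous_on_tent)
  have t0: "0 \<le> t u" for u by (simp add: t_def tent_props)
  have rhoT: "\<bar>rho_integral t - rho u0 * T\<bar> \<le> \<epsilon> / 8 * T"
  proof -
    have tr: "\<bar>t u * rho u - rho u0 * t u\<bar> \<le> \<epsilon> / 8 * t u" for u
    proof (cases "\<bar>u - u0\<bar> < \<delta>1")
      case True
      then have "\<bar>rho u - rho u0\<bar> \<le> \<epsilon> / 8" using d1(2)[of u] by simp
      then have "\<bar>rho u - rho u0\<bar> * t u \<le> \<epsilon> / 8 * t u" using t0 by (rule mult_right_mono)
      moreover have "t u * rho u - rho u0 * t u = (rho u - rho u0) * t u" by (simp add: algebra_simps)
      ultimately show ?thesis using t0[of u] by (simp only: abs_mult abs_of_nonneg)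
    next
      case False
      then have "t u = 0" using d by (auto simp: t_def intro!: tent_props(4))
      then show ?thesis by simp
    qed
    have tr1: "t u * rho u \<le> (rho u0 + \<epsilon> / 8) * t u" and tr2: "(rho u0 - \<epsilon> / 8) * t u \<le> t u * rho u" for u
      using tr[of u] unfolding distrib_right left_diff_distrib by linarith+
    have i1: "(\<lambda>u. t u * rho u) integrable_on {-2..2}" by (intro rho_integrable tc)
    have i2: "(\<lambda>u. c * t u) integrable_on {-2..2}" for c by (intro integrable_continuous_real continuous_intros tc)
    have c: "integral {-2..2} (\<lambda>u. c * t u) = c * T" for c by (simp add: T_def)
    have "rho_integral t \<le> integral {-2..2} (\<lambda>u. (rho u0 + \<epsilon> / 8) * t u)"
      unfolding rho_integral_def using tr1 tr2 by (intro integral_le i1 i2) blast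
    moreover have "integral {-2..2} (\<lambda>u. (rho u0 - \<epsilon> / 8) * t u) \<le> rho_integral t"
      unfolding rho_integral_def using tr1 tr2 by (intro integral_le i1 i2) blast
    ultimately have "rho_integral t \<le> (rho u0 + \<epsilon> / 8) * T" "(rho u0 - \<epsilon> / 8) * T \<le> rho_integral t"
      unfolding c by auto
    then show ?thesis unfolding distrib_right left_diff_distrib by linarith
  qed
  have l: "lln t"
  proof (rule lln_continuous[OF tc])
    show "\<bar>t u\<bar> \<le> \<delta>" for u using tent_props(1)[of u0 \<delta> u] tent_props(3)[of \<delta> u0 u] d by (simp add: t_def)
  qed
  \<comment> \<open>The first bound keeps the Riemann sum above 3/4 T, so that it can be divided out
    at the end; the second makes the error \<open>rho u0 * \<kappa>\<close> at most \<epsilon>/8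
    T.\<close>
  define \<kappa> where "\<kappa> = min (T / 4) (\<epsilon> * T / (8 * (rho u0 + 1)))"
  have k: "0 < \<kappa>" unfolding \<kappa>_def using T e rho_nonneg[of u0] by (auto intro!: divide_pos_pos add_nonneg_pos)
  have k2: "rho u0 * \<kappa> \<le> \<epsilon> / 8 * T"
  proof -
    have "rho u0 * \<kappa> \<le> (rho u0 + 1) * (\<epsilon> * T / (8 * (rho u0 + 1)))"
      using rho_nonneg[of u0] k by (intro mult_mono) (auto simp: \<kappa>_def)
    also have "\<dots> = \<epsilon> / 8 * T" using rho_nonneg[of u0] by (simp add: field_simps)
    finally show ?thesis .
  qed
  have "eventually (\<lambda>n. \<bar>R n - T\<bar> < \<kappa>) sequentially"
    using tendstoD[OF R k] by (simp add: dist_real_def)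
  moreover have "eventually (\<lambda>n. 1 / sqrt (real n) < \<epsilon> / 8) sequentially"
  proof -
    have "(\<lambda>n. 1 / sqrt (real n)) \<longlonglongrightarrow> 0" by real_asymp
    then show ?thesis by (rule order_tendstoD(2)) (use e in simp)
  qed
  ultimately have ev: "eventually (\<lambda>n. \<bar>R n - T\<bar> < \<kappa> \<and> 1 / sqrt (real n) < \<epsilon> / 8 \<and> 0 < n) sequentially"
    using eventually_gt_at_top[of 0] by eventually_elim auto
  have "whp (\<lambda>n S. \<bar>empirical n S t - rho_integral t\<bar> \<le> \<epsilon> * T / 8)"
  proof -
    have "0 < \<epsilon> * T / 8" using e T by simp
    then show ?thesis using l unfolding lln_def by blast
  qed
  then show ?thesis
  proof (rule whp_mono[OF _ eventually_mono[OF ev]], intro allI impI)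
    fix n S assume n: "\<bar>R n - T\<bar> < \<kappa> \<and> 1 / sqrt (real n) < \<epsilon> / 8 \<and> 0 < n" and S: "diagram S" "card S = n"
      and h: "\<bar>empirical n S t - rho_integral t\<bar> \<le> \<epsilon> * T / 8"
    define s where "s = sqrt (real n)"
    have s: "0 < s" using n by (simp add: s_def)
    define c0 where "c0 = \<lfloor>u0 * s\<rfloor>"
    define D where "D = real (diag_count S c0) / s"
    have "\<bar>R n - T\<bar> < T / 4" using n unfolding \<kappa>_def by linarith
    then have R0: "0 < R n" "T \<le> 4 / 3 * R n" using T by linarith+
    have ss: "s * s = real n" by (simp add: s_def)
    have emp: "empirical n S t - D * R n = (\<Sum>c\<in>C n. (real (diag_count S c) - real (diag_count S c0)) * t (real_of_int c / s)) / (s * s)"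
    proof -
      have "empirical n S t = (\<Sum>c\<in>C n. real (diag_count S c) * t (real_of_int c / s)) / (s * s)"
        using empirical_tent[OF S(1) d(4) conjunct2[OF conjunct2[OF n]]] unfolding t_def C_def s_def ss[unfolded s_def] .
      moreover have "D * R n = (\<Sum>c\<in>C n. real (diag_count S c0) * t (real_of_int c / s)) / (s * s)"
        unfolding R_def D_def s_def[symmetric] sum_distrib_left[symmetric] by simp
      ultimately show ?thesis
        by (simp only: diff_divide_distrib[symmetric] sum_subtractf[symmetric] left_diff_distrib)
    qed
    have bnd: "\<bar>(real (diag_count S c) - real (diag_count S c0)) * t (real_of_int c / s)\<bar> \<le> (\<delta> * s + 1) * t (real_of_int c / s)" for c
    proof (cases "\<delta> \<le> \<bar>real_of_int c / s - u0\<bar>")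
      case True
      then show ?thesis by (simp add: t_def tent_props(4))
    next
      case False
      then have "\<bar>real_of_int c / s - u0\<bar> * s < \<delta> * s" using s by simp
      moreover have "\<bar>real_of_int c / s - u0\<bar> * s = \<bar>real_of_int c - u0 * s\<bar>"
      proof -
        have "real_of_int c - u0 * s = (real_of_int c / s - u0) * s" using s by (simp add: left_diff_distrib)
        then show ?thesis using s by (simp only: abs_mult abs_of_pos)
      qed
      ultimately have "\<bar>real_of_int c - u0 * s\<bar> \<le> \<delta> * s" by (simp only: less_imp_le)
      moreover have "\<bar>u0 * s - real_of_int c0\<bar> \<le> 1" unfolding c0_def by linarith
      ultimately have "\<bar>real_of_int c - real_of_int c0\<bar> \<le> \<delta> * s + 1" by (rule abs_diff_le_add_1)
      then have "\<bar>real (diag_count S c) - real (diag_count S c0)\<bar> \<le> \<delta> * s + 1"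
        using diag_count_lipschitz[OF S(1), of c c0] by linarith
      then have "\<bar>real (diag_count S c) - real (diag_count S c0)\<bar> * t (real_of_int c / s) \<le> (\<delta> * s + 1) * t (real_of_int c / s)"
        using t0 by (rule mult_right_mono)
      then show ?thesis using t0 by (simp only: abs_mult abs_of_nonneg)
    qed
    have "\<bar>empirical n S t - D * R n\<bar> \<le> (\<Sum>c\<in>C n. (\<delta> * s + 1) * t (real_of_int c / s)) / (s * s)"
    proof -
      have "\<bar>\<Sum>c\<in>C n. (real (diag_count S c) - real (diag_count S c0)) * t (real_of_int c / s)\<bar>
          \<le> (\<Sum>c\<in>C n. (\<delta> * s + 1) * t (real_of_int c / s))"
        using bnd by (intro order_trans[OF sum_abs] sum_mono)
      then have "\<bar>\<Sum>c\<in>C n. (real (diag_count S c) - real (diag_count S c0)) * t (real_of_int c / s)\<bar> / (s * s)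
          \<le> (\<Sum>c\<in>C n. (\<delta> * s + 1) * t (real_of_int c / s)) / (s * s)"
        using s by (intro divide_right_mono) auto
      then show ?thesis unfolding emp abs_divide using s by simp
    qed
    also have "\<dots> = (\<delta> + 1 / s) * R n"
      unfolding R_def s_def[symmetric] sum_distrib_left[symmetric] using s by (simp add: field_simps)
    also have "\<dots> \<le> \<epsilon> / 4 * R n"
    proof (rule mult_right_mono)
      have "1 / s < \<epsilon> / 8" using n by (simp add: s_def)
      then show "\<delta> + 1 / s \<le> \<epsilon> / 4" using d(3) by linarith
    qed (use R0 in simp)
    finally have a1: "\<bar>empirical n S t - D * R n\<bar> \<le> \<epsilon> / 4 * R n" .
    have a2: "\<bar>rho u0 * T - rho u0 * R n\<bar> \<le> \<epsilon> / 8 * T"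
    proof -
      have "\<bar>rho u0 * T - rho u0 * R n\<bar> = rho u0 * \<bar>R n - T\<bar>"
        using rho_nonneg[of u0] by (simp add: right_diff_distrib[symmetric] abs_mult abs_minus_commute)
      also have "\<dots> \<le> rho u0 * \<kappa>" using n rho_nonneg[of u0] by (intro mult_left_mono) auto
      finally show ?thesis using k2 by linarith
    qed
    have "\<bar>D * R n - rho u0 * R n\<bar> \<le> \<epsilon> / 4 * R n + \<epsilon> * T / 8 + \<epsilon> / 8 * T + \<epsilon> / 8 * T"
      using a1 a2 h rhoT by linarith
    also have "\<dots> = \<epsilon> / 4 * R n + 3 / 8 * \<epsilon> * T" by simp
    \<comment> \<open>Trading T for 4/3 \<open>R n\<close> leaves a total of 3/4 \<epsilon>
      \<open>R n\<close>.\<close>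
    also have "\<dots> \<le> \<epsilon> / 4 * R n + 3 / 8 * \<epsilon> * (4 / 3 * R n)" using R0 e by (intro add_left_mono mult_left_mono) auto
    also have "\<dots> \<le> \<epsilon> * R n" using R0 e by simp
    finally have "\<bar>D - rho u0\<bar> * R n \<le> \<epsilon> * R n"
      using R0 by (simp add: left_diff_distrib[symmetric] abs_mult)
    then have "\<bar>D - rho u0\<bar> \<le> \<epsilon>" using R0 by simp
    then show "\<bar>real (diag_count S \<lfloor>u0 * sqrt (real n)\<rfloor>) / sqrt (real n) - rho u0\<bar> \<le> \<epsilon>"
      by (simp add: D_def c0_def s_def)
  qed
qed

text \<open>Finitely many centres suffice, because scaled diagonal lengths and \<open>rho\<close>
  both vary little over distance \<delta>. The centres stay in the open interval, where pointwise
  convergence is available; the end points are reached by the Lipschitz bound.\<close>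

theorem diag_count_uniform:
  assumes e: "0 < \<epsilon>"
  shows "whp (\<lambda>n S. \<forall>c. \<bar>real_of_int c\<bar> \<le> 2 * sqrt (real n) \<longrightarrow>
    \<bar>real (diag_count S c) / sqrt (real n) - rho (real_of_int c / sqrt (real n))\<bar> \<le> \<epsilon>)"
proof -
  have "uniformly_continuous_on {-2..2} rho"
    by (intro compact_uniformly_continuous continuous_on_rho) auto
  then obtain \<delta>1 where d1: "0 < \<delta>1"
    "\<And>u v. u \<in> {-2..2} \<Longrightarrow> v \<in> {-2..2} \<Longrightarrow> \<bar>u - v\<bar> < \<delta>1 \<Longrightarrow> \<bar>rho u - rho v\<bar> < \<epsilon> / 4"
    using e unfolding uniformly_continuous_on_def dist_real_def
    by (metis zero_less_divide_iff zero_less_numeral)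
  define \<delta> where "\<delta> = min \<delta>1 (\<epsilon> / 4)"
  have d: "0 < \<delta>" "\<delta> \<le> \<delta>1" "\<delta> \<le> \<epsilon> / 4" using d1(1) e unfolding \<delta>_def by linarith+
  have "{-2..2} \<subseteq> (\<Union>u\<in>{-2<..<2::real}. ball u \<delta>)"
  proof
    fix v :: real assume v: "v \<in> {-2..2}"
    \<comment> \<open>A point of the closed interval is shifted towards 0 by r; r < 1 prevents
      leaving the interval on the other side.\<close>
    define r where "r = min \<delta> 1 / 2"
    have r: "0 < r" "r < \<delta>" "r < 1" using d by (auto simp: r_def)
    define u where "u = (if v \<le> 0 then v + r else v - r)"
    have "u \<in> {-2<..<2}" "dist u v < \<delta>" using v r by (auto simp: u_def dist_real_def)
    then show "v \<in> (\<Union>u\<in>{-2<..<2}. ball u \<delta>)" by auto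
  qed
  then obtain U :: "real set" where U: "U \<subseteq> {-2<..<2}" "finite U" "{-2..2} \<subseteq> (\<Union>u\<in>U. ball u \<delta>)"
    by (rule compactE_image[OF compact_Icc open_ball])
  have w: "whp (\<lambda>n S. \<forall>u\<in>U. \<bar>real (diag_count S \<lfloor>u * sqrt (real n)\<rfloor>) / sqrt (real n) - rho u\<bar> \<le> \<epsilon> / 4)"
  proof (intro whp_ball_finite diag_count_pointwise U(2))
    fix u assume "u \<in> U"
    then have "u \<in> {-2<..<2}" using U(1) by blast
    then show "\<bar>u\<bar> < 2" by auto
  qed (use e in simp)
  have ev: "eventually (\<lambda>n. 1 / sqrt (real n) < \<epsilon> / 4 \<and> 0 < n) sequentially"
  proof -
    have "(\<lambda>n. 1 / sqrt (real n)) \<longlonglongrightarrow> 0" by real_asymp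
    then have "eventually (\<lambda>n. 1 / sqrt (real n) < \<epsilon> / 4) sequentially"
      by (rule order_tendstoD(2)) (use e in simp)
    then show ?thesis using eventually_gt_at_top[of 0] by eventually_elim auto
  qed
  show ?thesis
  proof (rule whp_mono[OF w eventually_mono[OF ev]], intro allI impI)
    fix n S c assume n: "1 / sqrt (real n) < \<epsilon> / 4 \<and> 0 < n" and S: "diagram S" "card S = n"
      and h: "\<forall>u\<in>U. \<bar>real (diag_count S \<lfloor>u * sqrt (real n)\<rfloor>) / sqrt (real n) - rho u\<bar> \<le> \<epsilon> / 4"
      and c: "\<bar>real_of_int c\<bar> \<le> 2 * sqrt (real n)"
    define s where "s = sqrt (real n)"
    have s: "0 < s" using n by (simp add: s_def)
    define v where "v = real_of_int c / s"
    have v: "v \<in> {-2..2}" using c s by (auto simp: v_def s_def[symmetric] abs_le_iff field_simps)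
    then obtain u where u: "u \<in> U" "\<bar>u - v\<bar> < \<delta>" using U(3) by (auto simp: dist_real_def)
    define c0 where "c0 = \<lfloor>u * s\<rfloor>"
    have "\<bar>real_of_int c - real_of_int c0\<bar> \<le> \<delta> * s + 1"
    proof -
      have "\<bar>u - v\<bar> * s \<le> \<delta> * s" using u s by (intro mult_right_mono) auto
      moreover have "real_of_int c - u * s = (v - u) * s" using s by (simp add: v_def left_diff_distrib)
      then have "\<bar>real_of_int c - u * s\<bar> = \<bar>u - v\<bar> * s"
        using s by (simp only: abs_mult abs_of_pos abs_minus_commute)
      ultimately have "\<bar>real_of_int c - u * s\<bar> \<le> \<delta> * s" by (simp only:)
      moreover have "\<bar>u * s - real_of_int c0\<bar> \<le> 1" unfolding c0_def by linarith
      ultimately show ?thesis by (rule abs_diff_le_add_1)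
    qed
    then have "\<bar>real (diag_count S c) - real (diag_count S c0)\<bar> \<le> \<delta> * s + 1"
      using diag_count_lipschitz[OF S(1), of c c0] by linarith
    then have "\<bar>real (diag_count S c) - real (diag_count S c0)\<bar> / s \<le> (\<delta> * s + 1) / s"
      using s by (intro divide_right_mono) auto
    then have "\<bar>real (diag_count S c) / s - real (diag_count S c0) / s\<bar> \<le> \<delta> + 1 / s"
      using s by (simp add: diff_divide_distrib[symmetric] abs_divide add_divide_distrib)
    moreover have "\<bar>real (diag_count S c0) / s - rho u\<bar> \<le> \<epsilon> / 4" using h u by (simp add: c0_def s_def)
    moreover have "\<bar>rho u - rho v\<bar> < \<epsilon> / 4"
    proof (rule d1(2))
      show "u \<in> {-2..2}" using subsetD[OF U(1) u(1)] by auto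
    qed (use u v d in auto)
    moreover have "1 / s < \<epsilon> / 4" using n by (simp add: s_def)
    ultimately have "\<bar>real (diag_count S c) / s - rho v\<bar> \<le> \<epsilon>" using d(3) by linarith
    then show "\<bar>real (diag_count S c) / sqrt (real n) - rho (real_of_int c / sqrt (real n))\<bar> \<le> \<epsilon>"
      by (simp add: v_def s_def)
  qed
qed

section \<open>The edges of the diagram\<close>

text \<open>The first column and the first row, treated uniformly.\<close>
definition is_arm :: "(nat \<Rightarrow> nat \<times> nat) \<Rightarrow> bool" where
  "is_arm \<tau> \<longleftrightarrow> \<tau> = (\<lambda>i. (i, 1)) \<or> \<tau> = (\<lambda>i. (1, i))"

definition arm_len :: "(nat \<Rightarrow> nat \<times> nat) \<Rightarrow> (nat \<times> nat) set \<Rightarrow> nat" where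
  "arm_len \<tau> S = card {i. \<tau> i \<in> S}"

lemma arm_inj: "is_arm \<tau> \<Longrightarrow> \<tau> i = \<tau> j \<longleftrightarrow> i = j"
  by (auto simp: is_arm_def)

lemma arm_set:
  assumes \<tau>: "is_arm \<tau>" and S: "diagram S"
  shows "{i. \<tau> i \<in> S} = {1..arm_len \<tau> S}"
  unfolding arm_len_def
proof (rule downward_closed_initial)
  have "inj \<tau>" using arm_inj[OF \<tau>] by (auto simp: inj_def)
  then show "finite {i. \<tau> i \<in> S}" using finite_vimageI[OF diagram_finite[OF S]] by (simp add: vimage_def)
  show "1 \<le> j" if "j \<in> {i. \<tau> i \<in> S}" for j
    using that \<tau> diagram_pos[OF S] unfolding is_arm_def by auto
  show "i \<in> {i. \<tau> i \<in> S}" if "j \<in> {i. \<tau> i \<in> S}" "1 \<le> i" "i \<le> j" for i j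
    using that \<tau> diagram_down[OF S, of j 1 i 1] diagram_down[OF S, of 1 j 1 i] unfolding is_arm_def by auto
qed

lemma arm_mem: "is_arm \<tau> \<Longrightarrow> diagram S \<Longrightarrow> \<tau> i \<in> S \<longleftrightarrow> 1 \<le> i \<and> i \<le> arm_len \<tau> S"
  using arm_set by (metis atLeastAtMost_iff mem_Collect_eq)

lemma arm_tip_addable:
  assumes \<tau>: "is_arm \<tau>" and S: "diagram S"
  shows "\<tau> (Suc (arm_len \<tau> S)) \<in> addable S"
proof -
  note m = arm_mem[OF \<tau> S]
  show ?thesis
    using \<tau>[unfolded is_arm_def]
  proof
    assume t: "\<tau> = (\<lambda>i. (i, 1))"
    show ?thesis using m[of "Suc (arm_len \<tau> S)"] m[of "arm_len \<tau> S"] unfolding t addable_iff[OF S] by auto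
  next
    assume t: "\<tau> = (\<lambda>i. (1, i))"
    show ?thesis using m[of "Suc (arm_len \<tau> S)"] m[of "arm_len \<tau> S"] unfolding t addable_iff[OF S] by auto
  qed
qed

lemma arm_len_insert:
  assumes \<tau>: "is_arm \<tau>" and S: "diagram S" and p: "p \<in> addable S"
  shows "arm_len \<tau> (insert p S) = arm_len \<tau> S + of_bool (p = \<tau> (Suc (arm_len \<tau> S)))"
proof -
  note ap = addable_removable[OF S p]
  define m where "m = arm_len \<tau> S"
  define m' where "m' = arm_len \<tau> (insert p S)"
  have mem: "\<tau> i \<in> S \<longleftrightarrow> 1 \<le> i \<and> i \<le> m" "\<tau> i \<in> insert p S \<longleftrightarrow> 1 \<le> i \<and> i \<le> m'" for i
    using arm_mem[OF \<tau> S] arm_mem[OF \<tau> ap(1)] by (simp_all add: m_def m'_def)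
  have le: "m \<le> m'" using mem[of m] by (cases "m = 0") auto
  have ge: "m' \<le> Suc m"
  proof (rule ccontr)
    assume "\<not> m' \<le> Suc m"
    then have "1 \<le> Suc m \<and> Suc m \<le> m'" "1 \<le> Suc (Suc m) \<and> Suc (Suc m) \<le> m'" by auto
    then have "\<tau> (Suc m) \<in> insert p S" "\<tau> (Suc (Suc m)) \<in> insert p S"
      unfolding mem(2)[symmetric] .
    moreover have "\<tau> (Suc m) \<notin> S" "\<tau> (Suc (Suc m)) \<notin> S" unfolding mem(1) by auto
    ultimately show False using arm_inj[OF \<tau>, of "Suc m" "Suc (Suc m)"] by auto
  qed
  show ?thesis
  proof (cases "p = \<tau> (Suc m)")
    case True
    then show ?thesis using mem(2)[of "Suc m"] ge by (simp add: m_def m'_def)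
  next
    case False
    then have "\<tau> (Suc m) \<notin> insert p S" using mem(1)[of "Suc m"] by auto
    then have "m' = m" using mem(2)[of "Suc m"] le ge by auto
    then show ?thesis using False by (simp add: m_def m'_def)
  qed
qed

lemma sum_sdim_sq: "(\<Sum>S\<in>shapes n. (sdim S)\<^sup>2) = fact n"
  using expect_const[of n 1] by (simp add: expect_def sum_divide_distrib[symmetric])

text \<open>Cauchy--Schwarz (in the form of AM--GM with ratio \<open>sqrt (n + 1)\<close>) bounds the probability
  that the growth process prolongs a given arm.\<close>
lemma arm_growth_prob:
  assumes \<tau>: "is_arm \<tau>"
  shows "expect n (\<lambda>S. trans_prob S (\<tau> (Suc (arm_len \<tau> S)))) \<le> 1 / sqrt (real n + 1)"
proof -
  define t where "t = sqrt (real n + 1)"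
  have t: "0 < t" "t * t = real n + 1" by (simp_all add: t_def add_nonneg_pos)
  \<comment> \<open>The inserted node is the tip of the new arm and can be removed again, so this
    map is injective and the squared dimensions of its values sum to at most (n + 1)!.\<close>
  define \<Lambda> where "\<Lambda> S = insert (\<tau> (Suc (arm_len \<tau> S))) S" for S
  have L: "\<Lambda> S \<in> shapes (Suc n)" "arm_len \<tau> (\<Lambda> S) = Suc (arm_len \<tau> S)" "\<Lambda> S - {\<tau> (arm_len \<tau> (\<Lambda> S))} = S"
    if "S \<in> shapes n" for S
  proof -
    have S: "diagram S" using that by (simp add: shapes_def)
    note a = arm_tip_addable[OF \<tau> S]
    show 2: "arm_len \<tau> (\<Lambda> S) = Suc (arm_len \<tau> S)" using arm_len_insert[OF \<tau> S a] by (simp add: \<Lambda>_def)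
    show "\<Lambda> S \<in> shapes (Suc n)" using addable_removable[OF S a] that by (simp add: \<Lambda>_def shapes_def)
    show "\<Lambda> S - {\<tau> (arm_len \<tau> (\<Lambda> S))} = S" unfolding 2 using addable_removable(3)[OF S a] by (simp add: \<Lambda>_def)
  qed
  have inj: "inj_on \<Lambda> (shapes n)" using L(3) by (metis inj_onI)
  have sumL: "(\<Sum>S\<in>shapes n. (sdim (\<Lambda> S))\<^sup>2) \<le> fact (Suc n)"
  proof -
    have "(\<Sum>S\<in>shapes n. (sdim (\<Lambda> S))\<^sup>2) = (\<Sum>S\<in>\<Lambda> ` shapes n. (sdim S)\<^sup>2)"
      using inj by (simp add: sum.reindex)
    also have "\<dots> \<le> (\<Sum>S\<in>shapes (Suc n). (sdim S)\<^sup>2)"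
      using L(1) finite_shapes by (intro sum_mono2) auto
    finally show ?thesis by (simp only: sum_sdim_sq)
  qed
  have f: "fact (Suc n) = t * t * (fact n :: real)" by (simp add: t(2) add.commute)
  have fp: "(0::real) < fact (Suc n)" by (rule fact_gt_zero)
  have "expect n (\<lambda>S. trans_prob S (\<tau> (Suc (arm_len \<tau> S)))) = (\<Sum>S\<in>shapes n. sdim S * sdim (\<Lambda> S)) / fact (Suc n)"
    unfolding expect_def sum_divide_distrib
  proof (intro sum.cong refl)
    fix S assume "S \<in> shapes n"
    then have "sdim S > 0" "card S = n" using sdim_pos by (auto simp: shapes_def)
    then show "(sdim S)\<^sup>2 / fact n * trans_prob S (\<tau> (Suc (arm_len \<tau> S))) = sdim S * sdim (\<Lambda> S) / fact (Suc n)"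
      by (simp add: trans_prob_def \<Lambda>_def power2_eq_square mult_ac add.commute)
  qed
  also have "\<dots> \<le> (\<Sum>S\<in>shapes n. (t * (sdim S)\<^sup>2 + (sdim (\<Lambda> S))\<^sup>2 / t) / 2) / fact (Suc n)"
  proof (intro divide_right_mono sum_mono less_imp_le[OF fp])
    fix S
    have "0 \<le> (t * sdim S - sdim (\<Lambda> S))\<^sup>2 / t" using t by simp
    also have "\<dots> = t * (sdim S)\<^sup>2 + (sdim (\<Lambda> S))\<^sup>2 / t - 2 * (sdim S * sdim (\<Lambda> S))"
      using t(1) by (simp add: power2_eq_square field_simps)
    finally show "sdim S * sdim (\<Lambda> S) \<le> (t * (sdim S)\<^sup>2 + (sdim (\<Lambda> S))\<^sup>2 / t) / 2" by simp
  qed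
  also have "(\<Sum>S\<in>shapes n. (t * (sdim S)\<^sup>2 + (sdim (\<Lambda> S))\<^sup>2 / t) / 2)
    = (t * fact n + (\<Sum>S\<in>shapes n. (sdim (\<Lambda> S))\<^sup>2) / t) / 2"
    unfolding sum_divide_distrib[symmetric] sum.distrib sum_distrib_left[symmetric] sum_sdim_sq by simp
  also have "\<dots> / fact (Suc n) \<le> ((t * fact n + fact (Suc n) / t) / 2) / fact (Suc n)"
    using sumL t(1) fp by (intro divide_right_mono add_left_mono) auto
  also have "\<dots> = 1 / t"
    unfolding f using t(1) by (simp add: field_simps)
  finally show ?thesis by (simp add: t_def)
qed

text \<open>An arm grows only at its tip, so its mean grows by the mean tip probability, at most
  \<open>1 / sqrt (n + 1)\<close>; these increments are dominated by those of
  \<open>2 * sqrt n\<close>.\<close>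

lemma expect_arm_len:
  assumes \<tau>: "is_arm \<tau>"
  shows "expect n (\<lambda>S. real (arm_len \<tau> S)) \<le> 2 * sqrt (real n)"
proof (induction n)
  case 0
  have "arm_len \<tau> {} = 0" by (simp add: arm_len_def)
  then show ?case by (simp add: expect_0)
next
  case (Suc n)
  have "expect (Suc n) (\<lambda>S. real (arm_len \<tau> S)) = expect n (\<lambda>S. real (arm_len \<tau> S) + trans_prob S (\<tau> (Suc (arm_len \<tau> S))))"
    unfolding expect_Suc
  proof (rule expect_cong)
    fix S assume S: "diagram S"
    let ?q = "\<tau> (Suc (arm_len \<tau> S))"
    have "(\<Sum>p\<in>addable S. trans_prob S p * real (arm_len \<tau> (insert p S)))
       = (\<Sum>p\<in>addable S. trans_prob S p * real (arm_len \<tau> S) + (if p = ?q then trans_prob S p else 0))"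
      using arm_len_insert[OF \<tau> S] by (intro sum.cong refl) (simp add: algebra_simps)
    also have "\<dots> = (\<Sum>p\<in>addable S. trans_prob S p) * real (arm_len \<tau> S) + trans_prob S ?q"
      using arm_tip_addable[OF \<tau> S] finite_addable[OF S] by (simp add: sum.distrib sum_distrib_right)
    also have "(\<Sum>p\<in>addable S. trans_prob S p) = 1" using trans_moment_0[OF S] by (simp add: trans_moment_def)
    finally show "(\<Sum>p\<in>addable S. trans_prob S p * real (arm_len \<tau> (insert p S))) = real (arm_len \<tau> S) + trans_prob S ?q"
      by simp
  qed
  also have "\<dots> \<le> 2 * sqrt (real n) + 1 / sqrt (real n + 1)"
    unfolding expect_add using Suc arm_growth_prob[OF \<tau>, of n] by linarith
  also have "\<dots> \<le> 2 * sqrt (real (Suc n))"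
  proof -
    define x where "x = sqrt (real n)"
    define y where "y = sqrt (real n + 1)"
    have xy: "0 \<le> x" "0 < y" "x \<le> y" "y * y = x * x + 1" by (simp_all add: x_def y_def add_nonneg_pos)
    \<comment> \<open>Together with y^2 = x^2 + 1 this is 2 x y + 1 <= 2 y^2, the step from n to n +
      1 after division by y.\<close>
    have "0 \<le> (y - x) * (y - x)" by simp
    then have "2 * x * y + 1 \<le> 2 * y * y" using xy(4) by (simp add: algebra_simps)
    then have "2 * x + 1 / y \<le> 2 * y" using xy(2) by (simp add: field_simps)
    then show ?thesis by (simp add: x_def y_def add.commute)
  qed
  finally show ?case .
qed

text \<open>Positivity of \<open>rho\<close> close to the end point makes the corresponding diagonal
  nonempty; its first node lies on the arm, at distance about |u0| \<open>sqrt n\<close>.\<close>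

lemma arm_len_lower:
  assumes \<tau>: "is_arm \<tau>" and e: "0 < \<epsilon>"
  shows "whp (\<lambda>n S. (2 - \<epsilon>) * sqrt (real n) \<le> real (arm_len \<tau> S))"
proof -
  \<comment> \<open>The maximum covers \<epsilon> >= 2; the sign of \<open>u0\<close> then selects
    the column (right end) or the row (left end).\<close>
  define u where "u = max 0 (2 - \<epsilon>)"
  define u0 where "u0 = (if \<tau> = (\<lambda>i. (i, 1)) then u else - u)"
  have u: "0 \<le> u" "\<bar>u0\<bar> < 2" "2 - \<epsilon> \<le> u" using e by (auto simp: u_def u0_def)
  have r: "0 < rho u0" using Omega_gt_abs[OF u(2)] by (simp add: rho_def)
  then have "whp (\<lambda>n S. \<bar>real (diag_count S \<lfloor>u0 * sqrt (real n)\<rfloor>) / sqrt (real n) - rho u0\<bar> \<le> rho u0 / 2)"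
    using u by (intro diag_count_pointwise) auto
  then show ?thesis
  proof (rule whp_mono[OF _ always_eventually], intro allI impI)
    fix n S assume S: "diagram S" "card S = n"
      and h: "\<bar>real (diag_count S \<lfloor>u0 * sqrt (real n)\<rfloor>) / sqrt (real n) - rho u0\<bar> \<le> rho u0 / 2"
    define s where "s = sqrt (real n)"
    define c where "c = \<lfloor>u0 * s\<rfloor>"
    have s: "0 \<le> s" by (simp add: s_def)
    have "0 < real (diag_count S c) / s" using h r unfolding c_def s_def by linarith
    then have d: "1 \<le> diag_count S c" using s by (auto simp: zero_less_divide_iff)
    have "u * s \<le> real (arm_len \<tau> S)"
    proof (cases "\<tau> = (\<lambda>i. (i, 1))")
      case True
      then have c0: "0 \<le> c" using u(1) s by (simp add: c_def u0_def)
      have "(nat c + 1, 1) \<in> S" using c0 d mem_diagram_iff[OF S(1), of "nat c + 1" 1] by simp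
      then have "nat c + 1 \<le> arm_len \<tau> S" using arm_mem[OF \<tau> S(1), of "nat c + 1"] True by simp
      then have "real_of_int c + 1 \<le> real (arm_len \<tau> S)" using c0 by linarith
      moreover have "u * s < real_of_int c + 1" using True unfolding c_def u0_def by simp
      ultimately show ?thesis by linarith
    next
      case False
      then have t: "\<tau> = (\<lambda>i. (1, i))" using \<tau> by (simp add: is_arm_def)
      have c0: "c \<le> 0" using False u(1) s by (simp add: c_def u0_def floor_le_iff) (smt (verit) mult_nonneg_nonneg)
      have "(1, nat (1 - c)) \<in> S" using c0 d mem_diagram_iff[OF S(1), of 1 "nat (1 - c)"] by simp
      then have "nat (1 - c) \<le> arm_len \<tau> S" using arm_mem[OF \<tau> S(1), of "nat (1 - c)"] t by simp
      then have "1 - real_of_int c \<le> real (arm_len \<tau> S)" using c0 by linarith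
      moreover have "u0 = - u" using False by (simp add: u0_def)
      then have "real_of_int c \<le> - (u * s)" using of_int_floor_le[of "u0 * s"] by (simp add: c_def)
      ultimately show ?thesis by linarith
    qed
    moreover have "(2 - \<epsilon>) * s \<le> u * s" using u(3) s by (intro mult_right_mono)
    ultimately show "(2 - \<epsilon>) * sqrt (real n) \<le> real (arm_len \<tau> S)" by (simp add: s_def)
  qed
qed

text \<open>The lower bound holds with high probability and the mean is at most \<open>2 sqrt n\<close>, so the upper
  bound follows from Markov's inequality.\<close>
lemma arm_len_upper:
  assumes \<tau>: "is_arm \<tau>" and e: "0 < \<epsilon>"
  shows "whp (\<lambda>n S. real (arm_len \<tau> S) \<le> (2 + \<epsilon>) * sqrt (real n))"
  unfolding whp_def
proof (rule LIMSEQ_I)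
  fix r :: real assume r: "0 < r"
  define \<delta> where "\<delta> = min 1 (r * \<epsilon> / 4)"
  have d: "0 < \<delta>" "\<delta> \<le> 1" "\<delta> \<le> r * \<epsilon> / 4" using r e by (auto simp: \<delta>_def)
  define bad where "bad n = expect n (\<lambda>S. of_bool (\<not> (2 - \<delta>) * sqrt (real n) \<le> real (arm_len \<tau> S)))" for n
  have "bad \<longlonglongrightarrow> 0" using arm_len_lower[OF \<tau> d(1)] unfolding whp_def bad_def[abs_def] .
  then have "eventually (\<lambda>n. bad n < r * \<epsilon> / 8) sequentially"
    by (rule order_tendstoD(2)) (use r e in simp)
  then have "eventually (\<lambda>n. bad n < r * \<epsilon> / 8 \<and> 0 < n) sequentially"
    using eventually_gt_at_top[of 0] by eventually_elim auto
  then have "eventually (\<lambda>n. norm (expect n (\<lambda>S. of_bool (\<not> real (arm_len \<tau> S) \<le> (2 + \<epsilon>) * sqrt (real n))) - 0) < r) sequentially"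
  proof eventually_elim
    case (elim n)
    define s where "s = sqrt (real n)"
    have s: "0 < s" using elim by (simp add: s_def)
    \<comment> \<open>The scaled arm minus its lower bound, corrected on the bad event so as to be
      nonnegative everywhere. Its mean is at most \<delta> + 2 \<open>bad n\<close>, below r
      \<epsilon>, and Markov's inequality applies.\<close>
    define Y where "Y S = real (arm_len \<tau> S) / s - (2 - \<delta>) + (2 - \<delta>) * of_bool (\<not> (2 - \<delta>) * s \<le> real (arm_len \<tau> S))" for S
    have Y: "0 \<le> Y S" for S
    proof (cases "(2 - \<delta>) * s \<le> real (arm_len \<tau> S)")
      case True
      then show ?thesis using s by (simp add: Y_def field_simps)
    next
      case False
      then show ?thesis using s by (simp add: Y_def)
    qed
    have "expect n (\<lambda>S. of_bool (\<not> real (arm_len \<tau> S) \<le> (2 + \<epsilon>) * s)) \<le> expect n (\<lambda>S. of_bool (\<not> Y S \<le> \<epsilon>))"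
    proof (rule expect_mono)
      fix S
      have "\<not> Y S \<le> \<epsilon>" if "\<not> real (arm_len \<tau> S) \<le> (2 + \<epsilon>) * s"
      proof -
        have "2 + \<epsilon> < real (arm_len \<tau> S) / s" using that s by (simp add: field_simps)
        moreover have "0 \<le> (2 - \<delta>) * of_bool (\<not> (2 - \<delta>) * s \<le> real (arm_len \<tau> S))" using d by simp
        ultimately show ?thesis using d(1) unfolding Y_def by linarith
      qed
      then show "of_bool (\<not> real (arm_len \<tau> S) \<le> (2 + \<epsilon>) * s) \<le> (of_bool (\<not> Y S \<le> \<epsilon>) :: real)" by simp
    qed
    also have "\<dots> \<le> expect n Y / \<epsilon>" using Y e by (intro markov) auto
    also have "\<dots> < r"
    proof -
      have "expect n Y = expect n (\<lambda>S. real (arm_len \<tau> S) / s) - (2 - \<delta>) + (2 - \<delta>) * bad n"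
        unfolding Y_def[abs_def] expect_add expect_diff expect_const expect_cmult bad_def s_def by simp
      moreover have "expect n (\<lambda>S. real (arm_len \<tau> S) / s) \<le> 2"
      proof -
        have "expect n (\<lambda>S. real (arm_len \<tau> S) / s) = expect n (\<lambda>S. real (arm_len \<tau> S)) / s"
          using expect_cmult[of n "1 / s" "\<lambda>S. real (arm_len \<tau> S)"] by simp
        then show ?thesis using expect_arm_len[OF \<tau>, of n] s by (simp add: s_def divide_le_eq)
      qed
      moreover have "0 \<le> bad n" unfolding bad_def by (intro expect_nonneg) auto
      then have "(2 - \<delta>) * bad n \<le> 2 * bad n" using d by (intro mult_right_mono) auto
      moreover have "0 < r * \<epsilon>" using r e by simp
      ultimately have "expect n Y < r * \<epsilon>" using elim d(3) by linarith
      then show ?thesis using e by (simp add: field_simps)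
    qed
    finally have "expect n (\<lambda>S. of_bool (\<not> real (arm_len \<tau> S) \<le> (2 + \<epsilon>) * s)) < r" .
    moreover have "0 \<le> expect n (\<lambda>S. of_bool (\<not> real (arm_len \<tau> S) \<le> (2 + \<epsilon>) * s))" by (intro expect_nonneg) auto
    ultimately show ?case by (simp add: s_def)
  qed
  then show "\<exists>no. \<forall>n\<ge>no. norm (expect n (\<lambda>S. of_bool (\<not> real (arm_len \<tau> S) \<le> (2 + \<epsilon>) * sqrt (real n))) - 0) < r"
    by (simp add: eventually_sequentially)
qed

text \<open>Within |c| <= 2 \<open>sqrt n\<close> the profile controls a + b, since |c| plus twice
  the diagonal length is close to \<open>sqrt n * Omega\<close>; the remaining diagonals are
  controlled by the arms.\<close>

theorem node_sum_bound:
  assumes e: "0 < \<epsilon>"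
  shows "whp (\<lambda>n S. \<forall>(a, b)\<in>S. real a + real b \<le> (2 + \<epsilon>) * sqrt (real n))"
proof -
  have arms: "is_arm (\<lambda>i. (i, 1))" "is_arm (\<lambda>i. (1, i))" by (auto simp: is_arm_def)
  have e2: "0 < \<epsilon> / 2" using e by simp
  have "whp (\<lambda>n S. (real (arm_len (\<lambda>i. (i, 1)) S) \<le> (2 + \<epsilon> / 2) * sqrt (real n)
     \<and> real (arm_len (\<lambda>i. (1, i)) S) \<le> (2 + \<epsilon> / 2) * sqrt (real n))
     \<and> (\<forall>c. \<bar>real_of_int c\<bar> \<le> 2 * sqrt (real n) \<longrightarrow>
    \<bar>real (diag_count S c) / sqrt (real n) - rho (real_of_int c / sqrt (real n))\<bar> \<le> \<epsilon> / 2))"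
    by (intro whp_conj arm_len_upper arms diag_count_uniform e2)
  then show ?thesis
  proof (rule whp_mono[OF _ eventually_mono[OF eventually_gt_at_top[of 0]]], intro allI impI)
    fix n S assume n: "0 < n" and S: "diagram S" "card S = n"
      and h: "(real (arm_len (\<lambda>i. (i, 1)) S) \<le> (2 + \<epsilon> / 2) * sqrt (real n)
     \<and> real (arm_len (\<lambda>i. (1, i)) S) \<le> (2 + \<epsilon> / 2) * sqrt (real n))
     \<and> (\<forall>c. \<bar>real_of_int c\<bar> \<le> 2 * sqrt (real n) \<longrightarrow>
    \<bar>real (diag_count S c) / sqrt (real n) - rho (real_of_int c / sqrt (real n))\<bar> \<le> \<epsilon> / 2)"
    define s where "s = sqrt (real n)"
    have s: "0 < s" using n by (simp add: s_def)
    show "\<forall>(a, b)\<in>S. real a + real b \<le> (2 + \<epsilon>) * sqrt (real n)"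
    proof (clarify)
      fix a b assume ab: "(a, b) \<in> S"
      have pos: "1 \<le> a" "1 \<le> b" using diagram_pos[OF S(1) ab] by auto
      have "(a, 1) \<in> S" "(1, b) \<in> S" using diagram_down[OF S(1) ab] pos by auto
      then have "a \<le> arm_len (\<lambda>i. (i, 1)) S" "b \<le> arm_len (\<lambda>i. (1, i)) S"
        using arm_mem[OF arms(1) S(1), of a] arm_mem[OF arms(2) S(1), of b] by auto
      then have le: "real a \<le> (2 + \<epsilon> / 2) * s" "real b \<le> (2 + \<epsilon> / 2) * s"
        using h unfolding s_def by linarith+
      define c where "c = int a - int b"
      define d where "d = real (diag_count S c)"
      show "real a + real b \<le> (2 + \<epsilon>) * sqrt (real n)"
      proof (cases "\<bar>real_of_int c\<bar> \<le> 2 * s")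
        case True
        define u where "u = real_of_int c / s"
        have u: "\<bar>u\<bar> \<le> 2" using True s by (simp add: u_def field_simps)
        define q where "q = d / s"
        have "\<bar>q - rho u\<bar> \<le> \<epsilon> / 2" using h True by (simp add: q_def d_def u_def s_def)
        then have "q - rho u \<le> \<epsilon> / 2" by (rule order_trans[OF abs_ge_self])
        moreover have "2 * rho u = Omega u - \<bar>u\<bar>" by (simp add: rho_def)
        ultimately have "\<bar>u\<bar> + 2 * q \<le> 2 + \<epsilon>" using Omega_le_2[OF u] by linarith
        then have "(\<bar>u\<bar> + 2 * q) * s \<le> (2 + \<epsilon>) * s" using s by (intro mult_right_mono) auto
        moreover have "(\<bar>u\<bar> + 2 * q) * s = \<bar>real_of_int c\<bar> + 2 * d" using s by (simp add: u_def q_def distrib_right)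
        moreover have "min a b \<le> diag_count S c" using mem_diagram_iff[OF S(1) pos] ab by (simp add: c_def)
        then have "real a + real b \<le> \<bar>real_of_int c\<bar> + 2 * d" unfolding c_def d_def by linarith
        ultimately show ?thesis by (simp add: s_def)
      next
        case False
        \<comment> \<open>Here a + b is 2 max a b - |c|, at most (4 + \<epsilon>) s - 2 s.\<close>
        then show ?thesis using le unfolding c_def s_def[symmetric] distrib_right by linarith
      qed
    qed
  qed
qed

section \<open>Ladders and regularisation\<close>

definition ladder_count :: "nat \<Rightarrow> (nat \<times> nat) set \<Rightarrow> nat \<Rightarrow> nat" where
  "ladder_count e S l = card {q \<in> S. ladder e q = l}"

definition ladder_full :: "nat \<Rightarrow> (nat \<times> nat) set \<Rightarrow> nat \<Rightarrow> bool" where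
  "ladder_full e S l \<longleftrightarrow> ladder_positions e l \<subseteq> S"

definition reg_set :: "nat \<Rightarrow> (nat \<times> nat) set \<Rightarrow> (nat \<times> nat) set" where
  "reg_set e S = {(a, b). 1 \<le> a \<and> 1 \<le> b \<and>
      card {q \<in> ladder_positions e (ladder e (a, b)). fst q < a} < ladder_count e S (ladder e (a, b))}"

lemma reg_nodes_eq: "reg_nodes e lam = reg_set e (young lam)"
  by (simp add: reg_nodes_def reg_set_def ladder_count_def)

lemma ladder_positions_finite:
  assumes "2 \<le> e"
  shows "finite (ladder_positions e l)"
proof (rule finite_subset)
  show "ladder_positions e l \<subseteq> {..l} \<times> {..Suc l}"
  proof
    fix p assume "p \<in> ladder_positions e l"
    then obtain a b where p: "p = (a, b)" "1 \<le> b" "a + (e - 1) * (b - 1) = l" by (auto simp: ladder_positions_def ladder_def)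
    have "1 * (b - 1) \<le> (e - 1) * (b - 1)" using assms by (intro mult_right_mono) auto
    then have "a \<le> l" "b \<le> Suc l" using p(2,3) by linarith+
    then show "p \<in> {..l} \<times> {..Suc l}" using p(1) by simp
  qed
qed auto

text \<open>The positions above (a, b) on its ladder are (a - j (e - 1), b + j), and they stop when
  the row index would drop below 1.\<close>

lemma ladder_higher_count:
  assumes e: "2 \<le> e" and ab: "1 \<le> a" "1 \<le> b"
  shows "card {q \<in> ladder_positions e (ladder e (a, b)). fst q < a} = (a - 1) div (e - 1)"
proof -
  define m where "m = e - 1"
  have m: "1 \<le> m" using e by (simp add: m_def)
  define k where "k = (a - 1) div m"
  have kle: "j \<le> k \<longleftrightarrow> j * m \<le> a - 1" for j using m by (simp add: k_def less_eq_div_iff_mult_less_eq)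
  have "{q \<in> ladder_positions e (ladder e (a, b)). fst q < a} = (\<lambda>j. (a - j * m, b + j)) ` {1..k}"
  proof (rule set_eqI)
    fix q :: "nat \<times> nat"
    obtain c d where q: "q = (c, d)" by (cases q)
    show "q \<in> {q \<in> ladder_positions e (ladder e (a, b)). fst q < a} \<longleftrightarrow> q \<in> (\<lambda>j. (a - j * m, b + j)) ` {1..k}"
    proof
      assume "q \<in> {q \<in> ladder_positions e (ladder e (a, b)). fst q < a}"
      then have h: "1 \<le> c" "1 \<le> d" "c + m * (d - 1) = a + m * (b - 1)" "c < a"
        by (auto simp: q ladder_positions_def ladder_def m_def)
      have "b < d"
      proof (rule ccontr)
        assume "\<not> b < d"
        then have "m * (d - 1) \<le> m * (b - 1)" by (intro mult_left_mono) auto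
        then show False using h by linarith
      qed
      define j where "j = d - b"
      have j: "d = b + j" "1 \<le> j" using \<open>b < d\<close> by (auto simp: j_def)
      have "d - 1 = (b - 1) + j" using j ab by simp
      then have "c + j * m = a" using h(3) by (simp add: algebra_simps)
      then have "c = a - j * m" "j * m \<le> a - 1" using h(1) by auto
      then show "q \<in> (\<lambda>j. (a - j * m, b + j)) ` {1..k}" using kle j by (auto simp: q)
    next
      assume "q \<in> (\<lambda>j. (a - j * m, b + j)) ` {1..k}"
      then obtain j where j: "1 \<le> j" "j \<le> k" "c = a - j * m" "d = b + j" by (auto simp: q)
      have jm: "j * m \<le> a - 1" using kle j by simp
      have "1 * 1 \<le> j * m" using j m by (intro mult_mono) auto
      then have "c + j * m = a" "1 \<le> c" "c < a" using jm j ab by auto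
      moreover have "d - 1 = (b - 1) + j" using j ab by simp
      ultimately have "c + m * (d - 1) = a + m * (b - 1)" by (simp add: algebra_simps)
      then have "ladder e (c, d) = ladder e (a, b)" unfolding ladder_def fst_conv snd_conv m_def .
      then show "q \<in> {q \<in> ladder_positions e (ladder e (a, b)). fst q < a}"
        using \<open>1 \<le> c\<close> \<open>c < a\<close> j by (simp add: q ladder_positions_def)
    qed
  qed
  moreover have "inj_on (\<lambda>j. (a - j * m, b + j)) {1..k}" by (auto simp: inj_on_def)
  ultimately show ?thesis by (simp add: card_image k_def m_def)
qed

lemma reg_set_iff:
  assumes "2 \<le> e"
  shows "(a, b) \<in> reg_set e S \<longleftrightarrow> 1 \<le> a \<and> 1 \<le> b \<and> (a - 1) div (e - 1) < ladder_count e S (ladder e (a, b))"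
  using ladder_higher_count[OF assms] by (auto simp: reg_set_def)

lemma ladder_positions_card:
  assumes e: "2 \<le> e" and a: "1 \<le> a"
  shows "card (ladder_positions e a) = Suc ((a - 1) div (e - 1))"
proof -
  have "ladder_positions e a = insert (a, 1) {q \<in> ladder_positions e (ladder e (a, 1)). fst q < a}"
  proof -
    have "\<forall>p\<in>ladder_positions e a. p = (a, 1) \<or> fst p < a"
      using e by (auto simp: ladder_positions_def ladder_def)
    moreover have "(a, 1) \<in> ladder_positions e a" and l: "ladder e (a, 1) = a" using a by (auto simp: ladder_positions_def ladder_def)
    ultimately show ?thesis unfolding l by blast
  qed
  then show ?thesis
    using ladder_higher_count[OF e a, of 1] ladder_positions_finite[OF e] by simp
qed

section \<open>Full ladders and the rows of the regularisation\<close>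

context
  fixes e :: nat and S :: "(nat \<times> nat) set"
  assumes e: "2 \<le> e" and S: "diagram S"
begin

lemma node_ladder_positions: "{q \<in> S. ladder e q = l} = S \<inter> ladder_positions e l"
  using diagram_pos[OF S] by (auto simp: ladder_positions_def)

lemma ladder_count_le: "ladder_count e S l \<le> card (ladder_positions e l)"
  unfolding ladder_count_def node_ladder_positions
  using ladder_positions_finite[OF e] by (intro card_mono) auto

lemma ladder_count_full: "ladder_full e S l \<Longrightarrow> ladder_count e S l = card (ladder_positions e l)"
  unfolding ladder_count_def node_ladder_positions ladder_full_def by (simp add: inf.absorb2)

lemma ladder_count_not_full: "\<not> ladder_full e S l \<Longrightarrow> ladder_count e S l < card (ladder_positions e l)"
  unfolding ladder_count_def node_ladder_positions ladder_full_def
  using ladder_positions_finite[OF e] by (intro psubset_card_mono) auto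

text \<open>The missing position in column b0 splits the later ladder: nodes to the right of b0 move
  one column left, the others move e - 1 rows up. Both moves stay in the diagram and land on ladder
  l. No image lies in column b0, as it would have to be the missing position, so the two families
  remain separated and the map is injective.\<close>

lemma ladder_count_step:
  assumes miss: "(a0, b0) \<notin> S" "1 \<le> a0" "1 \<le> b0" "ladder e (a0, b0) = l"
  shows "ladder_count e S (l + (e - 1)) \<le> ladder_count e S l"
proof -
  define m where "m = e - 1"
  have m: "1 \<le> m" using e by (simp add: m_def)
  define f where "f q = (if b0 < snd q then (fst q, snd q - 1) else (fst q - m, snd q))" for q :: "nat \<times> nat"
  have l: "a0 + m * (b0 - 1) = l" using miss by (simp add: ladder_def m_def)
  have im: "f q \<in> {q \<in> S. ladder e q = l} \<and> snd (f q) \<noteq> b0 \<and> (b0 < snd q \<longleftrightarrow> b0 < snd (f q)) \<and>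
      (\<not> b0 < snd q \<longrightarrow> m < fst q)"
    if "q \<in> {q \<in> S. ladder e q = l + m}" for q
  proof -
    obtain a b where q: "q = (a, b)" by (cases q)
    have ab: "(a, b) \<in> S" "a + m * (b - 1) = l + m" using that by (auto simp: q ladder_def m_def)
    note pos = diagram_pos[OF S ab(1)]
    show ?thesis
    proof (cases "b0 < b")
      case True
      have b1: "b - 1 = Suc (b - 1 - 1)" "1 \<le> b - 1" using True miss by auto
      then have "m * (b - 1) = m * (b - 1 - 1) + m" by (metis mult_Suc_right add.commute)
      then have eq: "a + m * (b - 1 - 1) = l" using ab(2) by linarith
      have mem: "(a, b - 1) \<in> S" using diagram_down[OF S ab(1), of a "b - 1"] pos b1 by simp
      have "b - 1 \<noteq> b0"
      proof
        assume "b - 1 = b0"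
        then have "a = a0" using eq l by simp
        then show False using mem miss \<open>b - 1 = b0\<close> by simp
      qed
      then show ?thesis using True mem eq by (auto simp: q f_def ladder_def m_def)
    next
      case False
      then have "m * (b - 1) \<le> m * (b0 - 1)" by (intro mult_left_mono) auto
      then have am: "a0 + m \<le> a" using ab(2) l by linarith
      have mem: "(a - m, b) \<in> S" using diagram_down[OF S ab(1), of "a - m" b] pos am miss by simp
      have eq: "(a - m) + m * (b - 1) = l" using ab(2) am by linarith
      have "b \<noteq> b0"
      proof
        assume "b = b0"
        then have "a - m = a0" using eq l by simp
        then show False using mem miss \<open>b = b0\<close> by simp
      qed
      then show ?thesis using False mem eq am miss by (auto simp: q f_def ladder_def m_def)
    qed
  qed
  have "inj_on f {q \<in> S. ladder e q = l + m}"
  proof (rule inj_onI)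
    fix q q' assume h: "q \<in> {q \<in> S. ladder e q = l + m}" "q' \<in> {q \<in> S. ladder e q = l + m}" "f q = f q'"
    have "b0 < snd q \<longleftrightarrow> b0 < snd q'" using im[OF h(1)] im[OF h(2)] h(3) by simp
    then show "q = q'" using h(3) im[OF h(1)] im[OF h(2)]
      by (cases q; cases q'; cases "b0 < snd q") (auto simp: f_def)
  qed
  moreover have "f ` {q \<in> S. ladder e q = l + m} \<subseteq> {q \<in> S. ladder e q = l}" using im by blast
  ultimately show ?thesis unfolding ladder_count_def m_def[symmetric]
    using diagram_finite[OF S] by (intro card_inj_on_le[of f]) auto
qed

text \<open>Iteration is possible because every position to the right of a missing one is missing
  too and provides the gap for the next ladder.\<close>

lemma ladder_count_later:
  assumes miss: "(a0, b0) \<notin> S" "1 \<le> a0" "1 \<le> b0" "ladder e (a0, b0) = l"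
  shows "ladder_count e S (l + (e - 1) * k) \<le> ladder_count e S l"
proof (induction k)
  case (Suc k)
  have "(a0, b0 + k) \<notin> S" using miss diagram_down[OF S, of a0 "b0 + k" a0 b0] by auto
  moreover have "ladder e (a0, b0 + k) = l + (e - 1) * k"
  proof -
    have "b0 + k - 1 = (b0 - 1) + k" using miss by simp
    then show ?thesis using miss(4) by (simp add: ladder_def add_mult_distrib2)
  qed
  ultimately have le: "ladder_count e S ((l + (e - 1) * k) + (e - 1)) \<le> ladder_count e S (l + (e - 1) * k)"
    using miss by (intro ladder_count_step[of a0 "b0 + k"]) auto
  have eq: "l + (e - 1) * Suc k = (l + (e - 1) * k) + (e - 1)" by simp
  show ?case unfolding eq by (rule order_trans[OF le Suc])
qed simp

text \<open>A row of the regularisation is empty as soon as the ladder through its first node has a gap: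
  gaps propagate to the parallel ladders further right.\<close>
lemma reg_set_row_nonempty:
  assumes a: "1 \<le> a"
  shows "{b. (a, b) \<in> reg_set e S} \<noteq> {} \<longleftrightarrow> ladder_full e S a"
proof
  assume "ladder_full e S a"
  then have "(a, 1) \<in> reg_set e S"
    using ladder_count_full[of a] ladder_positions_card[OF e a] a by (simp add: reg_set_iff[OF e] ladder_def)
  then show "{b. (a, b) \<in> reg_set e S} \<noteq> {}" by auto
next
  assume "{b. (a, b) \<in> reg_set e S} \<noteq> {}"
  then obtain b where b: "1 \<le> b" "(a - 1) div (e - 1) < ladder_count e S (a + (e - 1) * (b - 1))"
    by (auto simp: reg_set_iff[OF e] ladder_def)
  show "ladder_full e S a"
  proof (rule ccontr)
    assume nf: "\<not> ladder_full e S a"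
    then obtain a0 b0 where "(a0, b0) \<notin> S" "1 \<le> a0" "1 \<le> b0" "ladder e (a0, b0) = a"
      by (auto simp: ladder_full_def ladder_positions_def)
    \<comment> \<open>Ladder a holds \<open>Suc ((a - 1) div (e - 1))\<close> positions, so a gap
      leaves at most \<open>(a - 1) div (e - 1)\<close> nodes, one too few to fill row a on this
      ladder or a later one.\<close>
    from ladder_count_later[OF this, of "b - 1"] ladder_count_not_full[OF nf] ladder_positions_card[OF e a] b
    show False by linarith
  qed
qed

lemma ladder_full_Suc: "1 \<le> a \<Longrightarrow> ladder_full e S (Suc a) \<Longrightarrow> ladder_full e S a"
  unfolding ladder_full_def
proof
  fix p assume h: "ladder_positions e (Suc a) \<subseteq> S" "p \<in> ladder_positions e a"
  obtain c d where p: "p = (c, d)" by (cases p)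
  have "(Suc c, d) \<in> ladder_positions e (Suc a)" using h(2) by (auto simp: p ladder_positions_def ladder_def)
  then have "(Suc c, d) \<in> S" using h(1) by blast
  then show "p \<in> S" using h(2) diagram_down[OF S, of "Suc c" d c d] by (auto simp: p ladder_positions_def)
qed

text \<open>Counts full ladders, a condition on \<open>S\<close> itself;
  \<open>reg_set_row_nonempty\<close> identifies them with the nonempty rows.\<close>

definition reg_rows :: nat where
  "reg_rows = card {a. 1 \<le> a \<and> ladder_full e S a}"

lemma ladder_full_mem: "1 \<le> a \<Longrightarrow> ladder_full e S a \<Longrightarrow> (a, 1) \<in> S"
  by (auto simp: ladder_full_def ladder_positions_def ladder_def)

lemma reg_rows_set: "{a. 1 \<le> a \<and> ladder_full e S a} = {1..reg_rows}"
  unfolding reg_rows_def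
proof (rule downward_closed_initial)
  show "finite {a. 1 \<le> a \<and> ladder_full e S a}"
    by (rule finite_subset[of _ "{..card S}"]) (use ladder_full_mem diagram_card_bound[OF S] in auto)
  fix i j assume h: "j \<in> {a. 1 \<le> a \<and> ladder_full e S a}" "1 \<le> i" "i \<le> j"
  have "ladder_full e S i" using h(3)
  proof (induction rule: inc_induct)
    case base
    then show ?case using h by simp
  next
    case (step k)
    then show ?case using ladder_full_Suc[of k] h(2) by simp
  qed
  then show "i \<in> {a. 1 \<le> a \<and> ladder_full e S a}" using h by simp
qed simp

lemma ladder_full_iff: "1 \<le> a \<Longrightarrow> ladder_full e S a \<longleftrightarrow> a \<le> reg_rows"
  using reg_rows_set by (metis (mono_tags, lifting) atLeastAtMost_iff mem_Collect_eq)

lemma reg_rows_le: "reg_rows \<le> card S"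
  using ladder_full_iff[of reg_rows] ladder_full_mem[of reg_rows] diagram_card_bound(1)[OF S, of reg_rows 1]
  by (cases "reg_rows = 0") auto

lemma reg_rows_less:
  assumes "(a, b) \<notin> S" "1 \<le> a" "1 \<le> b"
  shows "reg_rows < a + (e - 1) * (b - 1)"
proof (rule ccontr)
  assume "\<not> reg_rows < a + (e - 1) * (b - 1)"
  then have "ladder_full e S (ladder e (a, b))"
    using assms ladder_full_iff[of "ladder e (a, b)"] by (simp add: ladder_def)
  then show False using assms by (auto simp: ladder_full_def ladder_positions_def)
qed

lemma reg_rows_witness:
  obtains a b where "(a, b) \<notin> S" "1 \<le> a" "1 \<le> b" "a + (e - 1) * (b - 1) = Suc reg_rows"
  using ladder_full_iff[of "Suc reg_rows"] by (auto simp: ladder_full_def ladder_positions_def ladder_def)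

lemma reg_set_node:
  assumes "(a, b) \<in> reg_set e S"
  obtains c d where "(c, d) \<in> S" "c + (e - 1) * (d - 1) = a + (e - 1) * (b - 1)"
proof -
  have "0 < card {q \<in> S. ladder e q = ladder e (a, b)}"
    using assms reg_set_iff[OF e] by (auto simp: ladder_count_def)
  then have "{q \<in> S. ladder e q = ladder e (a, b)} \<noteq> {}" by (metis card.empty less_irrefl)
  then show ?thesis using that by (auto simp: ladder_def)
qed

text \<open>The ladder of (a, b) contains some node (c, d) of the diagram. Since e - 1 is at least
  1, sliding that node up gains at most c - 1 columns.\<close>

lemma reg_set_col_bound:
  assumes ab: "(a, b) \<in> reg_set e S" and M: "\<And>c d. (c, d) \<in> S \<Longrightarrow> c + d \<le> M"
  shows "b < M"
proof -
  obtain c d where cd: "(c, d) \<in> S" "c + (e - 1) * (d - 1) = a + (e - 1) * (b - 1)" using reg_set_node[OF ab] .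
  have pos: "1 \<le> c" "1 \<le> d" "1 \<le> a" "1 \<le> b" using diagram_pos[OF S cd(1)] ab reg_set_iff[OF e] by auto
  have "1 * (c - 1) \<le> (e - 1) * (c - 1)" using e by (intro mult_right_mono) auto
  then have "(e - 1) * (b - 1) \<le> (e - 1) * ((c - 1) + (d - 1))"
    unfolding add_mult_distrib2 using cd(2) pos by linarith
  then have "b - 1 \<le> (c - 1) + (d - 1)" using e by (simp add: mult_le_cancel1)
  then show ?thesis using M[OF cd(1)] pos by linarith
qed

text \<open>A position in the first row has nothing above it on its ladder, so one node on the
  ladder suffices to fill it.\<close>

lemma reg_set_first_row: "(1, b) \<in> S \<Longrightarrow> (1, b) \<in> reg_set e S"
proof -
  assume b: "(1, b) \<in> S"
  then have "0 < ladder_count e S (ladder e (1, b))"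
    using diagram_finite[OF S] by (auto simp: ladder_count_def card_gt_0_iff)
  then show ?thesis using diagram_pos[OF S b] by (simp add: reg_set_iff[OF e])
qed

lemma finite_reg_set: "finite (reg_set e S)"
proof -
  have "finite (ladder e ` S)" using diagram_finite[OF S] by simp
  then have "finite (\<Union>l\<in>ladder e ` S. ladder_positions e l)"
    by (rule finite_UN_I) (rule ladder_positions_finite[OF e])
  moreover have "reg_set e S \<subseteq> (\<Union>l\<in>ladder e ` S. ladder_positions e l)"
  proof
    fix p assume p: "p \<in> reg_set e S"
    obtain a b where ab: "p = (a, b)" by (cases p)
    obtain c d where "(c, d) \<in> S" "c + (e - 1) * (d - 1) = a + (e - 1) * (b - 1)"
      using reg_set_node p ab by metis
    then have "ladder e (a, b) = ladder e (c, d)" by (simp add: ladder_def)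
    then have "ladder e (a, b) \<in> ladder e ` S" using \<open>(c, d) \<in> S\<close> by (rule image_eqI)
    moreover have "p \<in> ladder_positions e (ladder e (a, b))" using p by (auto simp: ab ladder_positions_def reg_set_def)
    ultimately show "p \<in> (\<Union>l\<in>ladder e ` S. ladder_positions e l)" by (rule UN_I)
  qed
  ultimately show ?thesis by (rule finite_subset[rotated])
qed

end

section \<open>Preservation of the number of nodes\<close>

lemma card_lower_rank:
  fixes f :: "'a \<Rightarrow> nat"
  assumes P: "finite P" and inj: "inj_on f P" and N: "N \<le> card P"
  shows "card {p \<in> P. card {q \<in> P. f q < f p} < N} = N"
proof -
  define r where "r p = card {q \<in> P. f q < f p}" for p
  have less: "r p < r p'" if "p \<in> P" "p' \<in> P" "f p < f p'" for p p'
    unfolding r_def using P that by (intro psubset_card_mono) auto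
  have injr: "inj_on r P"
  proof (rule inj_onI)
    fix p p' assume h: "p \<in> P" "p' \<in> P" "r p = r p'"
    then have "f p = f p'" using less[of p p'] less[of p' p] by (metis less_irrefl linorder_neqE_nat)
    then show "p = p'" using inj h by (auto dest: inj_onD)
  qed
  have "r ` P \<subseteq> {..<card P}"
    unfolding r_def using P by (auto intro!: psubset_card_mono)
  moreover have "card (r ` P) = card {..<card P}" using injr by (simp add: card_image)
  ultimately have im: "r ` P = {..<card P}" by (intro card_subset_eq) auto
  have "r ` {p \<in> P. r p < N} = {..<N}"
  proof
    show "{..<N} \<subseteq> r ` {p \<in> P. r p < N}"
    proof
      fix k assume k: "k \<in> {..<N}"
      then have "k \<in> r ` P" using N im by auto
      then show "k \<in> r ` {p \<in> P. r p < N}" using k by auto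
    qed
  qed auto
  moreover have "inj_on r {p \<in> P. r p < N}" using injr by (rule inj_on_subset) auto
  ultimately have "card {p \<in> P. r p < N} = N" using card_image by fastforce
  then show ?thesis by (simp add: r_def)
qed

text \<open>Summed ladder by ladder: each one keeps its number of nodes. The size matters because
  \<open>omega_tilde\<close> rescales by the sum of the regularised partition.\<close>

lemma card_reg_set:
  assumes e: "2 \<le> e" and S: "diagram S"
  shows "card (reg_set e S) = card S"
proof -
  let ?L = "ladder e ` S \<union> ladder e ` reg_set e S"
  have fin: "finite S" "finite (reg_set e S)" using S diagram_finite finite_reg_set[OF e S] by auto
  have each: "card {p \<in> reg_set e S. ladder e p = l} = card {p \<in> S. ladder e p = l}" for l
  proof -
    have "{p \<in> reg_set e S. ladder e p = l} =
      {p \<in> ladder_positions e l. card {q \<in> ladder_positions e l. fst q < fst p} < ladder_count e S l}"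
      by (auto simp: reg_set_def ladder_positions_def)
    also have "card \<dots> = ladder_count e S l"
    proof (rule card_lower_rank)
      show "inj_on fst (ladder_positions e l)"
        using e by (auto simp: inj_on_def ladder_positions_def ladder_def)
    qed (use ladder_positions_finite[OF e] ladder_count_le[OF e S] in auto)
    finally show ?thesis by (simp add: ladder_count_def)
  qed
  have "(\<Sum>l\<in>?L. \<Sum>p\<in>{p \<in> reg_set e S. ladder e p = l}. 1) = (\<Sum>p\<in>reg_set e S. 1::nat)"
    using fin by (intro sum.group) auto
  moreover have "(\<Sum>l\<in>?L. \<Sum>p\<in>{p \<in> S. ladder e p = l}. 1) = (\<Sum>p\<in>S. 1::nat)"
    using fin by (intro sum.group) auto
  ultimately show ?thesis using each by simp
qed

section \<open>From partitions to diagrams\<close>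

lemma young_iff: "(a, b) \<in> young lam \<longleftrightarrow> 1 \<le> a \<and> a \<le> length lam \<and> 1 \<le> b \<and> b \<le> lam ! (a - 1)"
  by (simp add: young_def)

lemma young_Sigma: "young lam = (SIGMA a:{1..length lam}. {1..lam ! (a - 1)})"
  by (auto simp: young_def)

lemma card_young: "card (young lam) = sum_list lam"
proof -
  have "card (young lam) = (\<Sum>a\<in>{1..length lam}. lam ! (a - 1))"
    unfolding young_Sigma by simp
  also have "\<dots> = (\<Sum>i\<in>{0..<length lam}. lam ! i)"
    by (rule sum.reindex_bij_witness[where i = Suc and j = "\<lambda>a. a - 1"]) auto
  finally show ?thesis by (simp add: sum_list_sum_nth)
qed

lemma diagram_young:
  assumes "is_partition n lam"
  shows "diagram (young lam)"
  unfolding diagram_def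
proof (intro conjI allI impI)
  show "finite (young lam)" unfolding young_Sigma by simp
  fix a b a' b' assume h: "(a, b) \<in> young lam" "1 \<le> a'" "a' \<le> a" "1 \<le> b'" "b' \<le> b"
  have "lam ! (a - 1) \<le> lam ! (a' - 1)"
  proof (cases "a' = a")
    case False
    then have "a' - 1 < a - 1" "a - 1 < length lam" using h by (auto simp: young_iff)
    then show ?thesis using assms unfolding is_partition_def by (auto dest: sorted_wrt_nth_less)
  qed simp
  then show "(a', b') \<in> young lam" using h by (auto simp: young_iff)
qed (auto simp: young_iff)

lemma young_inj:
  assumes "is_partition n lam" "is_partition n mu" "young lam = young mu"
  shows "lam = mu"
proof (rule nth_equalityI)
  have row: "card {b. (Suc i, b) \<in> young xs} = (if i < length xs then xs ! i else 0)" for xs i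
  proof -
    have "{b. (Suc i, b) \<in> young xs} = (if i < length xs then {1..xs ! i} else {})" by (auto simp: young_iff)
    then show ?thesis by simp
  qed
  have pos: "i < length xs \<longleftrightarrow> 0 < card {b. (Suc i, b) \<in> young xs}" if "is_partition n xs" for i xs
    using that unfolding row is_partition_def by auto
  have "i < length lam \<longleftrightarrow> i < length mu" for i using pos[OF assms(1)] pos[OF assms(2)] assms(3) by simp
  then show "length lam = length mu" by (metis linorder_neqE_nat less_irrefl)
  then show "lam ! i = mu ! i" if "i < length lam" for i
    using row[of i lam] row[of i mu] assms(3) that by simp
qed

lemma plancherel_eq:
  assumes "lam \<in> partitions n"
  shows "plancherel n lam = (sdim (young lam))\<^sup>2 / fact n" "young lam \<in> shapes n"
proof -
  have p: "is_partition n lam" using assms by (simp add: partitions_def)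
  have "std lam = syt (young lam)" by (simp add: std_def syt_def card_young)
  then show "plancherel n lam = (sdim (young lam))\<^sup>2 / fact n" by (simp add: plancherel_def sdim_def)
  show "young lam \<in> shapes n" using diagram_young[OF p] p by (simp add: shapes_def card_young is_partition_def)
qed

text \<open>Injectivity of \<open>young\<close> bounds the mass of the bad partitions by the failure
  probability over diagrams.\<close>

lemma plancherel_transfer:
  assumes w: "whp Q"
    and imp: "eventually (\<lambda>n. \<forall>lam\<in>partitions n. Q n (young lam) \<longrightarrow> \<not> bad lam) sequentially"
  shows "(\<lambda>n. \<Sum>lam\<in>{lam \<in> partitions n. bad lam}. plancherel n lam) \<longlonglongrightarrow> 0"
proof (rule tendsto_sandwich[OF _ _ tendsto_const w[unfolded whp_def]])
  show "eventually (\<lambda>n. 0 \<le> (\<Sum>lam\<in>{lam \<in> partitions n. bad lam}. plancherel n lam)) sequentially"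
    by (intro always_eventually allI sum_nonneg) (simp add: plancherel_def)
  show "eventually (\<lambda>n. (\<Sum>lam\<in>{lam \<in> partitions n. bad lam}. plancherel n lam)
     \<le> expect n (\<lambda>S. of_bool (\<not> Q n S))) sequentially"
    using imp
  proof eventually_elim
    case (elim n)
    have inj: "inj_on young (partitions n)" by (rule inj_onI) (auto simp: partitions_def intro: young_inj)
    have "(\<Sum>lam\<in>{lam \<in> partitions n. bad lam}. plancherel n lam)
      = (\<Sum>lam\<in>{lam \<in> partitions n. bad lam}. (sdim (young lam))\<^sup>2 / fact n * of_bool (\<not> Q n (young lam)))"
      using elim plancherel_eq(1) by (intro sum.cong refl) auto
    also have "\<dots> = (\<Sum>S\<in>young ` {lam \<in> partitions n. bad lam}. (sdim S)\<^sup>2 / fact n * of_bool (\<not> Q n S))"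
      by (subst sum.reindex) (auto intro: inj_on_subset[OF inj])
    also have "\<dots> \<le> expect n (\<lambda>S. of_bool (\<not> Q n S))"
      unfolding expect_def using plancherel_eq(2) finite_shapes by (intro sum_mono2) auto
    finally show ?case .
  qed
qed

section \<open>The ends of the profile in Russian coordinates\<close>

lemma node_square_iff:
  "(x, y) \<in> node_square (a, b) \<longleftrightarrow> \<bar>x - (real a - real b)\<bar> + \<bar>y - (real a + real b - 1)\<bar> \<le> 1"
  by (simp add: node_square_def)

text \<open>The square of (a, b) lies in y - x <= 2 b and y + x <= 2 a; a point of it with y > |x|
  therefore has -b < x < a.\<close>

lemma omega_ne_abs_bounds:
  assumes "omega mu x \<noteq> \<bar>x\<bar>"
  obtains a b where "(a, b) \<in> young mu" "- real b < x" "x < real a"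
proof -
  define Y where "Y = {y. \<exists>p\<in>young mu. (x, y) \<in> node_square p}"
  have Y: "Y \<noteq> {}" "\<bar>x\<bar> < Sup Y"
    using assms by (auto simp: omega_def Let_def Y_def[symmetric] split: if_splits)
  obtain y where y: "y \<in> Y" "\<bar>x\<bar> < y" using less_cSupD[OF Y] by blast
  then obtain a b where ab: "(a, b) \<in> young mu" "(x, y) \<in> node_square (a, b)" by (auto simp: Y_def)
  show ?thesis by (rule that[OF ab(1)]) (use ab(2) y(2) in \<open>unfold node_square_iff, linarith+\<close>)
qed

text \<open>One point of a square strictly above |x| is enough, the heights being bounded so that
  \<open>Sup\<close> really is an upper bound.\<close>

lemma omega_ne_absI:
  assumes ab: "(a, b) \<in> young mu" and sq: "(x, y) \<in> node_square (a, b)" and y: "\<bar>x\<bar> < y"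
  shows "omega mu x \<noteq> \<bar>x\<bar>"
proof -
  define Y where "Y = {y. \<exists>p\<in>young mu. (x, y) \<in> node_square p}"
  have yY: "y \<in> Y" using ab sq by (auto simp: Y_def)
  have "bdd_above Y"
  proof -
    have fin: "finite ((\<lambda>p. real (fst p) + real (snd p)) ` young mu)" unfolding young_Sigma by simp
    show ?thesis
    proof (rule bdd_aboveI)
      fix z assume "z \<in> Y"
      then obtain c d where cd: "(c, d) \<in> young mu" "(x, z) \<in> node_square (c, d)" by (auto simp: Y_def)
      then have "z \<le> real c + real d" unfolding node_square_iff by linarith
      also have "\<dots> \<le> Max ((\<lambda>p. real (fst p) + real (snd p)) ` young mu)"
        using cd(1) by (intro Max_ge[OF fin]) force
      finally show "z \<le> Max ((\<lambda>p. real (fst p) + real (snd p)) ` young mu)" .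
    qed
  qed
  then have "y \<le> Sup Y" using yY by (rule cSup_upper[rotated])
  then show ?thesis using y yY by (auto simp: omega_def Let_def Y_def[symmetric])
qed

text \<open>Rows are nonempty exactly up to \<open>reg_rows\<close>, which is at most n, so
  \<open>takeWhile\<close> cuts the list of n row sizes at that place.\<close>

lemma reg_eq:
  assumes e: "2 \<le> e" and lam: "is_partition n lam"
  shows "reg e lam = map (\<lambda>a. card {b. (a, b) \<in> reg_set e (young lam)}) [1..<Suc (reg_rows e (young lam))]"
    and "sum_list (reg e lam) = n"
proof -
  define S where "S = young lam"
  define L where "L = reg_rows e S"
  define r where "r a = card {b. (a, b) \<in> reg_set e S}" for a
  have S: "diagram S" unfolding S_def by (rule diagram_young[OF lam])
  have n: "card S = n" "sum_list lam = n" using lam by (auto simp: S_def card_young is_partition_def)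
  have fin: "finite {b. (a, b) \<in> reg_set e S}" for a
  proof -
    have "{b. (a, b) \<in> reg_set e S} \<subseteq> snd ` reg_set e S" by force
    then show ?thesis using finite_reg_set[OF e S] finite_subset by blast
  qed
  have pos: "0 < r a \<longleftrightarrow> a \<le> L" if "1 \<le> a" for a
    using fin reg_set_row_nonempty[OF e S that] ladder_full_iff[OF e S that] by (simp add: r_def L_def card_gt_0_iff)
  have Ln: "L \<le> n" using reg_rows_le[OF e S] n by (simp add: L_def)
  have split: "[1..<Suc n] = [1..<Suc L] @ [Suc L..<Suc n]"
    using Ln upt_add_eq_append[of 1 "Suc L" "n - L"] by simp
  have "reg e lam = takeWhile (\<lambda>k. 0 < k) (map r [1..<Suc n])"
    unfolding reg_def reg_nodes_eq n r_def S_def ..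
  also have "\<dots> = map r [1..<Suc L] @ takeWhile (\<lambda>k. 0 < k) (map r [Suc L..<Suc n])"
    unfolding split map_append by (rule takeWhile_append2) (auto simp: pos)
  also have "takeWhile (\<lambda>k. 0 < k) (map r [Suc L..<Suc n]) = []"
    using pos by (cases "L < n") (auto simp: upt_conv_Cons simp del: upt_Suc)
  finally have reg: "reg e lam = map r [1..<Suc L]" by simp
  then show "reg e lam = map (\<lambda>a. card {b. (a, b) \<in> reg_set e (young lam)}) [1..<Suc (reg_rows e (young lam))]"
    by (simp add: r_def S_def L_def)
  have "reg_set e S = (SIGMA a:{1..L}. {b. (a, b) \<in> reg_set e S})"
  proof -
    have "a \<in> {1..L}" if "(a, b) \<in> reg_set e S" for a b
    proof -
      have a: "1 \<le> a" using that by (simp add: reg_set_def)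
      then show ?thesis using reg_set_row_nonempty[OF e S a] ladder_full_iff[OF e S a] that by (auto simp: L_def)
    qed
    then show ?thesis by auto
  qed
  then have "card (reg_set e S) = card (SIGMA a:{1..L}. {b. (a, b) \<in> reg_set e S})" by (rule arg_cong)
  also have "\<dots> = (\<Sum>a\<in>{1..L}. r a)" unfolding r_def by (rule card_SigmaI) (use fin in auto)
  finally have "card (reg_set e S) = (\<Sum>a\<in>{1..L}. r a)" .
  moreover have "sum_list (reg e lam) = (\<Sum>a\<in>{1..L}. r a)"
    unfolding reg by (simp add: sum_list_distinct_conv_sum_set atLeastLessThanSuc_atLeastAtMost del: upt_Suc)
  ultimately show "sum_list (reg e lam) = n" using card_reg_set[OF e S] n by simp
qed

text \<open>The bottom node of the first column fixes the right end exactly. The left end is the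
  first row of the regularisation, which contains the first row of the diagram and is bounded by
  M.\<close>

lemma reg_support:
  assumes e: "2 \<le> e" and lam: "is_partition n lam" and n: "0 < n"
    and M: "\<And>a b. (a, b) \<in> young lam \<Longrightarrow> real a + real b \<le> M"
  defines "U \<equiv> {s. omega_tilde (reg e lam) s \<noteq> \<bar>s\<bar>}"
  shows "Sup U = real (reg_rows e (young lam)) / sqrt (real n)"
    and "- M / sqrt (real n) \<le> Inf U"
    and "Inf U \<le> - real (arm_len (\<lambda>i. (1, i)) (young lam)) / sqrt (real n)"
proof -
  define S where "S = young lam"
  define L where "L = reg_rows e S"
  define mu where "mu = reg e lam"
  define q where "q = sqrt (real n)"
  have q: "0 < q" using n by (simp add: q_def)
  have S: "diagram S" unfolding S_def by (rule diagram_young[OF lam])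
  have cS: "card S = n" using lam by (auto simp: S_def card_young is_partition_def)
  have len: "length mu = L" and nth: "\<And>a. 1 \<le> a \<Longrightarrow> a \<le> L \<Longrightarrow> mu ! (a - 1) = card {b. (a, b) \<in> reg_set e S}"
    unfolding mu_def reg_eq(1)[OF e lam] L_def S_def by (auto simp del: upt_Suc)
  have sm: "sum_list mu = n" unfolding mu_def by (rule reg_eq(2)[OF e lam])
  have U: "s \<in> U \<longleftrightarrow> omega mu (s * q) \<noteq> \<bar>s * q\<bar>" for s
    unfolding U_def omega_tilde_def mu_def[symmetric] sm q_def[symmetric] using q
    by (auto simp: abs_mult field_simps)
  have U': "x / q \<in> U \<longleftrightarrow> omega mu x \<noteq> \<bar>x\<bar>" for x using U[of "x / q"] q by simp
  have "S \<noteq> {}" using cS n by auto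
  then obtain a b where "(a, b) \<in> S" by auto
  then have 11: "(1, 1) \<in> S" using diagram_down[OF S, of a b 1 1] diagram_pos[OF S, of a b] by simp
  have L1: "1 \<le> L"
  proof -
    have "{b. (1, b) \<in> reg_set e S} \<noteq> {}" using reg_set_first_row[OF e S 11] by auto
    then show ?thesis using reg_set_row_nonempty[OF e S, of 1] ladder_full_iff[OF e S, of 1] by (simp add: L_def)
  qed
  have rowfin: "finite {b. (a, b) \<in> reg_set e S}" for a
  proof -
    have "{b. (a, b) \<in> reg_set e S} \<subseteq> snd ` reg_set e S" by force
    then show ?thesis using finite_reg_set[OF e S] finite_subset by blast
  qed
  have colL: "(L, 1) \<in> young mu"
  proof -
    have "{b. (L, b) \<in> reg_set e S} \<noteq> {}"
      using reg_set_row_nonempty[OF e S L1] ladder_full_iff[OF e S L1] by (simp add: L_def)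
    then have "0 < mu ! (L - 1)" using nth[of L] L1 rowfin by (simp add: card_gt_0_iff)
    then show ?thesis using L1 by (simp add: young_iff len)
  qed
  have colM: "real b \<le> M" if ab: "(a, b) \<in> young mu" for a b
  proof -
    have a: "1 \<le> a" "a \<le> L" "b \<le> card {b. (a, b) \<in> reg_set e S}" using ab nth[of a] by (auto simp: young_iff len)
    have M': "c + d \<le> nat \<lfloor>M\<rfloor>" if "(c, d) \<in> S" for c d
    proof -
      have "real (c + d) \<le> M" using M that by (simp add: S_def)
      then show ?thesis by (simp add: le_nat_floor)
    qed
    have "{b. (a, b) \<in> reg_set e S} \<subseteq> {1..nat \<lfloor>M\<rfloor>}"
    proof
      fix b assume "b \<in> {b. (a, b) \<in> reg_set e S}"
      then show "b \<in> {1..nat \<lfloor>M\<rfloor>}" using reg_set_col_bound[OF e S _ M'] by (fastforce simp: reg_set_def)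
    qed
    then have "card {b. (a, b) \<in> reg_set e S} \<le> card {1..nat \<lfloor>M\<rfloor>}" by (intro card_mono) auto
    moreover have "0 \<le> M" using M[of 1 1] 11 by (simp add: S_def)
    ultimately show ?thesis using a(3) by simp linarith
  qed
  define C where "C = arm_len (\<lambda>i. (1, i)) S"
  have arm: "is_arm (\<lambda>i. (1, i))" by (simp add: is_arm_def)
  have C1: "1 \<le> C" using arm_mem[OF arm S, of 1] 11 by (simp add: C_def)
  have rowC: "(1, C) \<in> young mu"
  proof -
    have "{1..C} \<subseteq> {b. (1, b) \<in> reg_set e S}"
      using arm_mem[OF arm S] reg_set_first_row[OF e S] by (auto simp: C_def)
    then have "card {1..C} \<le> card {b. (1, b) \<in> reg_set e S}" using rowfin by (intro card_mono)
    then show ?thesis using nth[of 1] L1 C1 by (simp add: young_iff len)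
  qed
  have bounds: "- M / q < s \<and> s < real L / q" if sU: "s \<in> U" for s
  proof -
    obtain a b where ab: "(a, b) \<in> young mu" "- real b < s * q" "s * q < real a"
      by (rule omega_ne_abs_bounds[OF sU[unfolded U]])
    have "a \<le> L" using ab(1) by (simp add: young_iff len)
    then have "- M < s * q" "s * q < real L" using ab colM[OF ab(1)] by linarith+
    then show ?thesis using q by (simp add: field_simps)
  qed
  \<comment> \<open>The point taken is on the upper right side y = 2 L - x of the square of (L, 1);
    it is above |x| up to, but not at, x = L. The supremum is therefore only approached.\<close>
  have right: "x / q \<in> U" if x: "real L - 1 \<le> x" "x < real L" for x
    unfolding U'
  proof (rule omega_ne_absI[OF colL])
    show "(x, 2 * real L - x) \<in> node_square (L, 1)" using x unfolding node_square_iff by simp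
    show "\<bar>x\<bar> < 2 * real L - x" using x L1 by simp
  qed
  \<comment> \<open>Mirror image: the upper left side y = 2 C + x of the square of (1, C).\<close>
  have left: "x / q \<in> U" if x: "- real C < x" "x \<le> 1 - real C" for x
    unfolding U'
  proof (rule omega_ne_absI[OF rowC])
    show "(x, 2 * real C + x) \<in> node_square (1, C)" using x unfolding node_square_iff by simp
    show "\<bar>x\<bar> < 2 * real C + x" using x C1 by simp
  qed
  have ne: "U \<noteq> {}" using right[of "real L - 1"] by auto
  have above: "bdd_above U" by (rule bdd_aboveI[of _ "real L / q"]) (use bounds in force)
  have below: "bdd_below U" by (rule bdd_belowI[of _ "- M / q"]) (use bounds in force)
  have "Sup U = real L / q"
  proof (rule antisym)
    show "Sup U \<le> real L / q" by (rule cSup_least[OF ne]) (use bounds in force)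
    show "real L / q \<le> Sup U"
    proof (rule field_le_epsilon)
      fix r :: real assume r: "0 < r"
      define x where "x = max (real L - 1) (real L - r * q)"
      have "0 < r * q" using r q by simp
      then have "x / q \<in> U" by (intro right) (auto simp: x_def)
      then have "x / q \<le> Sup U" using above by (rule cSup_upper)
      moreover have "(real L - r * q) / q \<le> x / q" using q by (intro divide_right_mono) (auto simp: x_def)
      moreover have "(real L - r * q) / q = real L / q - r" using q by (simp add: diff_divide_distrib)
      ultimately show "real L / q \<le> Sup U + r" by linarith
    qed
  qed
  then show "Sup U = real (reg_rows e (young lam)) / sqrt (real n)" by (simp add: L_def S_def q_def)
  show "- M / sqrt (real n) \<le> Inf U" unfolding q_def[symmetric]
    by (rule cInf_greatest[OF ne]) (use bounds in force)
  have "Inf U \<le> - real C / q"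
  proof (rule field_le_epsilon)
    fix r :: real assume r: "0 < r"
    define x where "x = min (1 - real C) (- real C + r * q)"
    have "0 < r * q" using r q by simp
    then have "x / q \<in> U" by (intro left) (auto simp: x_def)
    then have "Inf U \<le> x / q" using below by (rule cInf_lower)
    moreover have "x / q \<le> (- real C + r * q) / q" using q by (intro divide_right_mono) (auto simp: x_def)
    moreover have "(- real C + r * q) / q = - real C / q + r" using q by (simp add: field_simps)
    ultimately show "Inf U \<le> - real C / q + r" by linarith
  qed
  then show "Inf U \<le> - real (arm_len (\<lambda>i. (1, i)) (young lam)) / sqrt (real n)" by (simp add: C_def S_def q_def)
qed

section \<open>The number of rows of the regularisation\<close>

lemma s_alpha_eq:
  assumes e: "2 \<le> e"
  defines "\<alpha> \<equiv> 1 - 2 / real e"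
  shows "s_alpha \<alpha> = real e / 2 * F_alpha \<alpha> (x_plus \<alpha>)" "0 \<le> \<alpha>" "\<alpha> < 1"
proof -
  have "1 - \<alpha> = 2 / real e" by (simp add: \<alpha>_def)
  then show "s_alpha \<alpha> = real e / 2 * F_alpha \<alpha> (x_plus \<alpha>)" by (simp add: s_alpha_def)
  show "0 \<le> \<alpha>" "\<alpha> < 1" using e by (auto simp: \<alpha>_def field_simps)
qed

text \<open>On a ladder, \<open>a + (e - 1) b = e / 2 ((a + b) - \<alpha> (a - b))\<close>: the number of rows of the
  regularisation is the minimum of a linear functional over the boundary of the diagram, which
  the limit shape turns into the minimum of \<open>F_alpha\<close>.\<close>
theorem reg_rows_limit:
  assumes e: "2 \<le> e" and eps: "0 < \<epsilon>"
  defines "\<alpha> \<equiv> 1 - 2 / real e"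
  shows "whp (\<lambda>n S. \<bar>real (reg_rows e S) / sqrt (real n) - s_alpha \<alpha>\<bar> \<le> \<epsilon>)"
proof -
  note sa = s_alpha_eq[OF e, folded \<alpha>_def]
  define x where "x = x_plus \<alpha>"
  note xp = x_plus_eq[OF sa(2,3), folded x_def]
  have e0: "0 < real e" using e by simp
  have ea: "real e / 2 * (1 - \<alpha>) = 1" "real e / 2 * (1 + \<alpha>) = real e - 1" using e by (simp_all add: \<alpha>_def field_simps)
  \<comment> \<open>An error \<eta> in a diagonal length changes the profile by 2 \<eta> and, after
    the factor e/2, the number of rows by \<open>real e * \<eta>\<close>, half of
    \<epsilon>.\<close>
  define \<eta> where "\<eta> = \<epsilon> / (2 * real e)"
  have eta: "0 < \<eta>" "real e * \<eta> = \<epsilon> / 2" using eps e0 by (simp_all add: \<eta>_def)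
  have "(\<lambda>n. real e / sqrt (real n)) \<longlonglongrightarrow> 0" by real_asymp
  then have "eventually (\<lambda>n. real e / sqrt (real n) < \<epsilon> / 2) sequentially"
    by (rule order_tendstoD(2)) (use eps in simp)
  then have ev: "eventually (\<lambda>n. real e / sqrt (real n) < \<epsilon> / 2 \<and> 0 < n) sequentially"
    using eventually_gt_at_top[of 0] by eventually_elim auto
  have "whp (\<lambda>n S. (\<forall>c. \<bar>real_of_int c\<bar> \<le> 2 * sqrt (real n) \<longrightarrow>
    \<bar>real (diag_count S c) / sqrt (real n) - rho (real_of_int c / sqrt (real n))\<bar> \<le> \<eta>)
    \<and> \<bar>real (diag_count S \<lfloor>x * sqrt (real n)\<rfloor>) / sqrt (real n) - rho x\<bar> \<le> \<eta>)"
    using xp by (intro whp_conj diag_count_uniform diag_count_pointwise eta) auto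
  then show ?thesis
  proof (rule whp_mono[OF _ eventually_mono[OF ev]], intro allI impI)
    fix n S assume n: "real e / sqrt (real n) < \<epsilon> / 2 \<and> 0 < n" and S: "diagram S" "card S = n"
      and h: "(\<forall>c. \<bar>real_of_int c\<bar> \<le> 2 * sqrt (real n) \<longrightarrow>
    \<bar>real (diag_count S c) / sqrt (real n) - rho (real_of_int c / sqrt (real n))\<bar> \<le> \<eta>)
    \<and> \<bar>real (diag_count S \<lfloor>x * sqrt (real n)\<rfloor>) / sqrt (real n) - rho x\<bar> \<le> \<eta>"
    define q where "q = sqrt (real n)"
    have q: "0 < q" using n by (simp add: q_def)
    define L where "L = reg_rows e S"
    have lower: "s_alpha \<alpha> - \<epsilon> \<le> real L / q"
    proof -
      obtain a b where ab: "(a, b) \<notin> S" "1 \<le> a" "1 \<le> b" "a + (e - 1) * (b - 1) = Suc L"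
        using reg_rows_witness[OF e S(1)] unfolding L_def by metis
      define c where "c = int a - int b"
      define u where "u = real_of_int c / q"
      define v where "v = real (diag_count S c) / q"
      have "\<not> min a b \<le> diag_count S c" using ab(1) mem_diagram_iff[OF S(1) ab(2,3)] by (simp add: c_def)
      then have "Suc (diag_count S c) \<le> a" "Suc (diag_count S c) \<le> b" by auto
      \<comment> \<open>A missing position exceeds the length of its diagonal by at least one in
        both coordinates. The resulting 2 becomes e after the factor e/2 and cancels the -e in the
        formula for L.\<close>
      then have d: "\<bar>real_of_int c\<bar> + 2 * real (diag_count S c) + 2 \<le> real a + real b"
        unfolding c_def by linarith
      have "real (a + (e - 1) * (b - 1)) = real (Suc L)" using ab(4) by simp
      then have "real L + 1 = real a + (real e - 1) * (real b - 1)"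
        using ab(3) e by (simp add: of_nat_diff)
      also have "\<dots> = real e / 2 * ((real a + real b) - \<alpha> * real_of_int c) - (real e - 1)"
      proof -
        have "real e / 2 * ((real a + real b) - \<alpha> * real_of_int c) = real e / 2 * (1 - \<alpha>) * real a + real e / 2 * (1 + \<alpha>) * real b"
          by (simp add: c_def algebra_simps add_divide_distrib diff_divide_distrib)
        then show ?thesis unfolding ea by (simp add: algebra_simps)
      qed
      finally have L: "real L = real e / 2 * ((real a + real b) - \<alpha> * real_of_int c) - real e" by simp
      \<comment> \<open>Beyond the edge \<open>Omega u\<close> is |u|, so there the inequality
        follows from v >= 0.\<close>
      have uv: "Omega u - 2 * \<eta> \<le> \<bar>u\<bar> + 2 * v"
      proof (cases "\<bar>real_of_int c\<bar> \<le> 2 * q")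
        case True
        then have "\<bar>v - rho u\<bar> \<le> \<eta>" using h by (simp add: v_def u_def q_def)
        then have "rho u - \<eta> \<le> v" unfolding abs_le_iff by linarith
        moreover have "2 * rho u = Omega u - \<bar>u\<bar>" by (simp add: rho_def)
        ultimately show ?thesis by linarith
      next
        case False
        then have "2 \<le> \<bar>u\<bar>" using q by (simp add: u_def field_simps)
        moreover have "0 \<le> v" using q by (simp add: v_def)
        ultimately show ?thesis using Omega_outside[of u] eta(1) by linarith
      qed
      have "q * (F_alpha \<alpha> x - 2 * \<eta>) \<le> q * (\<bar>u\<bar> + 2 * v - \<alpha> * u)"
        using F_alpha_min[OF sa(2,3), of u] uv q by (intro mult_left_mono) (auto simp: F_alpha_def x_def)
      also have "\<dots> = \<bar>real_of_int c\<bar> + 2 * real (diag_count S c) - \<alpha> * real_of_int c"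
        using q by (simp add: u_def v_def algebra_simps)
      also have "\<dots> \<le> (real a + real b) - \<alpha> * real_of_int c - 2" using d by linarith
      finally have "real e / 2 * (q * (F_alpha \<alpha> x - 2 * \<eta>)) \<le> real e / 2 * ((real a + real b) - \<alpha> * real_of_int c - 2)"
        using e0 by (intro mult_left_mono) auto
      also have "\<dots> = real L" unfolding L by (simp add: algebra_simps)
      finally have "q * (s_alpha \<alpha> - real e * \<eta>) \<le> real L" unfolding sa(1) x_def by (simp add: algebra_simps)
      then have "s_alpha \<alpha> - real e * \<eta> \<le> real L / q" using q by (simp add: field_simps)
      then show ?thesis using eta eps by linarith
    qed
    have upper: "real L / q \<le> s_alpha \<alpha> + \<epsilon>"
    proof -
      define c where "c = \<lfloor>x * q\<rfloor>"
      have c0: "0 \<le> c" using xp q by (simp add: c_def)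
      define d where "d = diag_count S c"
      \<comment> \<open>The witness (a, d + 1) is the first missing position on the diagonal nearest
        to the minimiser x.\<close>
      define a where "a = nat c + d + 1"
      have ab: "(a, d + 1) \<notin> S" using mem_diagram_iff[OF S(1), of a "d + 1"] c0 by (simp add: a_def d_def)
      have "L < a + (e - 1) * (d + 1 - 1)" unfolding L_def by (rule reg_rows_less[OF e S(1) ab]) (auto simp: a_def)
      then have "L \<le> nat c + d + (e - 1) * d" by (simp add: a_def)
      also have "\<dots> = nat c + e * d" using e by (cases e) auto
      finally have "L \<le> nat c + e * d" .
      then have "real L \<le> real (nat c + e * d)" by (simp only: of_nat_le_iff)
      then have "real L \<le> real_of_int c + real e * real d" using c0 by simp
      also have "real_of_int c \<le> x * q" by (simp add: c_def)
      finally have "real L \<le> x * q + real e * real d" by simp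
      then have "real L / q \<le> (x * q + real e * real d) / q" using q by (intro divide_right_mono) auto
      also have "\<dots> = x + real e * (real d / q)" using q by (simp add: add_divide_distrib)
      also have "\<dots> \<le> x + real e * (rho x + \<eta>)"
      proof -
        have "\<bar>real d / q - rho x\<bar> \<le> \<eta>" using h by (simp add: d_def c_def q_def)
        then have "real d / q \<le> rho x + \<eta>" unfolding abs_le_iff by linarith
        then show ?thesis using e0 by (intro add_left_mono mult_left_mono) auto
      qed
      also have "\<dots> = real e / 2 * (1 - \<alpha>) * x + real e / 2 * (Omega x - x) + real e * \<eta>"
      proof -
        have "\<bar>x\<bar> = x" using xp(2) by simp
        then show ?thesis unfolding ea rho_def by (simp add: algebra_simps add_divide_distrib diff_divide_distrib)
      qed
      also have "\<dots> = s_alpha \<alpha> + real e * \<eta>"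
        unfolding sa(1) F_alpha_def x_def[symmetric] by (simp add: algebra_simps add_divide_distrib diff_divide_distrib)
      finally show ?thesis using eta eps by linarith
    qed
    show "\<bar>real (reg_rows e S) / sqrt (real n) - s_alpha \<alpha>\<bar> \<le> \<epsilon>"
      using lower upper unfolding L_def q_def by linarith
  qed
qed

theorem theorem6p2:
  fixes e :: nat
  assumes "2 \<le> e"
  defines "\<alpha> \<equiv> 1 - 2 / real e"
  shows "(\<forall>\<epsilon>>0. (\<lambda>n. \<Sum>lam\<in>{lam \<in> partitions n.
              \<bar>Inf {s. omega_tilde (reg e lam) s \<noteq> \<bar>s\<bar>} - (-2)\<bar> > \<epsilon>}. plancherel n lam)
            \<longlonglongrightarrow> 0)
    \<and> (\<forall>\<epsilon>>0. (\<lambda>n. \<Sum>lam\<in>{lam \<in> partitions n.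
              \<bar>Sup {s. omega_tilde (reg e lam) s \<noteq> \<bar>s\<bar>} - s_alpha \<alpha>\<bar> > \<epsilon>}. plancherel n lam)
            \<longlonglongrightarrow> 0)"
proof (intro conjI allI impI)
  fix \<epsilon> :: real assume eps: "0 < \<epsilon>"
  have arm: "is_arm (\<lambda>i. (1, i))" by (simp add: is_arm_def)
  have Q: "whp (\<lambda>n S. (\<forall>(a, b)\<in>S. real a + real b \<le> (2 + \<epsilon>) * sqrt (real n))
      \<and> (2 - \<epsilon>) * sqrt (real n) \<le> real (arm_len (\<lambda>i. (1, i)) S))"
    by (intro whp_conj node_sum_bound arm_len_lower arm eps)
  show "(\<lambda>n. \<Sum>lam\<in>{lam \<in> partitions n.
              \<bar>Inf {s. omega_tilde (reg e lam) s \<noteq> \<bar>s\<bar>} - (-2)\<bar> > \<epsilon>}. plancherel n lam) \<longlonglongrightarrow> 0"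
  proof (rule plancherel_transfer[OF Q eventually_mono[OF eventually_gt_at_top[of 0]]], intro ballI impI)
    fix n lam assume n: "0 < n" and lam: "lam \<in> partitions n"
      and h: "(\<forall>(a, b)\<in>young lam. real a + real b \<le> (2 + \<epsilon>) * sqrt (real n))
      \<and> (2 - \<epsilon>) * sqrt (real n) \<le> real (arm_len (\<lambda>i. (1, i)) (young lam))"
    have p: "is_partition n lam" using lam by (simp add: partitions_def)
    define q where "q = sqrt (real n)"
    have q: "0 < q" using n by (simp add: q_def)
    define I where "I = Inf {s. omega_tilde (reg e lam) s \<noteq> \<bar>s\<bar>}"
    have M: "real a + real b \<le> (2 + \<epsilon>) * q" if "(a, b) \<in> young lam" for a b
      using h that unfolding q_def by blast
    have "- ((2 + \<epsilon>) * q) / q \<le> I"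
      unfolding I_def q_def by (rule reg_support(2)[OF assms(1) p n M[unfolded q_def]])
    then have 1: "- (2 + \<epsilon>) \<le> I" using q by simp
    have "I \<le> - real (arm_len (\<lambda>i. (1, i)) (young lam)) / q"
      unfolding I_def q_def by (rule reg_support(3)[OF assms(1) p n M[unfolded q_def]])
    also have "\<dots> \<le> - ((2 - \<epsilon>) * q) / q" using h q unfolding q_def[symmetric] by (intro divide_right_mono) auto
    also have "\<dots> = - (2 - \<epsilon>)" using q by simp
    finally show "\<not> \<bar>Inf {s. omega_tilde (reg e lam) s \<noteq> \<bar>s\<bar>} - (-2)\<bar> > \<epsilon>"
      using 1 unfolding I_def[symmetric] by linarith
  qed
next
  fix \<epsilon> :: real assume eps: "0 < \<epsilon>"
  have Q: "whp (\<lambda>n S. \<bar>real (reg_rows e S) / sqrt (real n) - s_alpha \<alpha>\<bar> \<le> \<epsilon>)"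
    unfolding \<alpha>_def by (rule reg_rows_limit[OF assms(1) eps])
  show "(\<lambda>n. \<Sum>lam\<in>{lam \<in> partitions n.
              \<bar>Sup {s. omega_tilde (reg e lam) s \<noteq> \<bar>s\<bar>} - s_alpha \<alpha>\<bar> > \<epsilon>}. plancherel n lam) \<longlonglongrightarrow> 0"
  proof (rule plancherel_transfer[OF Q eventually_mono[OF eventually_gt_at_top[of 0]]], intro ballI impI)
    fix n lam assume n: "0 < n" and lam: "lam \<in> partitions n"
      and h: "\<bar>real (reg_rows e (young lam)) / sqrt (real n) - s_alpha \<alpha>\<bar> \<le> \<epsilon>"
    have p: "is_partition n lam" using lam by (simp add: partitions_def)
    \<comment> \<open>Gives the crude bound M = 2 n with which \<open>reg_support\<close> is
      instantiated to read off its formula for the supremum.\<close>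
    have "a \<le> n \<and> b \<le> n" if "(a, b) \<in> young lam" for a b
      using diagram_card_bound[OF diagram_young[OF p] that] p by (simp add: card_young is_partition_def)
    then have "real a + real b \<le> 2 * real n" if "(a, b) \<in> young lam" for a b
      using that by fastforce
    from reg_support(1)[OF assms(1) p n this] h
    show "\<not> \<bar>Sup {s. omega_tilde (reg e lam) s \<noteq> \<bar>s\<bar>} - s_alpha \<alpha>\<bar> > \<epsilon>" by simp
  qed
qed

end
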